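(* Let $X$ be a Grothendieck category with localizing subcategory $Y$, and let $\mathcal{X} = X/Y$ with quotient functor $\pi:X\to\mathcal{X}$. Then there are inverse bijections $$\phi:\{ Y\text{-weakly closed subcategories } Z \subseteq X \} \to \{\text{weakly closed subcategories } \mathcal{Z} \subseteq \mathcal{X} \},\qquad \phi(Z)=\pi(Z),$$ $$\psi:\{\text{weakly closed subcategories } \mathcal{Z} \subseteq \mathcal{X} \}\to \{ Y\text{-weakly closed subcategories } Z \subseteq X \},\qquad \psi(\mathcal{Z})=(\pi^{-1}(\mathcal{Z}))'.$$
   Context: A Grothendieck category is an abelian category with arbitrary small direct sums, exact small filtered colimits, and a generator. All subcategories are full. A full subcategory is weakly closed if it is closed under subobjects, quotient objects and small direct sums; localizing if it is weakly closed and closed under extensions. The subcategory generated by a collection of objects is the full subcategory of all quotient objects of (small) direct sums of objects in the collection. For $Y$ localizing in $X$, $X/Y$ is the Gabriel quotient category, a Grothendieck category with exact quotient functor $\pi: X\to X/Y$ (the identity on objects), which has a right adjoint $\omega: X/Y\to X$. Each object $M\in X$ has a largest subobject $\tau(M)$ in $Y$; $M$ is $Y$-torsionfree if $\tau(M)=0$. A full subcategory $Z$ of $X$ is $Y$-essentially stable if $M\in Z$ implies $\omega\pi(M)\in Z$; it is $Y$-torsionfree generated if it is generated by the $Y$-torsionfree objects it contains; it is $Y$-weakly closed if it is weakly closed, $Y$-essentially stable and $Y$-torsionfree generated. Notation: $\pi(Z)=\{\pi(M)\mid M\in Z\}$ (understood up to isomorphism in $X/Y$); $\pi^{-1}(\mathcal{Z})=\{M\in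 X\mid \pi(M)\in\mathcal{Z}\}$; for a weakly closed $W\subseteq X$, $W'$ is the subcategory of $X$ generated by all $Y$-torsionfree objects in $W$. *)

theory Defs
  imports "HOL-Algebra.Group" "HOL-Library.Equipollence"
begin

section \<open>Smallness\<close>

text \<open>
  Smallness is relative to a Grothendieck universe, of which only the cardinality matters. It is
  represented by a set \<open>U\<close> of that cardinality: a set, of any type, is small if it has strictly
  fewer elements than \<open>U\<close>. The two closure conditions say that \<open>card U\<close> is a regular strong
  limit cardinal. It need not be uncountable (so \<open>U = (UNIV :: nat set)\<close> is admitted);
  every uncountable universe is covered.
\<close>

definition small :: "'u set \<Rightarrow> 'b set \<Rightarrow> bool" where
  "small U A \<longleftrightarrow> A \<prec> U"

definition universe :: "'u set \<Rightarrow> bool" where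
  "universe U \<longleftrightarrow> infinite U \<and>
     (\<forall>A :: 'u set. small U A \<longrightarrow> small U (Pow A)) \<and>
     (\<forall>(I :: 'u set) (F :: 'u \<Rightarrow> 'u set).
        small U I \<longrightarrow> (\<forall>i\<in>I. small U (F i)) \<longrightarrow> small U (\<Union>i\<in>I. F i))"


section \<open>Categories\<close>

text \<open>\<open>g \<odot> f\<close> is the composite \<open>g \<circ> f\<close>; it is meaningful only for composable arrows.\<close>

record ('o, 'm) category =
  Ob :: "'o set"
  Hom :: "'o \<Rightarrow> 'o \<Rightarrow> 'm set"
  Id :: "'o \<Rightarrow> 'm"
  Comp :: "'m \<Rightarrow> 'm \<Rightarrow> 'm"  (infixl "\<odot>\<index>" 70)

locale category =
  fixes C :: "('o, 'm, 'z) category_scheme" (structure)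
  assumes Hom_Ob: "f \<in> Hom C A B \<Longrightarrow> A \<in> Ob C \<and> B \<in> Ob C"
    and Hom_disjoint: "\<lbrakk>f \<in> Hom C A B; f \<in> Hom C A' B'\<rbrakk> \<Longrightarrow> A = A' \<and> B = B'"
    and Id_Hom: "A \<in> Ob C \<Longrightarrow> Id C A \<in> Hom C A A"
    and Comp_Hom: "\<lbrakk>f \<in> Hom C A B; g \<in> Hom C B D\<rbrakk> \<Longrightarrow> g \<odot> f \<in> Hom C A D"
    and Comp_Id: "f \<in> Hom C A B \<Longrightarrow> f \<odot> Id C A = f"
    and Id_Comp: "f \<in> Hom C A B \<Longrightarrow> Id C B \<odot> f = f"
    and Comp_assoc: "\<lbrakk>f \<in> Hom C A B; g \<in> Hom C B D; h \<in> Hom C D E\<rbrakk>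
                       \<Longrightarrow> (h \<odot> g) \<odot> f = h \<odot> (g \<odot> f)"

definition Dom :: "('o, 'm, 'z) category_scheme \<Rightarrow> 'm \<Rightarrow> 'o" where
  "Dom C f = (THE A. \<exists>B. f \<in> Hom C A B)"

definition monic :: "('o, 'm, 'z) category_scheme \<Rightarrow> 'o \<Rightarrow> 'o \<Rightarrow> 'm \<Rightarrow> bool" where
  "monic C A B f \<longleftrightarrow> f \<in> Hom C A B \<and>
     (\<forall>L. \<forall>g\<in>Hom C L A. \<forall>h\<in>Hom C L A. f \<odot>\<^bsub>C\<^esub> g = f \<odot>\<^bsub>C\<^esub> h \<longrightarrow> g = h)"

definition epic :: "('o, 'm, 'z) category_scheme \<Rightarrow> 'o \<Rightarrow> 'o \<Rightarrow> 'm \<Rightarrow> bool" where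
  "epic C A B f \<longleftrightarrow> f \<in> Hom C A B \<and>
     (\<forall>L. \<forall>g\<in>Hom C B L. \<forall>h\<in>Hom C B L. g \<odot>\<^bsub>C\<^esub> f = h \<odot>\<^bsub>C\<^esub> f \<longrightarrow> g = h)"

definition isomorphic :: "('o, 'm, 'z) category_scheme \<Rightarrow> 'o \<Rightarrow> 'o \<Rightarrow> bool" where
  "isomorphic C A B \<longleftrightarrow>
     (\<exists>f\<in>Hom C A B. \<exists>g\<in>Hom C B A. g \<odot>\<^bsub>C\<^esub> f = Id C A \<and> f \<odot>\<^bsub>C\<^esub> g = Id C B)"

definition zero_object :: "('o, 'm, 'z) category_scheme \<Rightarrow> 'o \<Rightarrow> bool" where
  "zero_object C Z \<longleftrightarrow>
     Z \<in> Ob C \<and> (\<forall>A\<in>Ob C. (\<exists>!f. f \<in> Hom C Z A) \<and> (\<exists>!f. f \<in> Hom C A Z))"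

definition generator :: "('o, 'm, 'z) category_scheme \<Rightarrow> 'o \<Rightarrow> bool" where
  "generator C G \<longleftrightarrow> G \<in> Ob C \<and>
     (\<forall>A B. \<forall>f\<in>Hom C A B. \<forall>g\<in>Hom C A B.
        f \<noteq> g \<longrightarrow> (\<exists>h\<in>Hom C G A. f \<odot>\<^bsub>C\<^esub> h \<noteq> g \<odot>\<^bsub>C\<^esub> h))"

text \<open>\<open>S\<close> with the injections \<open>\<iota> i\<close> is a direct sum of the family \<open>M i\<close>, \<open>i \<in> I\<close>.\<close>

definition is_direct_sum ::
    "('o, 'm, 'z) category_scheme \<Rightarrow> 'i set \<Rightarrow> ('i \<Rightarrow> 'o) \<Rightarrow> 'o \<Rightarrow> ('i \<Rightarrow> 'm) \<Rightarrow> bool" where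
  "is_direct_sum C I M S \<iota> \<longleftrightarrow>
     S \<in> Ob C \<and> (\<forall>i\<in>I. \<iota> i \<in> Hom C (M i) S) \<and>
     (\<forall>T\<in>Ob C. \<forall>f. (\<forall>i\<in>I. f i \<in> Hom C (M i) T) \<longrightarrow>
        (\<exists>!h. h \<in> Hom C S T \<and> (\<forall>i\<in>I. h \<odot>\<^bsub>C\<^esub> \<iota> i = f i)))"


section \<open>Functors, adjoints and colimits\<close>

record ('o, 'm, 'p, 'n) ftor =
  fob :: "'o \<Rightarrow> 'p"
  farr :: "'m \<Rightarrow> 'n"

locale ftor =
  source: category C + target: category D
  for C :: "('o, 'm, 'z) category_scheme" and D :: "('p, 'n, 'y) category_scheme" +
  fixes F :: "('o, 'm, 'p, 'n) ftor"
  assumes fob_Ob: "A \<in> Ob C \<Longrightarrow> fob F A \<in> Ob D"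
    and farr_Hom: "f \<in> Hom C A B \<Longrightarrow> farr F f \<in> Hom D (fob F A) (fob F B)"
    and farr_Id: "A \<in> Ob C \<Longrightarrow> farr F (Id C A) = Id D (fob F A)"
    and farr_Comp: "\<lbrakk>f \<in> Hom C A B; g \<in> Hom C B E\<rbrakk>
                      \<Longrightarrow> farr F (g \<odot>\<^bsub>C\<^esub> f) = farr F g \<odot>\<^bsub>D\<^esub> farr F f"

definition right_adjoint ::
    "('o, 'm, 'z) category_scheme \<Rightarrow> ('p, 'n, 'y) category_scheme \<Rightarrow>
     ('o, 'm, 'p, 'n) ftor \<Rightarrow> ('p, 'n, 'o, 'm) ftor \<Rightarrow> bool" where
  "right_adjoint C D F R \<longleftrightarrow> ftor C D F \<and> ftor D C R \<and>
     (\<exists>\<Phi>. (\<forall>A\<in>Ob C. \<forall>B\<in>Ob D.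
              bij_betw (\<Phi> A B) (Hom D (fob F A) B) (Hom C A (fob R B))) \<and>
          (\<forall>A A' B B'. \<forall>a\<in>Hom C A' A. \<forall>b\<in>Hom D B B'. \<forall>h\<in>Hom D (fob F A) B.
              \<Phi> A' B' (b \<odot>\<^bsub>D\<^esub> h \<odot>\<^bsub>D\<^esub> farr F a) = farr R b \<odot>\<^bsub>C\<^esub> \<Phi> A B h \<odot>\<^bsub>C\<^esub> a))"

definition natural ::
    "('o, 'm, 'z) category_scheme \<Rightarrow> ('p, 'n, 'y) category_scheme \<Rightarrow>
     ('o, 'm, 'p, 'n) ftor \<Rightarrow> ('o, 'm, 'p, 'n) ftor \<Rightarrow> ('o \<Rightarrow> 'n) \<Rightarrow> bool" where
  "natural C D F G \<alpha> \<longleftrightarrow>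
     (\<forall>A\<in>Ob C. \<alpha> A \<in> Hom D (fob F A) (fob G A)) \<and>
     (\<forall>A B. \<forall>f\<in>Hom C A B. \<alpha> B \<odot>\<^bsub>D\<^esub> farr F f = farr G f \<odot>\<^bsub>D\<^esub> \<alpha> A)"

definition cocone ::
    "('i, 'j, 'y) category_scheme \<Rightarrow> ('o, 'm, 'z) category_scheme \<Rightarrow>
     ('i, 'j, 'o, 'm) ftor \<Rightarrow> 'o \<Rightarrow> ('i \<Rightarrow> 'm) \<Rightarrow> bool" where
  "cocone J C F T c \<longleftrightarrow> T \<in> Ob C \<and> (\<forall>i\<in>Ob J. c i \<in> Hom C (fob F i) T) \<and>
     (\<forall>i j. \<forall>f\<in>Hom J i j. c j \<odot>\<^bsub>C\<^esub> farr F f = c i)"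

definition is_colimit ::
    "('i, 'j, 'y) category_scheme \<Rightarrow> ('o, 'm, 'z) category_scheme \<Rightarrow>
     ('i, 'j, 'o, 'm) ftor \<Rightarrow> 'o \<Rightarrow> ('i \<Rightarrow> 'm) \<Rightarrow> bool" where
  "is_colimit J C F T c \<longleftrightarrow> cocone J C F T c \<and>
     (\<forall>T' c'. cocone J C F T' c' \<longrightarrow>
        (\<exists>!h. h \<in> Hom C T T' \<and> (\<forall>i\<in>Ob J. h \<odot>\<^bsub>C\<^esub> c i = c' i)))"

definition filtered :: "('i, 'j, 'y) category_scheme \<Rightarrow> bool" where
  "filtered J \<longleftrightarrow> category J \<and> Ob J \<noteq> {} \<and>
     (\<forall>i\<in>Ob J. \<forall>j\<in>Ob J. \<exists>k. Hom J i k \<noteq> {} \<and> Hom J j k \<noteq> {}) \<and>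
     (\<forall>i j. \<forall>f\<in>Hom J i j. \<forall>g\<in>Hom J i j. \<exists>k. \<exists>h\<in>Hom J j k. h \<odot>\<^bsub>J\<^esub> f = h \<odot>\<^bsub>J\<^esub> g)"

definition small_category :: "'u set \<Rightarrow> ('i, 'j, 'y) category_scheme \<Rightarrow> bool" where
  "small_category U J \<longleftrightarrow> category J \<and> small U (Ob J) \<and> (\<forall>i j. small U (Hom J i j))"


section \<open>Abelian and Grothendieck categories\<close>

record ('o, 'm) ab_category = "('o, 'm) category" +
  Plus :: "'m \<Rightarrow> 'm \<Rightarrow> 'm"  (infixl "\<boxplus>\<index>" 65)
  Zero :: "'o \<Rightarrow> 'o \<Rightarrow> 'm"

definition is_kernel ::
    "('o, 'm, 'z) ab_category_scheme \<Rightarrow> 'o \<Rightarrow> 'o \<Rightarrow> 'o \<Rightarrow> 'm \<Rightarrow> 'm \<Rightarrow> bool" where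
  "is_kernel C K A B k f \<longleftrightarrow> k \<in> Hom C K A \<and> f \<in> Hom C A B \<and> f \<odot>\<^bsub>C\<^esub> k = Zero C K B \<and>
     (\<forall>L. \<forall>h\<in>Hom C L A. f \<odot>\<^bsub>C\<^esub> h = Zero C L B \<longrightarrow> (\<exists>!u. u \<in> Hom C L K \<and> k \<odot>\<^bsub>C\<^esub> u = h))"

definition is_cokernel ::
    "('o, 'm, 'z) ab_category_scheme \<Rightarrow> 'o \<Rightarrow> 'o \<Rightarrow> 'o \<Rightarrow> 'm \<Rightarrow> 'm \<Rightarrow> bool" where
  "is_cokernel C A B Q f q \<longleftrightarrow> f \<in> Hom C A B \<and> q \<in> Hom C B Q \<and> q \<odot>\<^bsub>C\<^esub> f = Zero C A Q \<and>
     (\<forall>L. \<forall>h\<in>Hom C B L. h \<odot>\<^bsub>C\<^esub> f = Zero C A L \<longrightarrow> (\<exists>!u. u \<in> Hom C Q L \<and> u \<odot>\<^bsub>C\<^esub> q = h))"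

text \<open>Exactness of \<open>0 \<rightarrow> A \<rightarrow> B \<rightarrow> D \<rightarrow> 0\<close>.\<close>

definition short_exact ::
    "('o, 'm, 'z) ab_category_scheme \<Rightarrow> 'o \<Rightarrow> 'o \<Rightarrow> 'o \<Rightarrow> 'm \<Rightarrow> 'm \<Rightarrow> bool" where
  "short_exact C A B D f g \<longleftrightarrow> is_kernel C A B D f g \<and> is_cokernel C A B D f g"

locale preadditive_category = category C
  for C :: "('o, 'm, 'z) ab_category_scheme" (structure) +
  assumes Hom_group: "\<lbrakk>A \<in> Ob C; B \<in> Ob C\<rbrakk> \<Longrightarrow>
      comm_group \<lparr>carrier = Hom C A B, monoid.mult = Plus C, one = Zero C A B\<rparr>"
    and Comp_Plus: "\<lbrakk>f \<in> Hom C A B; f' \<in> Hom C A B; g \<in> Hom C B D\<rbrakk>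
                      \<Longrightarrow> g \<odot> (f \<boxplus> f') = (g \<odot> f) \<boxplus> (g \<odot> f')"
    and Plus_Comp: "\<lbrakk>f \<in> Hom C A B; g \<in> Hom C B D; g' \<in> Hom C B D\<rbrakk>
                      \<Longrightarrow> (g \<boxplus> g') \<odot> f = (g \<odot> f) \<boxplus> (g' \<odot> f)"

locale abelian_category = preadditive_category +
  assumes ex_zero: "\<exists>Z. zero_object C Z"
    and ex_biproduct: "\<lbrakk>A \<in> Ob C; B \<in> Ob C\<rbrakk> \<Longrightarrow>
      \<exists>S. \<exists>i\<in>Hom C A S. \<exists>j\<in>Hom C B S. \<exists>p\<in>Hom C S A. \<exists>q\<in>Hom C S B.
        p \<odot> i = Id C A \<and> q \<odot> j = Id C B \<and> (i \<odot> p) \<boxplus> (j \<odot> q) = Id C S"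
    and ex_kernel: "f \<in> Hom C A B \<Longrightarrow> \<exists>K k. is_kernel C K A B k f"
    and ex_cokernel: "f \<in> Hom C A B \<Longrightarrow> \<exists>Q q. is_cokernel C A B Q f q"
    and monic_kernel: "monic C A B f \<Longrightarrow> \<exists>D g. is_kernel C A B D f g"
    and epic_cokernel: "epic C A B f \<Longrightarrow> \<exists>D g. is_cokernel C D A B g f"

text \<open>
  Hom sets are small. Up to isomorphism every small category has objects and arrows in the type of
  the elements of \<open>U\<close>, so nothing is lost by drawing index sets and index categories from there.
\<close>

locale grothendieck_category = abelian_category C
  for U :: "'u set" and C :: "('o, 'm, 'z) ab_category_scheme" (structure) +
  assumes small_Hom: "small U (Hom C A B)"
    and ex_direct_sum: "\<lbrakk>small U (I :: 'u set); \<forall>i\<in>I. M i \<in> Ob C\<rbrakk>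
                          \<Longrightarrow> \<exists>S \<iota>. is_direct_sum C I M S \<iota>"
    and ex_filtered_colimit:
      "\<And>(J :: ('u, 'u) category) F. \<lbrakk>small_category U J; filtered J; ftor J C F\<rbrakk>
         \<Longrightarrow> \<exists>T c. is_colimit J C F T c"
    and exact_filtered_colimit:
      "\<And>(J :: ('u, 'u) category) F F' F'' \<alpha> \<beta> T T' T'' c c' c'' f g.
         \<lbrakk>small_category U J; filtered J; ftor J C F; ftor J C F'; ftor J C F'';
          natural J C F F' \<alpha>; natural J C F' F'' \<beta>;
          \<forall>i\<in>Ob J. short_exact C (fob F i) (fob F' i) (fob F'' i) (\<alpha> i) (\<beta> i);
          is_colimit J C F T c; is_colimit J C F' T' c'; is_colimit J C F'' T'' c'';
          f \<in> Hom C T T'; \<forall>i\<in>Ob J. f \<odot> c i = c' i \<odot> \<alpha> i;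
          g \<in> Hom C T' T''; \<forall>i\<in>Ob J. g \<odot> c' i = c'' i \<odot> \<beta> i\<rbrakk>
         \<Longrightarrow> short_exact C T T' T'' f g"
    and ex_generator: "\<exists>G. generator C G"


section \<open>Full subcategories\<close>

text \<open>A full subcategory is represented by its set of objects.\<close>

definition weakly_closed :: "'u set \<Rightarrow> ('o, 'm, 'z) category_scheme \<Rightarrow> 'o set \<Rightarrow> bool" where
  "weakly_closed U C Z \<longleftrightarrow> Z \<subseteq> Ob C \<and>
     (\<forall>A B f. monic C A B f \<longrightarrow> B \<in> Z \<longrightarrow> A \<in> Z) \<and>
     (\<forall>A B f. epic C A B f \<longrightarrow> A \<in> Z \<longrightarrow> B \<in> Z) \<and>
     (\<forall>(I :: 'u set) M S \<iota>. small U I \<longrightarrow> (\<forall>i\<in>I. M i \<in> Z) \<longrightarrow> is_direct_sum C I M S \<iota> \<longrightarrow> S \<in> Z)"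

definition localizing :: "'u set \<Rightarrow> ('o, 'm, 'z) ab_category_scheme \<Rightarrow> 'o set \<Rightarrow> bool" where
  "localizing U C Y \<longleftrightarrow> weakly_closed U C Y \<and>
     (\<forall>A B D f g. short_exact C A B D f g \<longrightarrow> A \<in> Y \<longrightarrow> D \<in> Y \<longrightarrow> B \<in> Y)"

definition generated :: "'u set \<Rightarrow> ('o, 'm, 'z) category_scheme \<Rightarrow> 'o set \<Rightarrow> 'o set" where
  "generated U C \<G> = {Q. \<exists>(I :: 'u set) M S \<iota> e.
     small U I \<and> (\<forall>i\<in>I. M i \<in> \<G>) \<and> is_direct_sum C I M S \<iota> \<and> epic C S Q e}"


section \<open>The Gabriel quotient\<close>

text \<open>
  \<open>X/Y\<close> is the localization of \<open>X\<close> at the arrows whose kernel and cokernel lie in \<open>Y\<close>. These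
  arrows admit a calculus of right fractions: an arrow \<open>M \<rightarrow> N\<close> of \<open>X/Y\<close> is an equivalence class of
  roofs \<open>M \<leftarrow> L \<rightarrow> N\<close>, given as pairs \<open>(s, f)\<close> that stand for the fraction \<open>f s\<^sup>-\<^sup>1\<close>. As hom sets are
  disjoint, \<open>M\<close> and \<open>N\<close> can be read off a nonempty class.
\<close>

definition quotient_iso :: "('o, 'm, 'z) ab_category_scheme \<Rightarrow> 'o set \<Rightarrow> 'm \<Rightarrow> bool" where
  "quotient_iso X Y s \<longleftrightarrow> (\<exists>A B K k Q q.
     is_kernel X K A B k s \<and> is_cokernel X A B Q s q \<and> K \<in> Y \<and> Q \<in> Y)"

definition roofs :: "('o, 'm, 'z) ab_category_scheme \<Rightarrow> 'o set \<Rightarrow> 'o \<Rightarrow> 'o \<Rightarrow> ('m \<times> 'm) set" where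
  "roofs X Y M N = {(s, f). \<exists>L. s \<in> Hom X L M \<and> f \<in> Hom X L N \<and> quotient_iso X Y s}"

definition roof_equiv ::
    "('o, 'm, 'z) ab_category_scheme \<Rightarrow> 'o set \<Rightarrow> (('m \<times> 'm) \<times> ('m \<times> 'm)) set" where
  "roof_equiv X Y = {((s, f), (t, g)). \<exists>M N L L' P u v.
     s \<in> Hom X L M \<and> f \<in> Hom X L N \<and> quotient_iso X Y s \<and>
     t \<in> Hom X L' M \<and> g \<in> Hom X L' N \<and> quotient_iso X Y t \<and>
     u \<in> Hom X P L \<and> v \<in> Hom X P L' \<and>
     s \<odot>\<^bsub>X\<^esub> u = t \<odot>\<^bsub>X\<^esub> v \<and> f \<odot>\<^bsub>X\<^esub> u = g \<odot>\<^bsub>X\<^esub> v \<and> quotient_iso X Y (s \<odot>\<^bsub>X\<^esub> u)}"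

text \<open>
  The composite of the classes of \<open>(s, f)\<close> and \<open>(t, g)\<close> is the class of \<open>(s u, g v)\<close> for any
  square \<open>f u = t v\<close> in which \<open>u\<close> is inverted; the union below is over all such choices, which all
  give the same class.
\<close>

definition roof_comp ::
    "('o, 'm, 'z) ab_category_scheme \<Rightarrow> 'o set \<Rightarrow> ('m \<times> 'm) set \<Rightarrow> ('m \<times> 'm) set \<Rightarrow> ('m \<times> 'm) set" where
  "roof_comp X Y d c = \<Union> {roof_equiv X Y `` {(s \<odot>\<^bsub>X\<^esub> u, g \<odot>\<^bsub>X\<^esub> v)} | s f t g u v.
     (s, f) \<in> c \<and> (t, g) \<in> d \<and>
     (\<exists>L L' N P. f \<in> Hom X L N \<and> t \<in> Hom X L' N \<and> u \<in> Hom X P L \<and> v \<in> Hom X P L' \<and>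
        f \<odot>\<^bsub>X\<^esub> u = t \<odot>\<^bsub>X\<^esub> v \<and> quotient_iso X Y u)}"

definition gabriel_quotient ::
    "('o, 'm, 'z) ab_category_scheme \<Rightarrow> 'o set \<Rightarrow> ('o, ('m \<times> 'm) set) category" where
  "gabriel_quotient X Y =
     \<lparr>Ob = Ob X,
      Hom = (\<lambda>M N. roofs X Y M N // roof_equiv X Y),
      Id = (\<lambda>M. roof_equiv X Y `` {(Id X M, Id X M)}),
      Comp = roof_comp X Y\<rparr>"

definition quotient_functor ::
    "('o, 'm, 'z) ab_category_scheme \<Rightarrow> 'o set \<Rightarrow> ('o, 'm, 'o, ('m \<times> 'm) set) ftor"  where
  "quotient_functor X Y =
     \<lparr>fob = (\<lambda>M. M), farr = (\<lambda>f. roof_equiv X Y `` {(Id X (Dom X f), f)})\<rparr>"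

text \<open>
  The functor \<open>\<omega>\<close>. For \<open>X\<close> Grothendieck and \<open>Y\<close> localizing a right adjoint exists, and it is
  unique up to isomorphism; one is chosen.
\<close>

definition section_functor ::
    "('o, 'm, 'z) ab_category_scheme \<Rightarrow> 'o set \<Rightarrow> ('o, ('m \<times> 'm) set, 'o, 'm) ftor" where
  "section_functor X Y =
     (SOME R. right_adjoint X (gabriel_quotient X Y) (quotient_functor X Y) R)"


section \<open>Subcategories relative to a localizing subcategory\<close>

definition is_torsion_subobject ::
    "('o, 'm, 'z) category_scheme \<Rightarrow> 'o set \<Rightarrow> 'o \<Rightarrow> 'o \<Rightarrow> 'm \<Rightarrow> bool" where
  "is_torsion_subobject X Y M T t \<longleftrightarrow> T \<in> Y \<and> monic X T M t \<and>
     (\<forall>S s. S \<in> Y \<longrightarrow> monic X S M s \<longrightarrow> (\<exists>u\<in>Hom X S T. t \<odot>\<^bsub>X\<^esub> u = s))"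

definition torsionfree :: "('o, 'm, 'z) category_scheme \<Rightarrow> 'o set \<Rightarrow> 'o \<Rightarrow> bool" where
  "torsionfree X Y M \<longleftrightarrow> M \<in> Ob X \<and> (\<exists>T t. is_torsion_subobject X Y M T t \<and> zero_object X T)"

definition essentially_stable ::
    "('o, 'm, 'z) ab_category_scheme \<Rightarrow> 'o set \<Rightarrow> 'o set \<Rightarrow> bool" where
  "essentially_stable X Y Z \<longleftrightarrow>
     (\<forall>M\<in>Z. fob (section_functor X Y) (fob (quotient_functor X Y) M) \<in> Z)"

definition torsionfree_part ::
    "'u set \<Rightarrow> ('o, 'm, 'z) category_scheme \<Rightarrow> 'o set \<Rightarrow> 'o set \<Rightarrow> 'o set" where
  "torsionfree_part U X Y W = generated U X {M \<in> W. torsionfree X Y M}"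

definition torsionfree_generated ::
    "'u set \<Rightarrow> ('o, 'm, 'z) category_scheme \<Rightarrow> 'o set \<Rightarrow> 'o set \<Rightarrow> bool" where
  "torsionfree_generated U X Y Z \<longleftrightarrow> Z = generated U X {M \<in> Z. torsionfree X Y M}"

definition rel_weakly_closed ::
    "'u set \<Rightarrow> ('o, 'm, 'z) ab_category_scheme \<Rightarrow> 'o set \<Rightarrow> 'o set \<Rightarrow> bool" where
  "rel_weakly_closed U X Y Z \<longleftrightarrow>
     weakly_closed U X Z \<and> essentially_stable X Y Z \<and> torsionfree_generated U X Y Z"

text \<open>\<open>\<pi>(Z)\<close>, closed under isomorphism in \<open>X/Y\<close>.\<close>

definition quotient_image ::
    "('o, 'm, 'z) ab_category_scheme \<Rightarrow> 'o set \<Rightarrow> 'o set \<Rightarrow> 'o set" where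
  "quotient_image X Y Z = {N \<in> Ob (gabriel_quotient X Y).
     \<exists>M\<in>Z. isomorphic (gabriel_quotient X Y) (fob (quotient_functor X Y) M) N}"

definition quotient_preimage ::
    "('o, 'm, 'z) ab_category_scheme \<Rightarrow> 'o set \<Rightarrow> 'o set \<Rightarrow> 'o set" where
  "quotient_preimage X Y \<Z> = {M \<in> Ob X. fob (quotient_functor X Y) M \<in> \<Z>}"

end

theory Submission
  imports Defs
begin

text \<open>
  Call an arrow null if it factors through \<open>Y\<close>. Every object \<open>B\<close> has an envelope \<open>\<eta> B : B \<rightarrow> hull B\<close>
  whose kernel and cokernel lie in \<open>Y\<close> and whose target is closed, that is, arrows into it extend
  uniquely along every arrow inverted by \<open>\<pi>\<close>. A roof \<open>M \<leftarrow> L \<rightarrow> N\<close> then amounts to an arrow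
  \<open>M \<rightarrow> hull N\<close>, so that \<open>X/Y\<close> is the Kleisli category of \<open>hull\<close>, and \<open>hull\<close> computes \<open>\<omega>\<pi>\<close> up to
  isomorphism.

  In these terms \<open>\<pi>(Z) = {N. hull N \<in> Z}\<close> for an essentially stable weakly closed \<open>Z\<close>, whereas
  \<open>(\<pi>\<^sup>-\<^sup>1(\<Z>))'\<close> consists of the quotients of torsionfree objects of \<open>\<Z>\<close>, because direct sums of
  torsionfree objects are torsionfree. The bijection follows since a torsionfree \<open>N\<close> embeds into
  \<open>hull N\<close> and \<open>hull N\<close> is torsionfree for every \<open>N\<close>.
\<close>

section \<open>Arrows and direct sums\<close>

text \<open>The delicate point is the existence of the envelope. It uses neither injective hulls nor
  transfinite iteration: one pushout solves all extension problems posed on dense subobjects of a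
  generator, and uniqueness of extensions into torsionfree objects makes this single step enough for
  all objects. Exactness of filtered colimits enters at one place, to show that the projections of a
  direct sum jointly detect zero; this is why direct sums of torsionfree objects are torsionfree and
  why the direct sums of monics that occur are monic. X/Y is never shown to be abelian. Its monics,
  epics, isomorphisms and direct sums are read off from Kleisli arrows, and kernels and cokernels
  modulo Y are handled inside X by null arrows, whose calculus is self-dual, so half of it comes
  from applying the other half to the opposite category. One asymmetry remains: passing to envelopes
  turns monics of X/Y into monics, but epics only into arrows that are epic modulo Y. Essential
  stability repairs this.\<close>

definition is_arr :: "('o, 'm, 'z) category_scheme \<Rightarrow> 'm \<Rightarrow> bool" where
  "is_arr C f \<longleftrightarrow> (\<exists>A B. f \<in> Hom C A B)"

definition Cod :: "('o, 'm, 'z) category_scheme \<Rightarrow> 'm \<Rightarrow> 'o" where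
  "Cod C f = (THE B. \<exists>A. f \<in> Hom C A B)"

context category
begin

abbreviation "arr \<equiv> is_arr C"
abbreviation "src \<equiv> Dom C"
abbreviation "tgt \<equiv> Cod C"

lemma Hom_DomCod: "f \<in> Hom C A B \<Longrightarrow> src f = A \<and> tgt f = B"
  unfolding Dom_def Cod_def by (rule conjI; rule the_equality) (use Hom_disjoint in blast)+

text \<open>Hom sets are disjoint, so membership splits into conditions on \<open>src\<close> and
  \<open>tgt\<close> that the simplifier can decide; the later bookkeeping of sources and targets
  runs through this rule.\<close>

lemma Hom_iff [simp]:
  "f \<in> Hom C A B \<longleftrightarrow> arr f \<and> src f = A \<and> tgt f = B \<and> A \<in> Ob C \<and> B \<in> Ob C"
  using Hom_DomCod Hom_Ob unfolding is_arr_def by metis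

lemma arr_Hom: "arr f \<Longrightarrow> f \<in> Hom C (src f) (tgt f)"
  using Hom_DomCod unfolding is_arr_def by metis

lemma src_Ob [simp]: "arr f \<Longrightarrow> src f \<in> Ob C" and tgt_Ob [simp]: "arr f \<Longrightarrow> tgt f \<in> Ob C"
  using arr_Hom by auto

lemma Comp_arr [simp]:
  assumes "arr f" "arr g" "src g = tgt f"
  shows "arr (g \<odot> f)" "src (g \<odot> f) = src f" "tgt (g \<odot> f) = tgt g"
  using Comp_Hom[of f "src f" "tgt f" g "tgt g"] assms by auto

lemma Id_arr [simp]:
  assumes "A \<in> Ob C"
  shows "arr (Id C A)" "src (Id C A) = A" "tgt (Id C A) = A"
  using Id_Hom[OF assms] by auto

lemma Comp_Id_src [simp]: "arr f \<Longrightarrow> src f = A \<Longrightarrow> f \<odot> Id C A = f"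
  and Id_Comp_tgt [simp]: "arr f \<Longrightarrow> tgt f = A \<Longrightarrow> Id C A \<odot> f = f"
  using Comp_Id[of f A "tgt f"] Id_Comp[of f "src f" A] by auto

lemma assoc [simp]:
  "\<lbrakk>arr f; arr g; arr h; src g = tgt f; src h = tgt g\<rbrakk> \<Longrightarrow> (h \<odot> g) \<odot> f = h \<odot> (g \<odot> f)"
  by (rule Comp_assoc[of f "src f" "tgt f" g "tgt g" h "tgt h"]) auto

text \<open>\<open>assoc\<close> nests composites to the right, which hides
  \<open>g \<odot> f\<close> inside \<open>g \<odot> (f \<odot> x)\<close>; this lemma applies an
  equation for \<open>g \<odot> f\<close> in that position.\<close>

lemma Comp_eq_comp:
  assumes "g \<odot> f = y" "arr f" "arr g" "arr x" "src g = tgt f" "src f = tgt x"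
  shows "g \<odot> (f \<odot> x) = y \<odot> x"
  using assms by (metis assoc)

lemma isomorphic_sym: "isomorphic C A B \<Longrightarrow> isomorphic C B A"
  unfolding isomorphic_def by blast

lemma isomorphicE:
  assumes "isomorphic C A B"
  obtains f g where "arr f" "src f = A" "tgt f = B" "arr g" "src g = B" "tgt g = A"
    "A \<in> Ob C" "B \<in> Ob C" "g \<odot> f = Id C A" "f \<odot> g = Id C B"
  using assms unfolding isomorphic_def by auto

lemma isomorphicI:
  assumes "arr f" "src f = A" "tgt f = B" "arr g" "src g = B" "tgt g = A"
    "g \<odot> f = Id C A" "f \<odot> g = Id C B"
  shows "isomorphic C A B"
  using assms unfolding isomorphic_def by (metis Hom_iff src_Ob)

lemma isomorphic_trans:
  assumes "isomorphic C A B" "isomorphic C B D"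
  shows "isomorphic C A D"
proof -
  obtain f g where f: "arr f" "src f = A" "tgt f = B" "arr g" "src g = B" "tgt g = A"
    "A \<in> Ob C" "B \<in> Ob C" "g \<odot> f = Id C A" "f \<odot> g = Id C B"
    using isomorphicE[OF assms(1)] by blast
  obtain h k where h: "arr h" "src h = B" "tgt h = D" "arr k" "src k = D" "tgt k = B"
    "B \<in> Ob C" "D \<in> Ob C" "k \<odot> h = Id C B" "h \<odot> k = Id C D"
    using isomorphicE[OF assms(2)] by blast
  have "(g \<odot> k) \<odot> (h \<odot> f) = Id C A" "(h \<odot> f) \<odot> (g \<odot> k) = Id C D"
    using f h by (simp_all add: Comp_eq_comp[of k h "Id C B"] Comp_eq_comp[of f g "Id C B"])
  then show ?thesis
    using f h by (intro isomorphicI[of "h \<odot> f" _ _ "g \<odot> k"]) auto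
qed

lemma isomorphic_monic:
  assumes "isomorphic C A B"
  shows "\<exists>f. monic C A B f"
proof -
  obtain f g where f: "arr f" "src f = A" "tgt f = B" "arr g" "src g = B" "tgt g = A"
    "A \<in> Ob C" "B \<in> Ob C" "g \<odot> f = Id C A"
    using isomorphicE[OF assms] by metis
  have "x = y" if "x \<in> Hom C L A" "y \<in> Hom C L A" "f \<odot> x = f \<odot> y" for L x y
  proof -
    have "(g \<odot> f) \<odot> x = (g \<odot> f) \<odot> y"
      using that f(1-8) by simp
    with that f show ?thesis by simp
  qed
  with f show ?thesis unfolding monic_def by auto
qed

lemma weakly_closed_iso:
  assumes "weakly_closed V C Z" "isomorphic C A B" "B \<in> Z"
  shows "A \<in> Z"
  using assms isomorphic_monic unfolding weakly_closed_def by metis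

lemma direct_sum_arr:
  assumes "is_direct_sum C I M S \<iota>"
  shows "S \<in> Ob C" "\<And>i. i \<in> I \<Longrightarrow> arr (\<iota> i) \<and> src (\<iota> i) = M i \<and> tgt (\<iota> i) = S \<and> M i \<in> Ob C"
  using assms[unfolded is_direct_sum_def, THEN conjunct1]
    assms[unfolded is_direct_sum_def, THEN conjunct2, THEN conjunct1] by auto

lemma direct_sum_ex1:
  assumes "is_direct_sum C I M S \<iota>" "T \<in> Ob C" "\<forall>i\<in>I. f i \<in> Hom C (M i) T"
  shows "\<exists>!h. h \<in> Hom C S T \<and> (\<forall>i\<in>I. h \<odot> \<iota> i = f i)"
  using assms(1)[unfolded is_direct_sum_def, THEN conjunct2, THEN conjunct2, THEN bspec, OF assms(2),
      THEN spec[of _ f], THEN mp, OF assms(3)] .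

lemma direct_sum_ext:
  assumes S: "is_direct_sum C I M S \<iota>" and fg: "arr f" "arr g" "src f = S" "src g = S" "tgt f = tgt g"
    "\<forall>i\<in>I. f \<odot> \<iota> i = g \<odot> \<iota> i"
  shows "f = g"
proof -
  have i: "\<forall>i\<in>I. f \<odot> \<iota> i \<in> Hom C (M i) (tgt f)"
    using direct_sum_arr[OF S] fg(1,3) by simp
  have "\<exists>!h. h \<in> Hom C S (tgt f) \<and> (\<forall>i\<in>I. h \<odot> \<iota> i = f \<odot> \<iota> i)"
    by (rule direct_sum_ex1[OF S tgt_Ob[OF fg(1)] i])
  moreover have "f \<in> Hom C S (tgt f)" "g \<in> Hom C S (tgt f)"
    using arr_Hom[OF fg(1)] arr_Hom[OF fg(2)] fg by auto
  moreover have "\<forall>i\<in>I. g \<odot> \<iota> i = f \<odot> \<iota> i"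
    using fg(6) by simp
  ultimately show ?thesis
    by blast
qed

lemma direct_sum_map:
  assumes S: "is_direct_sum C I M S \<iota>" and T: "T \<in> Ob C"
    and f: "\<And>i. i \<in> I \<Longrightarrow> arr (f i) \<and> src (f i) = M i \<and> tgt (f i) = T"
  shows "\<exists>h. arr h \<and> src h = S \<and> tgt h = T \<and> (\<forall>i\<in>I. h \<odot> \<iota> i = f i)"
proof -
  have "\<forall>i\<in>I. f i \<in> Hom C (M i) T"
    using f direct_sum_arr[OF S] T by simp
  from direct_sum_ex1[OF S T this] have "\<exists>!h. h \<in> Hom C S T \<and> (\<forall>i\<in>I. h \<odot> \<iota> i = f i)" .
  then show ?thesis
    unfolding Hom_iff by blast
qed

text \<open>The maps induced by the two families are mutually inverse because they are so on every
  summand. It is meant for X/Y, where \<open>M i\<close> and \<open>hull (M i)\<close> are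
  isomorphic but not equal.\<close>

lemma direct_sum_isomorphic:
  assumes S: "is_direct_sum C I M S \<iota>" and S': "is_direct_sum C I M' S' \<iota>'"
    and M: "\<forall>i\<in>I. isomorphic C (M i) (M' i)"
  shows "isomorphic C S S'"
proof -
  have "\<forall>i\<in>I. \<exists>f. \<exists>g\<in>Hom C (M' i) (M i). f \<in> Hom C (M i) (M' i) \<and> g \<odot> f = Id C (M i) \<and> f \<odot> g = Id C (M' i)"
    using M unfolding isomorphic_def by blast
  then obtain f where "\<forall>i\<in>I. \<exists>g\<in>Hom C (M' i) (M i). f i \<in> Hom C (M i) (M' i) \<and> g \<odot> f i = Id C (M i) \<and> f i \<odot> g = Id C (M' i)"
    by (rule bchoice[THEN exE])
  then obtain g where fg: "\<forall>i\<in>I. g i \<in> Hom C (M' i) (M i) \<and> f i \<in> Hom C (M i) (M' i) \<and> g i \<odot> f i = Id C (M i) \<and> f i \<odot> g i = Id C (M' i)"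
    unfolding Bex_def by (rule bchoice[THEN exE])
  note a = direct_sum_arr[OF S] direct_sum_arr[OF S']
  have "\<exists>h. arr h \<and> src h = S \<and> tgt h = S' \<and> (\<forall>i\<in>I. h \<odot> \<iota> i = \<iota>' i \<odot> f i)"
    by (rule direct_sum_map[OF S]) (use fg a in auto)
  then obtain h where h: "arr h" "src h = S" "tgt h = S'" "\<forall>i\<in>I. h \<odot> \<iota> i = \<iota>' i \<odot> f i"
    by blast
  have "\<exists>k. arr k \<and> src k = S' \<and> tgt k = S \<and> (\<forall>i\<in>I. k \<odot> \<iota>' i = \<iota> i \<odot> g i)"
    by (rule direct_sum_map[OF S']) (use fg a in auto)
  then obtain k where k: "arr k" "src k = S'" "tgt k = S" "\<forall>i\<in>I. k \<odot> \<iota>' i = \<iota> i \<odot> g i"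
    by blast
  have "k \<odot> h = Id C S"
  proof (rule direct_sum_ext[OF S])
    show "\<forall>i\<in>I. (k \<odot> h) \<odot> \<iota> i = Id C S \<odot> \<iota> i"
    proof
      fix i assume i: "i \<in> I"
      note t = bspec[OF fg i] a(2,4)[OF i] bspec[OF h(4) i] bspec[OF k(4) i]
      have "k \<odot> (\<iota>' i \<odot> f i) = (\<iota> i \<odot> g i) \<odot> f i"
        by (rule Comp_eq_comp) (use k(1-3) t in auto)
      with h(1-3) k(1-3) t show "(k \<odot> h) \<odot> \<iota> i = Id C S \<odot> \<iota> i" by simp
    qed
  qed (use h(1-3) k(1-3) a(1) in auto)
  moreover have "h \<odot> k = Id C S'"
  proof (rule direct_sum_ext[OF S'])
    show "\<forall>i\<in>I. (h \<odot> k) \<odot> \<iota>' i = Id C S' \<odot> \<iota>' i"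
    proof
      fix i assume i: "i \<in> I"
      note t = bspec[OF fg i] a(2,4)[OF i] bspec[OF h(4) i] bspec[OF k(4) i]
      have "h \<odot> (\<iota> i \<odot> g i) = (\<iota>' i \<odot> f i) \<odot> g i"
        by (rule Comp_eq_comp) (use h(1-3) t in auto)
      with h(1-3) k(1-3) t show "(h \<odot> k) \<odot> \<iota>' i = Id C S' \<odot> \<iota>' i" by simp
    qed
  qed (use h(1-3) k(1-3) a(3) in auto)
  ultimately show ?thesis
    using h(1-3) k(1-3) by (intro isomorphicI[of h _ _ k])
qed

end

section \<open>Addition and subtraction of arrows\<close>

context preadditive_category
begin

abbreviation "zero \<equiv> Zero C"

lemma zero_arr [simp]:
  assumes "A \<in> Ob C" "B \<in> Ob C"
  shows "arr (zero A B)" "src (zero A B) = A" "tgt (zero A B) = B"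
proof -
  interpret comm_group "\<lparr>carrier = Hom C A B, monoid.mult = Plus C, one = Zero C A B\<rparr>"
    by (rule Hom_group[OF assms])
  show "arr (zero A B)" "src (zero A B) = A" "tgt (zero A B) = B"
    using one_closed by simp_all
qed

lemma Plus_arr [simp]:
  assumes "arr f" "arr g" "src g = src f" "tgt g = tgt f"
  shows "arr (f \<boxplus> g)" "src (f \<boxplus> g) = src f" "tgt (f \<boxplus> g) = tgt f"
proof -
  interpret comm_group "\<lparr>carrier = Hom C (src f) (tgt f), monoid.mult = Plus C, one = Zero C (src f) (tgt f)\<rparr>"
    by (rule Hom_group) (use assms in auto)
  show "arr (f \<boxplus> g)" "src (f \<boxplus> g) = src f" "tgt (f \<boxplus> g) = tgt f"
    using m_closed[of f g] assms by simp_all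
qed

lemma Plus_zero [simp]: "arr f \<Longrightarrow> src f = A \<Longrightarrow> tgt f = B \<Longrightarrow> f \<boxplus> zero A B = f"
  and zero_Plus [simp]: "arr f \<Longrightarrow> src f = A \<Longrightarrow> tgt f = B \<Longrightarrow> zero A B \<boxplus> f = f"
proof -
  assume f: "arr f" "src f = A" "tgt f = B"
  interpret comm_group "\<lparr>carrier = Hom C A B, monoid.mult = Plus C, one = Zero C A B\<rparr>"
    by (rule Hom_group) (use f in auto)
  show "f \<boxplus> zero A B = f" "zero A B \<boxplus> f = f"
    using r_one[of f] l_one[of f] f by auto
qed

lemma Plus_cancel:
  assumes "arr f" "arr g" "arr h" "src g = src f" "tgt g = tgt f" "src h = src f" "tgt h = tgt f"
    "f \<boxplus> h = g \<boxplus> h"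
  shows "f = g"
proof -
  interpret comm_group "\<lparr>carrier = Hom C (src f) (tgt f), monoid.mult = Plus C, one = Zero C (src f) (tgt f)\<rparr>"
    by (rule Hom_group) (use assms in auto)
  show ?thesis
    using right_cancel[of h f g] assms by auto
qed

lemma Comp_Plus_distrib [simp]:
  "\<lbrakk>arr f; arr f'; arr g; src f' = src f; tgt f' = tgt f; src g = tgt f\<rbrakk>
     \<Longrightarrow> g \<odot> (f \<boxplus> f') = (g \<odot> f) \<boxplus> (g \<odot> f')"
  by (rule Comp_Plus[of f "src f" "tgt f" f' g "tgt g"]) auto

lemma Plus_Comp_distrib [simp]:
  "\<lbrakk>arr g; arr g'; arr f; src g' = src g; tgt g' = tgt g; src g = tgt f\<rbrakk>
     \<Longrightarrow> (g \<boxplus> g') \<odot> f = (g \<odot> f) \<boxplus> (g' \<odot> f)"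
  by (rule Plus_Comp[of f "src f" "tgt f" g "tgt g" g']) auto

lemma zero_Comp [simp]:
  assumes "arr f" "tgt f = A" "B \<in> Ob C"
  shows "zero A B \<odot> f = zero (src f) B"
proof (rule Plus_cancel)
  have "(zero A B \<boxplus> zero A B) \<odot> f = (zero A B \<odot> f) \<boxplus> (zero A B \<odot> f)"
    by (rule Plus_Comp_distrib) (use assms in auto)
  then show "zero A B \<odot> f \<boxplus> zero A B \<odot> f = zero (src f) B \<boxplus> zero A B \<odot> f"
    using assms by auto
qed (use assms in auto)

lemma Comp_zero [simp]:
  assumes "arr g" "src g = B" "A \<in> Ob C"
  shows "g \<odot> zero A B = zero A (tgt g)"
proof (rule Plus_cancel)
  have "g \<odot> (zero A B \<boxplus> zero A B) = (g \<odot> zero A B) \<boxplus> (g \<odot> zero A B)"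
    by (rule Comp_Plus_distrib) (use assms in auto)
  then show "g \<odot> zero A B \<boxplus> g \<odot> zero A B = zero A (tgt g) \<boxplus> g \<odot> zero A B"
    using assms by auto
qed (use assms in auto)

text \<open>The record has addition and zero but no negation, so subtraction is taken as the
  solution of an equation.\<close>

definition diff :: "'m \<Rightarrow> 'm \<Rightarrow> 'm" (infixl "\<boxminus>" 65) where
  "f \<boxminus> g = (THE h. h \<in> Hom C (src f) (tgt f) \<and> h \<boxplus> g = f)"

lemma diff:
  assumes "arr f" "arr g" "src g = src f" "tgt g = tgt f"
  shows "f \<boxminus> g \<in> Hom C (src f) (tgt f) \<and> (f \<boxminus> g) \<boxplus> g = f"
  unfolding diff_def
proof (rule theI')
  interpret comm_group "\<lparr>carrier = Hom C (src f) (tgt f), monoid.mult = Plus C, one = Zero C (src f) (tgt f)\<rparr>"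
    by (rule Hom_group) (use assms in auto)
  have "inv\<^bsub>\<lparr>carrier = Hom C (src f) (tgt f), monoid.mult = Plus C, one = Zero C (src f) (tgt f)\<rparr>\<^esub> g \<boxplus> g
      = zero (src f) (tgt f)"
    using l_inv[of g] assms by simp
  moreover have "inv\<^bsub>\<lparr>carrier = Hom C (src f) (tgt f), monoid.mult = Plus C, one = Zero C (src f) (tgt f)\<rparr>\<^esub> g
     \<in> Hom C (src f) (tgt f)"
    using inv_closed[of g] assms by simp
  ultimately have "\<exists>h. h \<in> Hom C (src f) (tgt f) \<and> h \<boxplus> g = f"
    using m_assoc[of f "inv\<^bsub>\<lparr>carrier = Hom C (src f) (tgt f), monoid.mult = Plus C, one = Zero C (src f) (tgt f)\<rparr>\<^esub> g" g] assms
    by (intro exI[of _ "f \<boxplus> inv\<^bsub>\<lparr>carrier = Hom C (src f) (tgt f), monoid.mult = Plus C, one = Zero C (src f) (tgt f)\<rparr>\<^esub> g"]) auto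
  then show "\<exists>!h. h \<in> Hom C (src f) (tgt f) \<and> h \<boxplus> g = f"
    using Plus_cancel[of _ _ g] assms by (metis Hom_iff)
qed

lemma diff_arr [simp]:
  assumes "arr f" "arr g" "src g = src f" "tgt g = tgt f"
  shows "arr (f \<boxminus> g)" "src (f \<boxminus> g) = src f" "tgt (f \<boxminus> g) = tgt f"
  using diff[OF assms] by auto

lemma diff_eqI:
  assumes "h \<boxplus> g = f" "arr f" "arr g" "src g = src f" "tgt g = tgt f" "arr h" "src h = src f" "tgt h = tgt f"
  shows "f \<boxminus> g = h"
  by (rule Plus_cancel[of _ _ g]) (use diff[OF assms(2-5)] assms in auto)

lemma diff_zero_iff [simp]:
  assumes "arr f" "arr g" "src f = A" "tgt f = B" "src g = A" "tgt g = B"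
  shows "f \<boxminus> g = zero A B \<longleftrightarrow> f = g"
proof
  assume "f \<boxminus> g = zero A B"
  with diff[of f g] assms show "f = g" by auto
next
  assume "f = g"
  with assms show "f \<boxminus> g = zero A B" by (intro diff_eqI) auto
qed

lemma diff_self [simp]: "arr f \<Longrightarrow> f \<boxminus> f = zero (src f) (tgt f)"
  by simp

lemma diff_zero [simp]:
  assumes "arr f" "src f = A" "tgt f = B"
  shows "f \<boxminus> zero A B = f"
  by (rule diff_eqI) (use assms in auto)

lemma Comp_diff [simp]:
  assumes "arr f" "arr f'" "arr g" "src f' = src f" "tgt f' = tgt f" "src g = tgt f"
  shows "g \<odot> (f \<boxminus> f') = (g \<odot> f) \<boxminus> (g \<odot> f')"
proof (rule diff_eqI[symmetric])
  have "g \<odot> ((f \<boxminus> f') \<boxplus> f') = g \<odot> (f \<boxminus> f') \<boxplus> g \<odot> f'"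
    by (rule Comp_Plus_distrib) (use assms in auto)
  then show "g \<odot> (f \<boxminus> f') \<boxplus> g \<odot> f' = g \<odot> f"
    using diff[of f f'] assms by auto
qed (use assms in auto)

lemma diff_Comp [simp]:
  assumes "arr f" "arr f'" "arr g" "src f' = src f" "tgt f' = tgt f" "src f = tgt g"
  shows "(f \<boxminus> f') \<odot> g = (f \<odot> g) \<boxminus> (f' \<odot> g)"
proof (rule diff_eqI[symmetric])
  have "((f \<boxminus> f') \<boxplus> f') \<odot> g = (f \<boxminus> f') \<odot> g \<boxplus> f' \<odot> g"
    by (rule Plus_Comp_distrib) (use assms in auto)
  then show "(f \<boxminus> f') \<odot> g \<boxplus> f' \<odot> g = f \<odot> g"
    using diff[of f f'] assms by auto
qed (use assms in auto)

end

section \<open>Kernels, cokernels and duality\<close>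

text \<open>Monic is tested against zero instead of by cancellation, with source and target read off
  from the arrow. \<open>mon\<close>, \<open>epi\<close>, \<open>kern\<close> and
  \<open>coker\<close> are phrased so that passing to the opposite category swaps them
  literally.\<close>

definition mon :: "('o, 'm, 'z) ab_category_scheme \<Rightarrow> 'm \<Rightarrow> bool" where
  "mon C f \<longleftrightarrow> is_arr C f \<and> (\<forall>h. is_arr C h \<longrightarrow> Cod C h = Dom C f \<longrightarrow>
     f \<odot>\<^bsub>C\<^esub> h = Zero C (Dom C h) (Cod C f) \<longrightarrow> h = Zero C (Dom C h) (Dom C f))"

definition epi :: "('o, 'm, 'z) ab_category_scheme \<Rightarrow> 'm \<Rightarrow> bool" where
  "epi C f \<longleftrightarrow> is_arr C f \<and> (\<forall>h. is_arr C h \<longrightarrow> Dom C h = Cod C f \<longrightarrow>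
     h \<odot>\<^bsub>C\<^esub> f = Zero C (Dom C f) (Cod C h) \<longrightarrow> h = Zero C (Cod C f) (Cod C h))"

text \<open>Monicity of \<open>k\<close> replaces uniqueness of the factorization.\<close>

definition kern :: "('o, 'm, 'z) ab_category_scheme \<Rightarrow> 'm \<Rightarrow> 'm \<Rightarrow> bool" where
  "kern C k f \<longleftrightarrow> mon C k \<and> is_arr C f \<and> Cod C k = Dom C f \<and> f \<odot>\<^bsub>C\<^esub> k = Zero C (Dom C k) (Cod C f) \<and>
     (\<forall>h. is_arr C h \<longrightarrow> Cod C h = Dom C f \<longrightarrow> f \<odot>\<^bsub>C\<^esub> h = Zero C (Dom C h) (Cod C f) \<longrightarrow>
        (\<exists>u. is_arr C u \<and> Dom C u = Dom C h \<and> Cod C u = Dom C k \<and> k \<odot>\<^bsub>C\<^esub> u = h))"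

definition coker :: "('o, 'm, 'z) ab_category_scheme \<Rightarrow> 'm \<Rightarrow> 'm \<Rightarrow> bool" where
  "coker C q f \<longleftrightarrow> epi C q \<and> is_arr C f \<and> Dom C q = Cod C f \<and> q \<odot>\<^bsub>C\<^esub> f = Zero C (Dom C f) (Cod C q) \<and>
     (\<forall>h. is_arr C h \<longrightarrow> Dom C h = Cod C f \<longrightarrow> h \<odot>\<^bsub>C\<^esub> f = Zero C (Dom C f) (Cod C h) \<longrightarrow>
        (\<exists>u. is_arr C u \<and> Dom C u = Cod C q \<and> Cod C u = Cod C h \<and> u \<odot>\<^bsub>C\<^esub> q = h))"

text \<open>The opposite category as a record of the same kind. Instantiating a locale with it turns
  each fact on monics, kernels and pullbacks into one on epics, cokernels and pushouts.\<close>

definition dual :: "('o, 'm, 'z) ab_category_scheme \<Rightarrow> ('o, 'm) ab_category" where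
  "dual C = \<lparr>Ob = Ob C, Hom = (\<lambda>A B. Hom C B A), Id = Id C, Comp = (\<lambda>g f. f \<odot>\<^bsub>C\<^esub> g),
     Plus = Plus C, Zero = (\<lambda>A B. Zero C B A)\<rparr>"

lemma dual_sel [simp]:
  "Ob (dual C) = Ob C" "Hom (dual C) A B = Hom C B A" "Id (dual C) = Id C"
  "g \<odot>\<^bsub>dual C\<^esub> f = f \<odot>\<^bsub>C\<^esub> g" "Plus (dual C) = Plus C" "Zero (dual C) A B = Zero C B A"
  "Dom (dual C) = Cod C" "Cod (dual C) = Dom C" "is_arr (dual C) = is_arr C"
  unfolding dual_def Dom_def[abs_def] Cod_def[abs_def] is_arr_def[abs_def] by auto

lemma dual_mon [simp]:
  "mon (dual C) = epi C"
  "epi (dual C) = mon C"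
  by (auto simp: fun_eq_iff mon_def epi_def)

lemma dual_kern [simp]:
  "kern (dual C) = coker C"
  "coker (dual C) = kern C"
  by (auto simp: fun_eq_iff kern_def coker_def)

lemma dual_monic: "monic (dual C) A B f \<longleftrightarrow> epic C B A f" "epic (dual C) A B f \<longleftrightarrow> monic C B A f"
  unfolding monic_def epic_def dual_sel by (rule refl)+

lemma dual_is_kernel:
  "is_kernel (dual C) K A B k f \<longleftrightarrow> is_cokernel C B A K f k"
  "is_cokernel (dual C) A B Q f q \<longleftrightarrow> is_kernel C Q B A q f"
  unfolding is_kernel_def is_cokernel_def dual_sel by (rule conj_left_commute)+

context preadditive_category
begin

lemma mon_arr [simp]: "mon C f \<Longrightarrow> arr f" and epi_arr [simp]: "epi C f \<Longrightarrow> arr f"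
  unfolding mon_def epi_def by auto

lemma monI:
  assumes "arr f" "\<And>h. \<lbrakk>arr h; tgt h = src f; f \<odot> h = zero (src h) (tgt f)\<rbrakk> \<Longrightarrow> h = zero (src h) (src f)"
  shows "mon C f"
  using assms unfolding mon_def by blast

lemma epiI:
  assumes "arr f" "\<And>h. \<lbrakk>arr h; src h = tgt f; h \<odot> f = zero (src f) (tgt h)\<rbrakk> \<Longrightarrow> h = zero (tgt f) (tgt h)"
  shows "epi C f"
  using assms unfolding epi_def by blast

lemma mon_zero:
  "\<lbrakk>mon C f; f \<odot> h = zero (src h) (tgt f); arr h; tgt h = src f\<rbrakk> \<Longrightarrow> h = zero (src h) (src f)"
  unfolding mon_def by blast

lemma mon_cancel:
  assumes "mon C f" "f \<odot> x = f \<odot> y" "arr x" "arr y" "src x = src y" "tgt x = src f" "tgt y = src f"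
  shows "x = y"
proof -
  have "f \<odot> (x \<boxminus> y) = zero (src y) (tgt f)"
    using assms by simp
  then have "x \<boxminus> y = zero (src y) (src f)"
    using mon_zero[of f "x \<boxminus> y"] assms by simp
  with assms show ?thesis by simp
qed

lemma monic_iff: "monic C A B f \<longleftrightarrow> mon C f \<and> src f = A \<and> tgt f = B"
proof
  assume m: "monic C A B f"
  then have f: "arr f" "src f = A" "tgt f = B"
    unfolding monic_def by auto
  moreover have "mon C f"
  proof (rule monI)
    fix h assume h: "arr h" "tgt h = src f" "f \<odot> h = zero (src h) (tgt f)"
    then have "h \<in> Hom C (src h) A" "zero (src h) A \<in> Hom C (src h) A" "f \<odot> h = f \<odot> zero (src h) A"
      using f by auto
    with m f show "h = zero (src h) (src f)"
      unfolding monic_def by blast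
  qed (use f in auto)
  ultimately show "mon C f \<and> src f = A \<and> tgt f = B" by simp
next
  assume "mon C f \<and> src f = A \<and> tgt f = B"
  then have f: "mon C f" "src f = A" "tgt f = B"
    by auto
  have "g = h" if "g \<in> Hom C L A" "h \<in> Hom C L A" "f \<odot> g = f \<odot> h" for L g h
    by (rule mon_cancel[OF f(1)]) (use that f in simp_all)
  moreover have "f \<in> Hom C A B"
    using f by auto
  ultimately show "monic C A B f"
    unfolding monic_def by blast
qed

lemma kernD:
  assumes "kern C k f"
  shows "mon C k" "arr f" "tgt k = src f" "f \<odot> k = zero (src k) (tgt f)"
    "\<And>h. \<lbrakk>f \<odot> h = zero (src h) (tgt f); arr h; tgt h = src f\<rbrakk> \<Longrightarrow>
        \<exists>u. arr u \<and> src u = src h \<and> tgt u = src k \<and> k \<odot> u = h"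
  using assms unfolding kern_def by blast+

lemma cokerD:
  assumes "coker C q f"
  shows "epi C q" "arr f" "src q = tgt f" "q \<odot> f = zero (src f) (tgt q)"
    "\<And>h. \<lbrakk>h \<odot> f = zero (src f) (tgt h); arr h; src h = tgt f\<rbrakk> \<Longrightarrow>
        \<exists>u. arr u \<and> src u = tgt q \<and> tgt u = tgt h \<and> u \<odot> q = h"
  using assms unfolding coker_def by blast+

lemma is_kernel_iff: "is_kernel C K A B k f \<longleftrightarrow> kern C k f \<and> src k = K \<and> src f = A \<and> tgt f = B"
proof
  assume k: "is_kernel C K A B k f"
  then have t: "arr k" "src k = K" "tgt k = A" "arr f" "src f = A" "tgt f = B" "f \<odot> k = zero K B"
    "A \<in> Ob C" "B \<in> Ob C" "K \<in> Ob C"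
    unfolding is_kernel_def Hom_iff by blast+
  have ex: "\<exists>!u. u \<in> Hom C L K \<and> k \<odot> u = h" if "h \<in> Hom C L A" "f \<odot> h = zero L B" for L h
    using k that unfolding is_kernel_def by blast
  have "mon C k"
  proof (rule monI)
    fix h assume h: "arr h" "tgt h = src k" "k \<odot> h = zero (src h) (tgt k)"
    have z: "zero (src h) A \<in> Hom C (src h) A" "f \<odot> zero (src h) A = zero (src h) B"
      using h t by auto
    have "zero (src h) K \<in> Hom C (src h) K \<and> k \<odot> zero (src h) K = zero (src h) A"
      "h \<in> Hom C (src h) K \<and> k \<odot> h = zero (src h) A"
      using h t by auto
    with ex[OF z] have "h = zero (src h) K"
      by blast
    with t show "h = zero (src h) (src k)" by simp
  qed (use t in auto)
  moreover have "\<exists>u. arr u \<and> src u = src h \<and> tgt u = src k \<and> k \<odot> u = h"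
    if "arr h" "tgt h = src f" "f \<odot> h = zero (src h) (tgt f)" for h
    using ex[of h "src h"] that t by auto
  ultimately have "kern C k f"
    unfolding kern_def by (intro conjI allI impI) (use t in simp_all)
  with t show "kern C k f \<and> src k = K \<and> src f = A \<and> tgt f = B" by simp
next
  assume k: "kern C k f \<and> src k = K \<and> src f = A \<and> tgt f = B"
  note d = kernD[OF k[THEN conjunct1]]
  have "\<exists>!u. u \<in> Hom C L K \<and> k \<odot> u = h" if h: "h \<in> Hom C L A" "f \<odot> h = zero L B" for L h
  proof -
    obtain u where "u \<in> Hom C L K" "k \<odot> u = h"
      using d(5)[of h] h k d(1) by (metis Hom_iff mon_arr src_Ob)
    moreover have "v = u" if "v \<in> Hom C L K" "k \<odot> v = h" for v
      by (rule mon_cancel[OF d(1)]) (use that calculation k in simp_all)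
    ultimately show ?thesis by blast
  qed
  moreover have "k \<in> Hom C K A" "f \<in> Hom C A B" "f \<odot> k = zero K B"
    using k d(1-4) by auto
  ultimately show "is_kernel C K A B k f"
    unfolding is_kernel_def by blast
qed

lemma mon_comp:
  assumes "mon C f" "mon C g" "src g = tgt f"
  shows "mon C (g \<odot> f)"
proof (rule monI)
  fix h assume h: "arr h" "tgt h = src (g \<odot> f)" "g \<odot> f \<odot> h = zero (src h) (tgt (g \<odot> f))"
  then have "f \<odot> h = zero (src h) (tgt f)"
    using mon_zero[of g "f \<odot> h"] assms by simp
  with h assms show "h = zero (src h) (src (g \<odot> f))"
    using mon_zero[of f h] by simp
qed (use assms in auto)

lemma mon_second:
  assumes "mon C (g \<odot> f)" "arr f" "arr g" "src g = tgt f"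
  shows "mon C f"
proof (rule monI)
  fix h assume h: "arr h" "tgt h = src f" "f \<odot> h = zero (src h) (tgt f)"
  with assms have "g \<odot> f \<odot> h = zero (src h) (tgt (g \<odot> f))"
    by simp
  with h assms show "h = zero (src h) (src f)"
    using mon_zero[of "g \<odot> f" h] by simp
qed (use assms in auto)

lemma mon_Id: "A \<in> Ob C \<Longrightarrow> mon C (Id C A)"
  by (rule monI) auto

lemma dual_preadditive: "preadditive_category (dual C)"
proof (intro preadditive_category.intro category.intro preadditive_category_axioms.intro)
  fix A B f A' B'
  show "f \<in> Hom (dual C) A B \<Longrightarrow> A \<in> Ob (dual C) \<and> B \<in> Ob (dual C)"
    by simp
  show "f \<in> Hom (dual C) A B \<Longrightarrow> f \<in> Hom (dual C) A' B' \<Longrightarrow> A = A' \<and> B = B'"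
    by simp
  show "A \<in> Ob (dual C) \<Longrightarrow> Id (dual C) A \<in> Hom (dual C) A A"
    by simp
  show "f \<in> Hom (dual C) A B \<Longrightarrow> f \<odot>\<^bsub>dual C\<^esub> Id (dual C) A = f"
    by simp
  show "f \<in> Hom (dual C) A B \<Longrightarrow> Id (dual C) B \<odot>\<^bsub>dual C\<^esub> f = f"
    by simp
next
  fix f A B g D h E
  assume "f \<in> Hom (dual C) A B" "g \<in> Hom (dual C) B D"
  then show "g \<odot>\<^bsub>dual C\<^esub> f \<in> Hom (dual C) A D"
    by simp
next
  fix f A B g D h E
  assume "f \<in> Hom (dual C) A B" "g \<in> Hom (dual C) B D" "h \<in> Hom (dual C) D E"
  then show "h \<odot>\<^bsub>dual C\<^esub> g \<odot>\<^bsub>dual C\<^esub> f = h \<odot>\<^bsub>dual C\<^esub> (g \<odot>\<^bsub>dual C\<^esub> f)"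
    by simp
next
  fix A B assume "A \<in> Ob (dual C)" "B \<in> Ob (dual C)"
  then show "comm_group \<lparr>carrier = Hom (dual C) A B, monoid.mult = Plus (dual C), one = Zero (dual C) A B\<rparr>"
    using Hom_group[of B A] by (simp only: dual_sel)
next
  fix f A B f' g D
  assume "f \<in> Hom (dual C) A B" "f' \<in> Hom (dual C) A B" "g \<in> Hom (dual C) B D"
  then show "g \<odot>\<^bsub>dual C\<^esub> (f \<boxplus>\<^bsub>dual C\<^esub> f') = (g \<odot>\<^bsub>dual C\<^esub> f) \<boxplus>\<^bsub>dual C\<^esub> (g \<odot>\<^bsub>dual C\<^esub> f')"
    by simp
next
  fix f A B g D g'
  assume "f \<in> Hom (dual C) A B" "g \<in> Hom (dual C) B D" "g' \<in> Hom (dual C) B D"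
  then show "(g \<boxplus>\<^bsub>dual C\<^esub> g') \<odot>\<^bsub>dual C\<^esub> f = (g \<odot>\<^bsub>dual C\<^esub> f) \<boxplus>\<^bsub>dual C\<^esub> (g' \<odot>\<^bsub>dual C\<^esub> f)"
    by simp
qed

lemmas epi_zero = preadditive_category.mon_zero[OF dual_preadditive, unfolded dual_mon dual_sel]
lemmas epi_cancel = preadditive_category.mon_cancel[OF dual_preadditive, unfolded dual_mon dual_sel]

lemma epic_iff: "epic C A B f \<longleftrightarrow> epi C f \<and> src f = A \<and> tgt f = B"
  using preadditive_category.monic_iff[OF dual_preadditive, of B A f] unfolding dual_monic dual_mon dual_sel
  by blast

lemma is_cokernel_iff: "is_cokernel C A B Q f q \<longleftrightarrow> coker C q f \<and> src f = A \<and> tgt f = B \<and> tgt q = Q"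
  using preadditive_category.is_kernel_iff[OF dual_preadditive, of Q B A q f]
  unfolding dual_is_kernel dual_kern dual_sel by blast

lemma epi_comp: "\<lbrakk>epi C f; epi C g; src g = tgt f\<rbrakk> \<Longrightarrow> epi C (g \<odot> f)"
  using preadditive_category.mon_comp[OF dual_preadditive, of g f] unfolding dual_mon dual_sel by simp

lemma epi_first: "\<lbrakk>epi C (g \<odot> f); arr f; arr g; src g = tgt f\<rbrakk> \<Longrightarrow> epi C g"
  using preadditive_category.mon_second[OF dual_preadditive, of f g] unfolding dual_mon dual_sel by simp

lemmas epi_Id = preadditive_category.mon_Id[OF dual_preadditive, unfolded dual_mon dual_sel]

end

section \<open>Images and pullbacks\<close>

text \<open>Uniqueness of the mediating arrow is expressed by testing \<open>p\<close> and
  \<open>q\<close> jointly against zero. A pushout is a \<open>pullback (dual C)\<close>.\<close>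

definition pullback :: "('o, 'm, 'z) ab_category_scheme \<Rightarrow> 'm \<Rightarrow> 'm \<Rightarrow> 'm \<Rightarrow> 'm \<Rightarrow> bool" where
  "pullback C f g p q \<longleftrightarrow>
     is_arr C f \<and> is_arr C g \<and> is_arr C p \<and> is_arr C q \<and> Cod C f = Cod C g \<and>
     Cod C p = Dom C f \<and> Cod C q = Dom C g \<and> Dom C p = Dom C q \<and> f \<odot>\<^bsub>C\<^esub> p = g \<odot>\<^bsub>C\<^esub> q \<and>
     (\<forall>x y. is_arr C x \<longrightarrow> is_arr C y \<longrightarrow> Dom C x = Dom C y \<longrightarrow> Cod C x = Dom C f \<longrightarrow> Cod C y = Dom C g \<longrightarrow>
        f \<odot>\<^bsub>C\<^esub> x = g \<odot>\<^bsub>C\<^esub> y \<longrightarrow>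
        (\<exists>u. is_arr C u \<and> Dom C u = Dom C x \<and> Cod C u = Dom C p \<and> p \<odot>\<^bsub>C\<^esub> u = x \<and> q \<odot>\<^bsub>C\<^esub> u = y)) \<and>
     (\<forall>u. is_arr C u \<longrightarrow> Cod C u = Dom C p \<longrightarrow>
        p \<odot>\<^bsub>C\<^esub> u = Zero C (Dom C u) (Cod C p) \<longrightarrow> q \<odot>\<^bsub>C\<^esub> u = Zero C (Dom C u) (Cod C q) \<longrightarrow>
        u = Zero C (Dom C u) (Dom C p))"

definition biproduct ::
    "('o, 'm, 'z) ab_category_scheme \<Rightarrow> 'o \<Rightarrow> 'o \<Rightarrow> 'o \<Rightarrow> 'm \<Rightarrow> 'm \<Rightarrow> 'm \<Rightarrow> 'm \<Rightarrow> bool" where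
  "biproduct C A B S i j p q \<longleftrightarrow>
     i \<in> Hom C A S \<and> j \<in> Hom C B S \<and> p \<in> Hom C S A \<and> q \<in> Hom C S B \<and>
     p \<odot>\<^bsub>C\<^esub> i = Id C A \<and> q \<odot>\<^bsub>C\<^esub> j = Id C B \<and> p \<odot>\<^bsub>C\<^esub> j = Zero C B A \<and> q \<odot>\<^bsub>C\<^esub> i = Zero C A B \<and>
     (i \<odot>\<^bsub>C\<^esub> p) \<boxplus>\<^bsub>C\<^esub> (j \<odot>\<^bsub>C\<^esub> q) = Id C S"

context preadditive_category
begin

lemma biproductD:
  assumes "biproduct C A B S i j p q"
  shows "arr i" "src i = A" "tgt i = S" "arr j" "src j = B" "tgt j = S"
    "arr p" "src p = S" "tgt p = A" "arr q" "src q = S" "tgt q = B" "A \<in> Ob C" "B \<in> Ob C" "S \<in> Ob C"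
    "p \<odot> i = Id C A" "q \<odot> j = Id C B" "p \<odot> j = zero B A" "q \<odot> i = zero A B"
    "(i \<odot> p) \<boxplus> (j \<odot> q) = Id C S"
  using assms unfolding biproduct_def Hom_iff by blast+

lemma pullbackD:
  assumes "pullback C f g p q"
  shows "arr f" "arr g" "arr p" "arr q" "tgt f = tgt g" "tgt p = src f" "tgt q = src g" "src p = src q"
    "f \<odot> p = g \<odot> q"
    "\<And>x y. \<lbrakk>f \<odot> x = g \<odot> y; arr x; arr y; src x = src y; tgt x = src f; tgt y = src g\<rbrakk> \<Longrightarrow>
       \<exists>u. arr u \<and> src u = src x \<and> tgt u = src p \<and> p \<odot> u = x \<and> q \<odot> u = y"
    "\<And>u. \<lbrakk>p \<odot> u = zero (src u) (tgt p); q \<odot> u = zero (src u) (tgt q); arr u; tgt u = src p\<rbrakk> \<Longrightarrow>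
       u = zero (src u) (src p)"
  using assms unfolding pullback_def by blast+

lemma pullback_sym:
  assumes "pullback C f g p q"
  shows "pullback C g f q p"
proof -
  note d = pullbackD[OF assms]
  show ?thesis
    unfolding pullback_def
  proof (intro conjI allI impI)
    fix x y assume "arr x" "arr y" "src x = src y" "tgt x = src g" "tgt y = src f" "g \<odot> x = f \<odot> y"
    then show "\<exists>u. arr u \<and> src u = src x \<and> tgt u = src q \<and> q \<odot> u = x \<and> p \<odot> u = y"
      using d(10)[of y x] unfolding d(8) by metis
  next
    fix u assume "arr u" "tgt u = src q" "q \<odot> u = zero (src u) (tgt q)" "p \<odot> u = zero (src u) (tgt p)"
    then show "u = zero (src u) (src q)"
      using d(11)[of u] unfolding d(8) by metis
  qed (use d(1-9) in simp_all)
qed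

lemma Plus_eq_self:
  assumes "x \<boxplus> x = x" "arr x"
  shows "x = zero (src x) (tgt x)"
  by (rule Plus_cancel[of x _ x]) (use assms in auto)

end

context abelian_category
begin

lemma ex_kern: "arr f \<Longrightarrow> \<exists>k. kern C k f"
  using ex_kernel[OF arr_Hom[of f]] unfolding is_kernel_iff by blast

lemma ex_coker: "arr f \<Longrightarrow> \<exists>q. coker C q f"
  using ex_cokernel[OF arr_Hom[of f]] unfolding is_cokernel_iff by blast

lemma ex_biproduct':
  assumes "A \<in> Ob C" "B \<in> Ob C"
  shows "\<exists>S i j p q. biproduct C A B S i j p q"
proof -
  obtain S i j p q where h: "i\<in>Hom C A S" "j\<in>Hom C B S" "p\<in>Hom C S A" "q\<in>Hom C S B"
    "p \<odot> i = Id C A" "q \<odot> j = Id C B" "(i \<odot> p) \<boxplus> (j \<odot> q) = Id C S"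
    using ex_biproduct[OF assms] by blast
  then have t: "arr i" "src i = A" "tgt i = S" "arr j" "src j = B" "tgt j = S"
    "arr p" "src p = S" "tgt p = A" "arr q" "src q = S" "tgt q = B" "S \<in> Ob C"
    by auto
  \<comment> \<open>Sandwiching the identity \<open>i p + j q\<close> between \<open>p\<close> and
    \<open>j\<close> gives \<open>p j + p j = p j\<close>, which forces the cross term to
    vanish.\<close>
  have "p \<odot> ((i \<odot> p) \<boxplus> (j \<odot> q)) \<odot> j = p \<odot> j"
    unfolding h(7) using t by simp
  then have "(p \<odot> j) \<boxplus> (p \<odot> j) = p \<odot> j"
    using t h(5,6) by (simp add: Comp_eq_comp[OF h(5)])
  from Plus_eq_self[OF this] have pj: "p \<odot> j = zero B A"
    using t by simp
  have "q \<odot> ((i \<odot> p) \<boxplus> (j \<odot> q)) \<odot> i = q \<odot> i"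
    unfolding h(7) using t by simp
  then have "(q \<odot> i) \<boxplus> (q \<odot> i) = q \<odot> i"
    using t h(5,6) by (simp add: Comp_eq_comp[OF h(6)])
  from Plus_eq_self[OF this] have "q \<odot> i = zero A B"
    using t by simp
  with h pj have "biproduct C A B S i j p q"
    unfolding biproduct_def by blast
  then show ?thesis by blast
qed

lemma dual_abelian: "abelian_category (dual C)"
proof (intro abelian_category.intro dual_preadditive abelian_category_axioms.intro)
  show "\<exists>Z. zero_object (dual C) Z"
    using ex_zero by (simp only: zero_object_def dual_sel conj_commute)
next
  fix A B assume "A \<in> Ob (dual C)" "B \<in> Ob (dual C)"
  then obtain S i j p q where h: "i\<in>Hom C A S" "j\<in>Hom C B S" "p\<in>Hom C S A" "q\<in>Hom C S B"
    "p \<odot> i = Id C A" "q \<odot> j = Id C B" "(i \<odot> p) \<boxplus> (j \<odot> q) = Id C S"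
    using ex_biproduct[of A B] unfolding dual_sel by blast
  then show "\<exists>S. \<exists>i\<in>Hom (dual C) A S. \<exists>j\<in>Hom (dual C) B S. \<exists>p\<in>Hom (dual C) S A. \<exists>q\<in>Hom (dual C) S B.
        p \<odot>\<^bsub>dual C\<^esub> i = Id (dual C) A \<and> q \<odot>\<^bsub>dual C\<^esub> j = Id (dual C) B \<and>
        i \<odot>\<^bsub>dual C\<^esub> p \<boxplus>\<^bsub>dual C\<^esub> j \<odot>\<^bsub>dual C\<^esub> q = Id (dual C) S"
    unfolding dual_sel by blast
next
  fix f A B assume "f \<in> Hom (dual C) A B"
  then show "\<exists>K k. is_kernel (dual C) K A B k f"
    using ex_cokernel[of f B A] unfolding dual_is_kernel dual_sel by iprover
next
  fix f A B assume "f \<in> Hom (dual C) A B"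
  then show "\<exists>Q q. is_cokernel (dual C) A B Q f q"
    using ex_kernel[of f B A] unfolding dual_is_kernel dual_sel by iprover
next
  fix A B f assume "monic (dual C) A B f"
  then have "epic C B A f"
    unfolding dual_monic .
  from epic_cokernel[OF this] show "\<exists>D g. is_kernel (dual C) A B D f g"
    unfolding dual_is_kernel .
next
  fix A B f assume "epic (dual C) A B f"
  then have "monic C B A f"
    unfolding dual_monic .
  from monic_kernel[OF this] show "\<exists>D g. is_cokernel (dual C) D A B g f"
    unfolding dual_is_kernel .
qed

text \<open>By axiom \<open>f\<close> is the kernel of some \<open>g\<close>. Since
  \<open>g \<odot> f\<close> vanishes, \<open>g\<close> factors through the cokernel
  \<open>q\<close>, so anything killed by \<open>q\<close> is killed by \<open>g\<close> and factors
  through \<open>f\<close>.\<close>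

lemma mon_kern:
  assumes "mon C f" "coker C q f"
  shows "kern C f q"
proof -
  note q = cokerD[OF assms(2)]
  have "monic C (src f) (tgt f) f"
    using assms unfolding monic_iff by simp
  from monic_kernel[OF this] obtain g where g: "kern C f g"
    unfolding is_kernel_iff by blast
  note g' = kernD[OF g]
  obtain u where u: "arr u" "src u = tgt q" "tgt u = tgt g" "u \<odot> q = g"
    using q(5)[OF g'(4)] g' by metis
  have "\<exists>v. arr v \<and> src v = src h \<and> tgt v = src f \<and> f \<odot> v = h"
    if h: "arr h" "tgt h = src q" "q \<odot> h = zero (src h) (tgt q)" for h
  proof (rule g'(5))
    have "u \<odot> (q \<odot> h) = g \<odot> h"
      by (rule Comp_eq_comp[OF u(4)]) (use h u q(1) in simp_all)
    then show "g \<odot> h = zero (src h) (tgt g)"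
      using h u by simp
  qed (use h g' q in simp_all)
  then show ?thesis
    unfolding kern_def using assms(1) q(1-4) by simp
qed

lemmas epi_coker = abelian_category.mon_kern[OF dual_abelian, unfolded dual_mon dual_kern]

text \<open>\<open>m\<close> is the kernel of the cokernel of \<open>f\<close>. That
  \<open>e\<close> is epic is the substantial point: if \<open>h \<odot> e\<close> vanishes,
  \<open>f\<close> factors through the smaller subobject cut out by the kernel \<open>k\<close> of
  \<open>h\<close>, and this subobject turns out to be all of \<open>m\<close>.\<close>

lemma image:
  assumes f: "arr f"
  shows "\<exists>m e. mon C m \<and> epi C e \<and> src m = tgt e \<and> m \<odot> e = f \<and> src e = src f \<and> tgt m = tgt f"
proof -
  obtain q where "coker C q f"
    using ex_coker[OF f] by blast
  note q = cokerD[OF this]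
  obtain m where "kern C m q"
    using ex_kern[of q] q(1) by auto
  note m = kernD[OF this]
  obtain e where e: "arr e" "src e = src f" "tgt e = src m" "m \<odot> e = f"
    using m(5)[of f] q f by auto
  have "epi C e"
  proof (rule epiI)
    fix h assume h: "arr h" "src h = tgt e" "h \<odot> e = zero (src e) (tgt h)"
    obtain k where "kern C k h"
      using ex_kern[OF h(1)] by blast
    note k = kernD[OF this]
    obtain e' where e': "arr e'" "src e' = src e" "tgt e' = src k" "k \<odot> e' = e"
      using k(5)[of e] h e by auto
    \<comment> \<open>\<open>m \<odot> k\<close> is monic, hence the kernel of its cokernel
      \<open>g\<close>. As \<open>f\<close> factors through \<open>m \<odot> k\<close>,
      \<open>g\<close> kills \<open>f\<close>, so it factors through \<open>q\<close> and kills
      \<open>m\<close>; thus \<open>m\<close> factors through \<open>m \<odot> k\<close>, and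
      \<open>k\<close> has a right inverse.\<close>
    have mk: "mon C (m \<odot> k)"
      using mon_comp[of k m] k m h e by simp
    then obtain g where g: "coker C g (m \<odot> k)"
      using ex_coker[of "m \<odot> k"] by auto
    note g' = kernD[OF mon_kern[OF mk g]]
    have gmk: "g \<odot> (m \<odot> k) = zero (src k) (tgt g)" "src g = tgt m"
      using g'(3,4) m(1) k(1,3) h e by auto
    have f': "m \<odot> (k \<odot> e') = f"
      using e' e by simp
    have "g \<odot> f = zero (src f) (tgt g)"
    proof -
      have "g \<odot> f = (g \<odot> (m \<odot> k)) \<odot> e'"
        unfolding f'[symmetric] using e'(1-3) e(1-3) g'(2) gmk(2) m(1) k(1,3) h(2) by simp
      then show ?thesis
        unfolding gmk(1) using e' e g'(2) k(1) by simp
    qed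
    then obtain w where w: "arr w" "src w = tgt q" "tgt w = tgt g" "w \<odot> q = g"
      using q(5)[of g] gmk m g'(2) q by auto
    have "g \<odot> m = zero (src m) (tgt g)"
      using Comp_eq_comp[OF w(4), of m] w m q by simp
    then have "\<exists>v. arr v \<and> src v = src m \<and> tgt v = src (m \<odot> k) \<and> (m \<odot> k) \<odot> v = m"
      by (rule g'(5)) (use m(1) gmk in simp_all)
    then obtain v where v: "arr v" "src v = src m" "tgt v = src k" "(m \<odot> k) \<odot> v = m"
      using m(1) k(1,3) h(2) e(3) by auto
    have "k \<odot> v = Id C (src m)"
      by (rule mon_cancel[OF m(1)]) (use v k h e m in simp_all)
    then have "h = h \<odot> (k \<odot> v)"
      using h e by simp
    also have "\<dots> = zero (tgt e) (tgt h)"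
      using v k h e by (simp add: Comp_eq_comp[OF k(4)])
    finally show "h = zero (tgt e) (tgt h)" .
  qed (use e in simp)
  with m(1) e m(3) q(3) show ?thesis
    by (intro exI[of _ m] exI[of _ e]) simp
qed

lemma ex_pullback:
  assumes "arr f" "arr g" "tgt f = tgt g"
  shows "\<exists>p q. pullback C f g p q"
proof -
  obtain S i j P Q where b: "biproduct C (src f) (src g) S i j P Q"
    using ex_biproduct'[of "src f" "src g"] assms by auto
  note b = biproductD[OF this]
  let ?\<phi> = "f \<odot> P \<boxminus> g \<odot> Q"
  have a: "arr ?\<phi>" "src ?\<phi> = S" "tgt ?\<phi> = tgt g"
    using b assms by auto
  obtain n where "kern C n ?\<phi>"
    using ex_kern[OF a(1)] by blast
  note n = kernD[OF this]
  have "pullback C f g (P \<odot> n) (Q \<odot> n)"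
    unfolding pullback_def
  proof (intro conjI allI impI)
    have "f \<odot> P \<odot> n \<boxminus> g \<odot> Q \<odot> n = zero (src n) (tgt g)"
      using n(1,3,4) a b assms by simp
    then show "f \<odot> (P \<odot> n) = g \<odot> (Q \<odot> n)"
      using n(1,3) a(2) b assms by simp
  next
    fix x y assume xy: "arr x" "arr y" "src x = src y" "tgt x = src f" "tgt y = src g" "f \<odot> x = g \<odot> y"
    let ?h = "i \<odot> x \<boxplus> j \<odot> y"
    have h: "arr ?h" "src ?h = src y" "tgt ?h = S"
      using xy b by auto
    have Ph: "P \<odot> ?h = x" "Q \<odot> ?h = y"
      using xy b by (simp_all add: Comp_eq_comp[OF b(16)] Comp_eq_comp[OF b(17)] Comp_eq_comp[OF b(18)] Comp_eq_comp[OF b(19)])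
    have "f \<odot> P \<odot> ?h = f \<odot> x" "g \<odot> Q \<odot> ?h = g \<odot> y"
      using b h assms Ph by (simp_all del: Comp_Plus_distrib)
    then have "?\<phi> \<odot> ?h = zero (src y) (tgt g)"
      using b h assms xy by (simp del: Comp_Plus_distrib)
    then obtain u where u: "arr u" "src u = src y" "tgt u = src n" "n \<odot> u = ?h"
      using n(5)[of ?h] h a by auto
    show "\<exists>u. arr u \<and> src u = src x \<and> tgt u = src (P \<odot> n) \<and> P \<odot> n \<odot> u = x \<and> Q \<odot> n \<odot> u = y"
      using u Ph n(1,3) a(2) b xy(3) by (intro exI[of _ u]) (simp del: Comp_Plus_distrib)
  next
    fix u assume u: "arr u" "tgt u = src (P \<odot> n)" "P \<odot> n \<odot> u = zero (src u) (tgt (P \<odot> n))"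
       "Q \<odot> n \<odot> u = zero (src u) (tgt (Q \<odot> n))"
    then have u': "arr u" "tgt u = src n" "P \<odot> (n \<odot> u) = zero (src u) (src f)"
       "Q \<odot> (n \<odot> u) = zero (src u) (src g)"
      using n(1,3) a(2) b by simp_all
    have "n \<odot> u = (i \<odot> P \<boxplus> j \<odot> Q) \<odot> (n \<odot> u)"
      unfolding b(20) using n(1,3) a(2) u' by simp
    also have "\<dots> = zero (src u) S"
      using b(1-15) n(1,3) a(2) u' by simp
    finally have "u = zero (src u) (src n)"
      using mon_zero[OF n(1), of u] u' n(3) a(2) by simp
    then show "u = zero (src u) (src (P \<odot> n))"
      using n(1,3) a(2) b by simp
  qed (use n(1,3) a b assms in simp_all)
  then show ?thesis by blast
qed

text \<open>Every pullback, not just the one constructed above, is such a kernel on the biproduct;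
  this makes the difference arrow available as a cokernel in the arguments on epics.\<close>

lemma pullback_kern:
  assumes "pullback C f g p q" "biproduct C (src f) (src g) S i j P Q"
  shows "kern C (i \<odot> p \<boxplus> j \<odot> q) (f \<odot> P \<boxminus> g \<odot> Q)"
proof -
  note d = pullbackD[OF assms(1)] and b = biproductD[OF assms(2)]
  note r = Comp_eq_comp[OF b(16)] Comp_eq_comp[OF b(17)] Comp_eq_comp[OF b(18)] Comp_eq_comp[OF b(19)]
  let ?n = "i \<odot> p \<boxplus> j \<odot> q" and ?\<phi> = "f \<odot> P \<boxminus> g \<odot> Q"
  have a: "arr ?\<phi>" "src ?\<phi> = S" "tgt ?\<phi> = tgt g" "arr ?n" "src ?n = src p" "tgt ?n = S"
    using b d(1-8) by auto
  have Pn: "P \<odot> ?n = p" "Q \<odot> ?n = q"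
    using b d(1-8) by (simp_all add: r)
  have \<phi>: "?\<phi> \<odot> x = f \<odot> (P \<odot> x) \<boxminus> g \<odot> (Q \<odot> x)" if "arr x" "tgt x = S" for x
    using that b d(1-8) by simp
  show ?thesis
    unfolding kern_def
  proof (intro conjI allI impI)
    show "mon C ?n"
    proof (rule monI)
      fix h assume h: "arr h" "tgt h = src ?n" "?n \<odot> h = zero (src h) (tgt ?n)"
      have "P \<odot> ?n \<odot> h = zero (src h) (src f)" "Q \<odot> ?n \<odot> h = zero (src h) (src g)"
        using h a b by (simp_all del: Plus_Comp_distrib Comp_Plus_distrib)
      then show "h = zero (src h) (src ?n)"
        unfolding Pn using d(11)[of h] h a b d(6,7) by simp
    qed (use a in simp)
    show "?\<phi> \<odot> ?n = zero (src ?n) (tgt ?\<phi>)"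
      using \<phi>[of ?n] a Pn d(1-9) by simp
  next
    fix h assume h: "arr h" "tgt h = src ?\<phi>" "?\<phi> \<odot> h = zero (src h) (tgt ?\<phi>)"
    have "f \<odot> (P \<odot> h) = g \<odot> (Q \<odot> h)"
      using h \<phi>[of h] a b d(1-8) by simp
    then obtain u where u: "arr u" "src u = src h" "tgt u = src p" "p \<odot> u = P \<odot> h" "q \<odot> u = Q \<odot> h"
      using d(10)[of "P \<odot> h" "Q \<odot> h"] h a b by auto
    have "?n \<odot> u = (i \<odot> P \<boxplus> j \<odot> Q) \<odot> h"
      using u h a b(1-15) d(1-8) by simp
    then have "?n \<odot> u = h"
      unfolding b(20) using h a by simp
    with u a show "\<exists>u. arr u \<and> src u = src h \<and> tgt u = src ?n \<and> ?n \<odot> u = h"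
      by (intro exI[of _ u]) simp
  qed (use a in simp_all)
qed

text \<open>The difference arrow is epic because its restriction along \<open>i\<close> is
  \<open>f\<close>, so it is the cokernel of the pullback embedding. If \<open>t \<odot> q\<close>
  vanishes, \<open>t \<odot> Q\<close> factors through it by some \<open>u\<close>; restriction
  along \<open>i\<close> gives \<open>u = 0\<close>, and then restriction along \<open>j\<close>
  gives \<open>t = 0\<close>.\<close>

lemma pullback_epi:
  assumes "pullback C f g p q" "epi C f"
  shows "epi C q"
proof -
  note d = pullbackD[OF assms(1)]
  obtain S i j P Q where B: "biproduct C (src f) (src g) S i j P Q"
    using ex_biproduct'[of "src f" "src g"] d by auto
  note b = biproductD[OF B]
  let ?n = "i \<odot> p \<boxplus> j \<odot> q" and ?\<phi> = "f \<odot> P \<boxminus> g \<odot> Q"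
  have a: "arr ?\<phi>" "src ?\<phi> = S" "tgt ?\<phi> = tgt g" "arr ?n" "src ?n = src p" "tgt ?n = S"
    using b d(1-8) by auto
  have \<phi>i: "?\<phi> \<odot> i = f"
    using b d(1-8) by simp
  have "epi C ?\<phi>"
    by (rule epi_first[of _ i]) (use \<phi>i assms(2) a b in simp_all)
  from cokerD[OF epi_coker[OF this pullback_kern[OF assms(1) B]]]
  have *: "\<And>h. \<lbrakk>h \<odot> ?n = zero (src ?n) (tgt h); arr h; src h = tgt ?n\<rbrakk> \<Longrightarrow>
        \<exists>u. arr u \<and> src u = tgt ?\<phi> \<and> tgt u = tgt h \<and> u \<odot> ?\<phi> = h"
    by blast
  show ?thesis
  proof (rule epiI)
    fix t assume t: "arr t" "src t = tgt q" "t \<odot> q = zero (src q) (tgt t)"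
    have "Q \<odot> ?n = q"
      using b d(1-8) by (simp add: Comp_eq_comp[OF b(17)] Comp_eq_comp[OF b(19)])
    then have "t \<odot> Q \<odot> ?n = zero (src ?n) (tgt t)"
      using t a b d(6-8) by (simp del: Comp_Plus_distrib)
    then obtain u where u: "arr u" "src u = tgt g" "tgt u = tgt t" "u \<odot> ?\<phi> = t \<odot> Q"
      using *[of "t \<odot> Q"] a t b d(6-8) by auto
    have "u \<odot> f = t \<odot> (Q \<odot> i)"
      using Comp_eq_comp[OF u(4), of i] \<phi>i t u a b d by simp
    then have "u \<odot> f = zero (src f) (tgt u)"
      using b t u d by simp
    from epi_zero[OF assms(2) this] have u0: "u = zero (tgt f) (tgt t)"
      using u d by simp
    have "t = (t \<odot> Q) \<odot> j"
      using t b d by simp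
    also have "\<dots> = zero (tgt q) (tgt t)"
      unfolding u(4)[symmetric] u0 using a b d(1-8) t by simp
    finally show "t = zero (tgt q) (tgt t)" .
  qed (use d in simp)
qed

lemma pullback_mon:
  assumes "pullback C f g p q" "mon C f"
  shows "mon C q"
proof -
  note d = pullbackD[OF assms(1)]
  show ?thesis
  proof (rule monI)
    fix h assume h: "arr h" "tgt h = src q" "q \<odot> h = zero (src h) (tgt q)"
    have "f \<odot> (p \<odot> h) = zero (src h) (tgt f)"
      using h d(1-8) by (simp add: Comp_eq_comp[OF d(9)])
    then have "p \<odot> h = zero (src h) (src f)"
      using mon_zero[OF assms(2), of "p \<odot> h"] h d by simp
    then show "h = zero (src h) (src q)"
      using d(11)[of h] h d(6-8) by simp
  qed (use d in simp)
qed

lemmas ex_pushout = abelian_category.ex_pullback[OF dual_abelian, unfolded dual_sel]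
lemmas pushout_mon = abelian_category.pullback_epi[OF dual_abelian, unfolded dual_mon]
lemmas pushoutD = preadditive_category.pullbackD[OF abelian_category.axioms(1)[OF dual_abelian], unfolded dual_sel]

end

section \<open>The calculus of null arrows\<close>

text \<open>
  In \<open>X/Y\<close> null arrows become zero, and \<open>Ymon\<close> and \<open>Yepi\<close> arrows become monic and epic.
\<close>

definition null :: "('o, 'm, 'z) ab_category_scheme \<Rightarrow> 'o set \<Rightarrow> 'm \<Rightarrow> bool" where
  "null C Y f \<longleftrightarrow> (\<exists>a b. is_arr C a \<and> is_arr C b \<and> Cod C a = Dom C b \<and> Dom C b \<in> Y \<and> b \<odot>\<^bsub>C\<^esub> a = f)"

definition Ymon :: "('o, 'm, 'z) ab_category_scheme \<Rightarrow> 'o set \<Rightarrow> 'm \<Rightarrow> bool" where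
  "Ymon C Y f \<longleftrightarrow> is_arr C f \<and>
     (\<forall>h. is_arr C h \<longrightarrow> Cod C h = Dom C f \<longrightarrow> null C Y (f \<odot>\<^bsub>C\<^esub> h) \<longrightarrow> null C Y h)"

definition Yepi :: "('o, 'm, 'z) ab_category_scheme \<Rightarrow> 'o set \<Rightarrow> 'm \<Rightarrow> bool" where
  "Yepi C Y f \<longleftrightarrow> is_arr C f \<and>
     (\<forall>h. is_arr C h \<longrightarrow> Dom C h = Cod C f \<longrightarrow> null C Y (h \<odot>\<^bsub>C\<^esub> f) \<longrightarrow> null C Y h)"

lemma dual_zero_object: "zero_object (dual C) Z \<longleftrightarrow> zero_object C Z"
  unfolding zero_object_def dual_sel by (simp only: conj_commute)

lemma dual_null [simp]: "null (dual C) Y = null C Y"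
  unfolding null_def[abs_def] dual_sel by (rule ext) metis

lemma dual_Ymon [simp]: "Ymon (dual C) Y = Yepi C Y" "Yepi (dual C) Y = Ymon C Y"
  unfolding Ymon_def[abs_def] Yepi_def[abs_def] dual_sel dual_null by (rule refl)+

text \<open>Closure properties that are self-dual as a whole, so that \<open>dual_serre\<close> is
  available. Small direct sums, which break the symmetry, are added in
  \<open>localizing_subcategory\<close>.\<close>

locale serre = abelian_category C for C :: "('o, 'm, 'z) ab_category_scheme" (structure) +
  fixes Y :: "'o set"
  assumes Y_Ob: "Y \<subseteq> Ob C"
    and Y_zero: "zero_object C Z \<Longrightarrow> Z \<in> Y"
    and Y_sub: "mon C f \<Longrightarrow> Cod C f \<in> Y \<Longrightarrow> Dom C f \<in> Y"
    and Y_quot: "epi C f \<Longrightarrow> Dom C f \<in> Y \<Longrightarrow> Cod C f \<in> Y"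
    and Y_ext: "kern C f g \<Longrightarrow> coker C g f \<Longrightarrow> Dom C f \<in> Y \<Longrightarrow> Cod C g \<in> Y \<Longrightarrow> Cod C f \<in> Y"

context preadditive_category
begin

lemma nullE:
  assumes "null C Y f"
  obtains a b where "arr a" "arr b" "tgt a = src b" "src b \<in> Y" "b \<odot> a = f" "src a = src f" "tgt b = tgt f"
  using assms unfolding null_def by fastforce

lemma nullI:
  assumes "arr a" "arr b" "tgt a = src b" "src b \<in> Y" "b \<odot> a = f"
  shows "null C Y f"
  using assms unfolding null_def by blast

lemma null_arr [simp]: "null C Y f \<Longrightarrow> arr f"
  by (erule nullE) auto

lemma null_comp_left:
  assumes "null C Y f" "arr g" "src g = tgt f"
  shows "null C Y (g \<odot> f)"
proof -
  obtain a b where "arr a" "arr b" "tgt a = src b" "src b \<in> Y" "b \<odot> a = f" "src a = src f" "tgt b = tgt f"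
    using nullE[OF assms(1)] by blast
  with assms show ?thesis
    by (intro nullI[of a "g \<odot> b"]) simp_all
qed

lemma null_comp_right:
  assumes "null C Y f" "arr g" "tgt g = src f"
  shows "null C Y (f \<odot> g)"
proof -
  obtain a b where "arr a" "arr b" "tgt a = src b" "src b \<in> Y" "b \<odot> a = f" "src a = src f" "tgt b = tgt f"
    using nullE[OF assms(1)] by blast
  with assms show ?thesis
    by (intro nullI[of "a \<odot> g" b]) (simp_all add: assoc[symmetric] del: assoc)
qed

lemma YmonD:
  assumes "Ymon C Y f"
  shows "arr f" "\<And>h. \<lbrakk>null C Y (f \<odot> h); arr h; tgt h = src f\<rbrakk> \<Longrightarrow> null C Y h"
  using assms unfolding Ymon_def by blast+

lemma Ymon_comp:
  assumes "Ymon C Y f" "Ymon C Y g" "src g = tgt f"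
  shows "Ymon C Y (g \<odot> f)"
  unfolding Ymon_def
proof (intro conjI allI impI)
  note f = YmonD[OF assms(1)] and g = YmonD[OF assms(2)]
  show "arr (g \<odot> f)" using f(1) g(1) assms(3) by simp
  fix h assume h: "arr h" "tgt h = src (g \<odot> f)" "null C Y (g \<odot> f \<odot> h)"
  show "null C Y h"
    by (rule f(2)[OF g(2)]) (use h f(1) g(1) assms(3) in simp_all)
qed

lemmas YepiD = preadditive_category.YmonD[OF dual_preadditive, unfolded dual_Ymon dual_null dual_sel]

lemma Yepi_comp: "\<lbrakk>Yepi C Y f; Yepi C Y g; src g = tgt f\<rbrakk> \<Longrightarrow> Yepi C Y (g \<odot> f)"
  using preadditive_category.Ymon_comp[OF dual_preadditive, of Y g f] unfolding dual_Ymon dual_sel by simp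

lemma Yepi_first:
  assumes "Yepi C Y (g \<odot> f)" "arr f" "arr g" "src g = tgt f"
  shows "Yepi C Y g"
  unfolding Yepi_def
proof (intro conjI allI impI)
  note gf = YepiD[OF assms(1)]
  fix h assume h: "arr h" "src h = tgt g" "null C Y (h \<odot> g)"
  show "null C Y h"
    by (rule gf(2)) (use null_comp_right[OF h(3), of f] h(1,2) assms(2-) in simp_all)
qed (rule assms)

end

context serre
begin

abbreviation "nul \<equiv> null C Y"

text \<open>\<open>quotient_iso\<close> in terms of null arrows; in this form, closure under
  composition and pullback is checked without computing kernels and cokernels of composites.\<close>

definition qi :: "'m \<Rightarrow> bool" where
  "qi f \<longleftrightarrow> Ymon C Y f \<and> Yepi C Y f"

lemma dual_serre: "serre (dual C) Y"
proof (rule serre.intro[OF dual_abelian serre_axioms.intro])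
  show "Y \<subseteq> Ob (dual C)"
    using Y_Ob by simp
  fix Z assume "zero_object (dual C) Z"
  then show "Z \<in> Y"
    by (intro Y_zero) (simp only: dual_zero_object)
next
  fix f assume "mon (dual C) f" "Cod (dual C) f \<in> Y"
  then show "Dom (dual C) f \<in> Y"
    using Y_quot by simp
next
  fix f assume "epi (dual C) f" "Dom (dual C) f \<in> Y"
  then show "Cod (dual C) f \<in> Y"
    using Y_sub by simp
next
  fix f g assume h: "kern (dual C) f g" "coker (dual C) g f" "Dom (dual C) f \<in> Y" "Cod (dual C) g \<in> Y"
  then have "tgt g \<in> Y"
    by (intro Y_ext[of g f]) simp_all
  with h kernD(3)[of g f] show "Cod (dual C) f \<in> Y"
    by simp
qed

text \<open>The arrow factors through an object \<open>src b\<close> of Y. The image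
  \<open>src ka\<close> of the first factor is a subobject of it, the image \<open>src kb\<close> of
  \<open>b \<odot> ka\<close> is a quotient of that, and being an image of the given arrow too, it
  maps onto \<open>tgt e\<close>.\<close>

lemma null_image:
  assumes "nul (m \<odot> e)" "mon C m" "epi C e" "src m = tgt e"
  shows "tgt e \<in> Y"
proof -
  obtain a b where ab: "arr a" "arr b" "tgt a = src b" "src b \<in> Y" "b \<odot> a = m \<odot> e"
    "src a = src (m \<odot> e)" "tgt b = tgt (m \<odot> e)"
    using nullE[OF assms(1)] by blast
  then have ab': "src a = src e" "tgt b = tgt m"
    using assms(2-) by auto
  obtain ka ea where a: "mon C ka" "epi C ea" "src ka = tgt ea" "ka \<odot> ea = a" "src ea = src a" "tgt ka = tgt a"
    using image[OF ab(1)] by blast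
  have "arr (b \<odot> ka)"
    using ab(2,3) a(1,6) by simp
  from image[OF this] obtain kb eb where b: "mon C kb" "epi C eb" "src kb = tgt eb" "kb \<odot> eb = b \<odot> ka"
    "src eb = src (b \<odot> ka)" "tgt kb = tgt (b \<odot> ka)"
    by blast
  have t: "src eb = src ka" "tgt kb = tgt m"
    using b(5,6) ab(2,3) ab' a(1,6) by simp_all
  have "src ka \<in> Y"
    using Y_sub[OF a(1)] a(6) ab(3,4) by simp
  then have kbY: "src kb \<in> Y"
    using Y_quot[OF b(2)] b(3) t by simp
  have bb: "kb \<odot> (eb \<odot> ea) = m \<odot> e"
  proof -
    have "kb \<odot> (eb \<odot> ea) = (b \<odot> ka) \<odot> ea"
      by (rule Comp_eq_comp[OF b(4)]) (use a b(1-3) t in simp_all)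
    also have "\<dots> = b \<odot> a"
      using a ab(1-3) by simp
    finally show ?thesis using ab(5) by simp
  qed
  have ee: "epi C (eb \<odot> ea)"
    by (rule epi_comp) (use a b t in simp_all)
  have tee: "arr (eb \<odot> ea)" "src (eb \<odot> ea) = src e" "tgt (eb \<odot> ea) = src kb"
    using a(2,3,5) b(2,3) t ab' by simp_all
  \<comment> \<open>Comparison of the two images: the cokernel of \<open>m\<close> kills
    \<open>kb\<close> since \<open>eb \<odot> ea\<close> is epic, so \<open>kb\<close> factors
    through \<open>m\<close>, by an arrow \<open>w\<close> that is epic because \<open>e\<close>
    is.\<close>
  obtain g where g: "coker C g m"
    using ex_coker[OF mon_arr[OF assms(2)]] by blast
  note g' = kernD[OF mon_kern[OF assms(2) g]]
  have "(g \<odot> kb) \<odot> (eb \<odot> ea) = g \<odot> (m \<odot> e)"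
    unfolding bb[symmetric] using g' tee b(1) t(2) by simp
  also have "\<dots> = zero (src e) (tgt g)"
    using g' assms by (simp add: Comp_eq_comp[OF g'(4)])
  finally have "g \<odot> kb = zero (src kb) (tgt g)"
    using epi_zero[OF ee, of "g \<odot> kb"] g' tee b(1) t(2) by simp
  then have "\<exists>w. arr w \<and> src w = src kb \<and> tgt w = src m \<and> m \<odot> w = kb"
    by (rule g'(5)) (use g' b(1) t(2) in simp_all)
  then obtain w where w: "arr w" "src w = src kb" "tgt w = src m" "m \<odot> w = kb"
    by blast
  have "w \<odot> (eb \<odot> ea) = e"
    by (rule mon_cancel[OF assms(2)]) (use w tee assms bb Comp_eq_comp[OF w(4), of "eb \<odot> ea"] in simp_all)
  then have "epi C (w \<odot> (eb \<odot> ea))"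
    using assms(3) by simp
  then have "epi C w"
    by (rule epi_first) (use w tee in simp_all)
  from Y_quot[OF this] show ?thesis
    using w kbY assms(4) by simp
qed

text \<open>The image of \<open>f\<close>, embedded further by \<open>m\<close>, is the image of
  \<open>m \<odot> f\<close>, so it lies in Y.\<close>

lemma null_mon:
  assumes "nul (m \<odot> f)" "mon C m" "arr f" "src m = tgt f"
  shows "nul f"
proof -
  obtain k e where k: "mon C k" "epi C e" "src k = tgt e" "k \<odot> e = f" "src e = src f" "tgt k = tgt f"
    using image[OF assms(3)] by blast
  have mk: "mon C (m \<odot> k)"
    by (rule mon_comp) (use k assms in simp_all)
  have "(m \<odot> k) \<odot> e = m \<odot> f"
    using k assms by simp
  then have "tgt e \<in> Y"
    using null_image[of "m \<odot> k" e] assms mk k by simp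
  with k show ?thesis
    by (intro nullI[of e k]) simp_all
qed

lemmas null_epi = serre.null_mon[OF dual_serre, unfolded dual_null dual_mon dual_sel]

lemma mon_null:
  assumes "mon C f" "nul f"
  shows "src f \<in> Y"
  using null_image[of f "Id C (src f)"] assms epi_Id[of "src f"] by simp

lemma Y_null: "A \<in> Y \<Longrightarrow> arr f \<Longrightarrow> src f = A \<Longrightarrow> nul f" "A \<in> Y \<Longrightarrow> arr f \<Longrightarrow> tgt f = A \<Longrightarrow> nul f"
  by (rule nullI[of "Id C A" f] nullI[of f "Id C A"]; simp add: subsetD[OF Y_Ob])+

lemma null_zero [simp]: "A \<in> Ob C \<Longrightarrow> B \<in> Ob C \<Longrightarrow> nul (zero A B)"
proof -
  assume A: "A \<in> Ob C" "B \<in> Ob C"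
  obtain Z where Z: "zero_object C Z"
    using ex_zero by blast
  then have "Z \<in> Ob C" "Z \<in> Y"
    using Y_zero unfolding zero_object_def by auto
  with A show ?thesis
    by (intro nullI[of "zero A Z" "zero Z B"]) simp_all
qed

lemma biproduct_kern:
  assumes "biproduct C A B S i j p q"
  shows "kern C i q"
proof -
  note b = biproductD[OF assms]
  have "mon C (p \<odot> i)"
    unfolding b(16) using b(13) by (rule mon_Id)
  then have "mon C i"
    by (rule mon_second) (use b in simp_all)
  moreover have "\<exists>u. arr u \<and> src u = src h \<and> tgt u = src i \<and> i \<odot> u = h"
    if h: "arr h" "tgt h = src q" "q \<odot> h = zero (src h) (tgt q)" for h
  proof -
    have "(i \<odot> p \<boxplus> j \<odot> q) \<odot> h = i \<odot> (p \<odot> h)"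
      using h b(1-15) by simp
    then have "i \<odot> (p \<odot> h) = h"
      unfolding b(20) using h b(11) by simp
    with h b show ?thesis
      by (intro exI[of _ "p \<odot> h"]) simp
  qed
  ultimately show ?thesis
    unfolding kern_def using b by simp
qed

lemma biproduct_coker:
  assumes "biproduct C A B S i j p q"
  shows "coker C q i"
proof -
  note b = biproductD[OF assms]
  have "epi C (q \<odot> j)"
    unfolding b(17) using b(14) by (rule epi_Id)
  then have "epi C q"
    by (rule epi_first) (use b in simp_all)
  moreover have "\<exists>u. arr u \<and> src u = tgt q \<and> tgt u = tgt h \<and> u \<odot> q = h"
    if h: "arr h" "src h = tgt i" "h \<odot> i = zero (src i) (tgt h)" for h
  proof -
    have "h \<odot> (i \<odot> p \<boxplus> j \<odot> q) = h \<odot> j \<odot> q"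
      using h b(1-15) by (simp add: Comp_eq_comp[OF h(3)])
    then have "h \<odot> j \<odot> q = h"
      unfolding b(20) using h b(3) by simp
    with h b show ?thesis
      by (intro exI[of _ "h \<odot> j"]) simp
  qed
  ultimately show ?thesis
    unfolding coker_def using b by simp
qed

text \<open>Both arrows factor through the biproduct of their intermediate objects, which lies in Y
  as an extension of one by the other.\<close>

lemma null_plus_diff:
  assumes "nul f" "nul g" "src f = src g" "tgt f = tgt g"
  shows "nul (f \<boxplus> g)" "nul (f \<boxminus> g)"
proof -
  obtain a b where f: "arr a" "arr b" "tgt a = src b" "src b \<in> Y" "b \<odot> a = f" "src a = src f" "tgt b = tgt f"
    using nullE[OF assms(1)] by blast
  obtain c d where g: "arr c" "arr d" "tgt c = src d" "src d \<in> Y" "d \<odot> c = g" "src c = src g" "tgt d = tgt g"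
    using nullE[OF assms(2)] by blast
  obtain S i j p q where B: "biproduct C (src b) (src d) S i j p q"
    using ex_biproduct'[of "src b" "src d"] f g by auto
  note b = biproductD[OF B]
  note r = Comp_eq_comp[OF b(16)] Comp_eq_comp[OF b(17)] Comp_eq_comp[OF b(18)] Comp_eq_comp[OF b(19)]
  have S: "S \<in> Y"
    using Y_ext[OF biproduct_kern[OF B] biproduct_coker[OF B]] b f g by simp
  let ?n = "i \<odot> a \<boxplus> j \<odot> c"
  have n: "arr ?n" "tgt ?n = S" "p \<odot> ?n = a" "q \<odot> ?n = c"
    using f g b assms by (simp_all add: r)
  have "(b \<odot> p \<boxplus> d \<odot> q) \<odot> ?n = f \<boxplus> g" "(b \<odot> p \<boxminus> d \<odot> q) \<odot> ?n = f \<boxminus> g"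
    using f g b(1-15) n assms by (simp_all del: Comp_Plus_distrib)
  with S n(1,2) f g b(1-15) assms show "nul (f \<boxplus> g)" "nul (f \<boxminus> g)"
    by (intro nullI[of ?n "b \<odot> p \<boxplus> d \<odot> q"] nullI[of ?n "b \<odot> p \<boxminus> d \<odot> q"];
        simp del: Comp_Plus_distrib Plus_Comp_distrib diff_Comp Comp_diff)+
qed

lemma mon_Ymon: "mon C f \<Longrightarrow> Ymon C Y f"
  using null_mon[of f] unfolding Ymon_def by (metis mon_arr)

lemma epi_Yepi: "epi C f \<Longrightarrow> Yepi C Y f"
  using null_epi[of _ f] unfolding Yepi_def by (metis epi_arr)

text \<open>For null \<open>f \<odot> h\<close>, the image of \<open>h\<close> is an extension: the
  part killed by \<open>f\<close> embeds in the kernel of \<open>f\<close>, and the quotient by it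
  is the image of a null arrow. Closure under extensions puts it in Y.\<close>

lemma Ymon_kern:
  assumes "kern C k f" "src k \<in> Y"
  shows "Ymon C Y f"
  unfolding Ymon_def
proof (intro conjI allI impI)
  note k = kernD[OF assms(1)]
  show "arr f" by (rule k)
  fix h assume h: "arr h" "tgt h = src f" "nul (f \<odot> h)"
  obtain m e where m: "mon C m" "epi C e" "src m = tgt e" "m \<odot> e = h" "src e = src h" "tgt m = tgt h"
    using image[OF h(1)] by blast
  have fm: "nul (f \<odot> m)"
    by (rule null_epi[of _ e]) (use m h k(2) in simp_all)
  obtain m' e' where m': "mon C m'" "epi C e'" "src m' = tgt e'" "m' \<odot> e' = f \<odot> m" "src e' = src (f \<odot> m)" "tgt m' = tgt (f \<odot> m)"
    using image[OF null_arr[OF fm]] by blast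
  have t: "src e' = src m" "tgt m' = tgt f"
    using m' m h k(2) by simp_all
  have e'Y: "tgt e' \<in> Y"
    by (rule null_image[of m']) (use m' fm in simp_all)
  obtain n where "kern C n e'"
    using ex_kern[OF epi_arr[OF m'(2)]] by blast
  note n = kernD[OF this] and n' = this
  have "m' \<odot> (e' \<odot> n) = (f \<odot> m) \<odot> n"
    by (rule Comp_eq_comp[OF m'(4)]) (use m'(1-3) n(1,3) in simp_all)
  then have "f \<odot> (m \<odot> n) = zero (src (m \<odot> n)) (tgt f)"
    using m(1,6) h n(1,3,4) k(2) t m'(1-3) by simp
  then have "\<exists>u. arr u \<and> src u = src (m \<odot> n) \<and> tgt u = src k \<and> k \<odot> u = m \<odot> n"
    by (rule k(5)) (use m n(1,3) t h in simp_all)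
  then obtain u where u: "arr u" "src u = src n" "tgt u = src k" "k \<odot> u = m \<odot> n"
    using m(1) n(1,3) t by auto
  have "mon C (k \<odot> u)"
    unfolding u(4) by (rule mon_comp) (use m n(1,3) t in simp_all)
  then have "mon C u"
    by (rule mon_second) (use u k(1) in simp_all)
  from Y_sub[OF this] have "src n \<in> Y"
    using u assms by simp
  with Y_ext[OF n' epi_coker[OF m'(2) n']] e'Y have "src m \<in> Y"
    using n(3) t by simp
  with m show "nul h"
    by (intro nullI[of e m]) simp_all
qed

lemma kern_Ymon:
  assumes "kern C k f" "Ymon C Y f"
  shows "src k \<in> Y"
proof -
  note k = kernD[OF assms(1)]
  have "nul k"
    using YmonD(2)[OF assms(2), of k] k by simp
  with mon_null[OF k(1)] show ?thesis .
qed

lemmas Yepi_coker = serre.Ymon_kern[OF dual_serre, unfolded dual_Ymon dual_kern dual_sel]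
lemmas coker_Yepi = serre.kern_Ymon[OF dual_serre, unfolded dual_Ymon dual_kern dual_sel]

lemma quotient_iso_iff: "quotient_iso C Y s \<longleftrightarrow> qi s"
proof
  assume "quotient_iso C Y s"
  then show "qi s"
    unfolding quotient_iso_def is_kernel_iff is_cokernel_iff qi_def
    using Ymon_kern Yepi_coker by blast
next
  assume s: "qi s"
  then have "arr s"
    unfolding qi_def using YmonD by blast
  then obtain k q where "kern C k s" "coker C q s"
    using ex_kern ex_coker by blast
  with s kern_Ymon coker_Yepi show "quotient_iso C Y s"
    unfolding quotient_iso_def is_kernel_iff is_cokernel_iff qi_def by blast
qed

lemma qi_arr [simp]: "qi s \<Longrightarrow> arr s"
  unfolding qi_def using YmonD by blast

lemma qi_Id: "A \<in> Ob C \<Longrightarrow> qi (Id C A)"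
  unfolding qi_def using mon_Ymon mon_Id epi_Yepi epi_Id by blast

lemma qi_comp: "qi f \<Longrightarrow> qi g \<Longrightarrow> src g = tgt f \<Longrightarrow> qi (g \<odot> f)"
  unfolding qi_def using Ymon_comp Yepi_comp by blast

text \<open>It suffices to test arrows that \<open>f\<close> kills outright: applied to the kernel,
  the test puts the source of the kernel in Y.\<close>

lemma YmonI:
  assumes "arr f" "\<And>h. \<lbrakk>arr h; tgt h = src f; f \<odot> h = zero (src h) (tgt f)\<rbrakk> \<Longrightarrow> nul h"
  shows "Ymon C Y f"
proof -
  obtain k where "kern C k f" using ex_kern[OF assms(1)] by blast
  note k = kernD[OF this] and k' = this
  have "nul k"
    by (rule assms(2)) (use k in simp_all)
  with mon_null[OF k(1)] Ymon_kern[OF k'] show ?thesis by blast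
qed

lemmas YepiI = serre.YmonI[OF dual_serre, unfolded dual_Ymon dual_null dual_sel]

text \<open>If \<open>q \<odot> h\<close> is null, then so is \<open>f \<odot> p \<odot> h\<close>,
  hence \<open>p \<odot> h\<close>. Both coordinates of \<open>h\<close> in the biproduct being
  null, \<open>h\<close> is null because the pullback embeds there.\<close>

lemma pullback_Ymon:
  assumes "pullback C f g p q" "Ymon C Y f"
  shows "Ymon C Y q"
  unfolding Ymon_def
proof (intro conjI allI impI)
  note d = pullbackD[OF assms(1)]
  show "arr q" by (rule d)
  obtain S i j P Q where B: "biproduct C (src f) (src g) S i j P Q"
    using ex_biproduct'[of "src f" "src g"] d by auto
  note b = biproductD[OF B] and n = kernD(1)[OF pullback_kern[OF assms(1) B]]
  fix h assume h: "arr h" "tgt h = src q" "nul (q \<odot> h)"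
  have "nul (g \<odot> (q \<odot> h))"
    by (rule null_comp_left) (use h d in simp_all)
  then have "nul (f \<odot> (p \<odot> h))"
    using Comp_eq_comp[OF d(9), of h] h d(1-8) by simp
  then have ph: "nul (p \<odot> h)"
    by (rule YmonD(2)[OF assms(2)]) (use h d in simp_all)
  have "nul (i \<odot> (p \<odot> h))" "nul (j \<odot> (q \<odot> h))"
    by (rule null_comp_left; use ph h b d in simp)+
  from null_plus_diff(1)[OF this] have "nul ((i \<odot> p \<boxplus> j \<odot> q) \<odot> h)"
    using h b d(1-8) by simp
  then show "nul h"
    by (rule null_mon[OF _ n]) (use h b d in simp_all)
qed

text \<open>Follows \<open>pullback_epi\<close>, but the difference arrow need not be epic. It is
  replaced by its image factorization \<open>m \<odot> e\<close>, and the missing factorization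
  through \<open>m\<close> is supplied by a pushout.\<close>

lemma pullback_Yepi:
  assumes "pullback C f g p q" "Yepi C Y f"
  shows "Yepi C Y q"
proof -
  note d = pullbackD[OF assms(1)]
  obtain S i j P Q where B: "biproduct C (src f) (src g) S i j P Q"
    using ex_biproduct'[of "src f" "src g"] d by auto
  note b = biproductD[OF B]
  let ?n = "i \<odot> p \<boxplus> j \<odot> q" and ?\<phi> = "f \<odot> P \<boxminus> g \<odot> Q"
  have a: "arr ?\<phi>" "src ?\<phi> = S" "tgt ?\<phi> = tgt g" "arr ?n" "src ?n = src p" "tgt ?n = S"
    using b d(1-8) by auto
  note n = kernD[OF pullback_kern[OF assms(1) B]]
  have \<phi>i: "?\<phi> \<odot> i = f"
    using b d(1-8) by simp
  obtain m e where "mon C m" "epi C e" "src m = tgt e" "m \<odot> e = ?\<phi>" "src e = src ?\<phi>" "tgt m = tgt ?\<phi>"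
    using image[OF a(1)] by blast
  then have m: "mon C m" "epi C e" "src m = tgt e" "m \<odot> e = ?\<phi>" "src e = S" "tgt m = tgt g"
    unfolding a by auto
  have men: "m \<odot> (e \<odot> x) = ?\<phi> \<odot> x" if "arr x" "tgt x = S" for x
    by (rule Comp_eq_comp[OF m(4)]) (use that m in simp_all)
  have "kern C ?n e"
    unfolding kern_def
  proof (intro conjI allI impI)
    show "e \<odot> ?n = zero (src ?n) (tgt e)"
      using mon_zero[OF m(1), of "e \<odot> ?n"] men[of ?n] n(4) m a(3-6) by (simp del: Comp_Plus_distrib)
  next
    fix h assume h: "arr h" "tgt h = src e" "e \<odot> h = zero (src h) (tgt e)"
    show "\<exists>u. arr u \<and> src u = src h \<and> tgt u = src ?n \<and> ?n \<odot> u = h"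
      by (rule n(5)) (use men[of h] h m a(2,3) in simp_all)
  qed (use n m a in simp_all)
  note c = cokerD[OF epi_coker[OF m(2) this]]
  show ?thesis
  proof (rule YepiI)
    fix t assume t: "arr t" "src t = tgt q" "t \<odot> q = zero (src q) (tgt t)"
    have "Q \<odot> ?n = q"
      using b d(1-8) by (simp add: Comp_eq_comp[OF b(17)] Comp_eq_comp[OF b(19)])
    then have tQ: "t \<odot> Q \<odot> ?n = zero (src ?n) (tgt (t \<odot> Q))"
      using t a b d(6-8) by (simp del: Comp_Plus_distrib)
    have "\<exists>u. arr u \<and> src u = tgt e \<and> tgt u = tgt (t \<odot> Q) \<and> u \<odot> e = t \<odot> Q"
      by (rule c(5)[OF tQ]) (use t a b d(6-8) in simp_all)
    then obtain t' where t': "arr t'" "src t' = tgt e" "tgt t' = tgt t" "t' \<odot> e = t \<odot> Q"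
      using t b d(7) by auto
    \<comment> \<open>\<open>t'\<close> is defined only on the image. The pushout extends it to
      \<open>w\<close> on all of \<open>tgt g\<close> at the cost of composing with the monic
      \<open>r\<close>, so nullity of \<open>w\<close> descends to \<open>t'\<close>.\<close>
    obtain w r where po: "pullback (dual C) m t' w r"
      using ex_pushout[of m t'] m t' by auto
    note w = pushoutD[OF po]
    have r: "mon C r"
      by (rule pushout_mon[OF po m(1)])
    have "w \<odot> f = w \<odot> (m \<odot> (e \<odot> i))"
      using men[of i] \<phi>i b by simp
    also have "\<dots> = (w \<odot> m) \<odot> (e \<odot> i)"
      using w(1-8) m(1-3,5) b by simp
    also have "\<dots> = r \<odot> ((t' \<odot> e) \<odot> i)"
      unfolding w(9) using w(1-8) m(1-3,5) b t'(1-3) by simp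
    also have "\<dots> = zero (src f) (tgt w)"
      unfolding t'(4) using w(1-8) t b t'(3) d(7) by simp
    finally have "nul (w \<odot> f)"
      using d w by simp
    then have "nul w"
      by (rule YepiD(2)[OF assms(2)]) (use w m d in simp_all)
    then have "nul (w \<odot> m)"
      by (rule null_comp_right) (use w m in simp_all)
    then have "nul t'"
      unfolding w(9) by (rule null_mon[OF _ r]) (use w t' in simp_all)
    then have "nul (t' \<odot> (e \<odot> j))"
      by (rule null_comp_right) (use t' m b in simp_all)
    also have "t' \<odot> (e \<odot> j) = (t \<odot> Q) \<odot> j"
      by (rule Comp_eq_comp[OF t'(4)]) (use t' m b in simp_all)
    also have "\<dots> = t"
      using t b d(7) by simp
    finally show "nul t" .
  qed (use d in simp)
qed

lemma pullback_qi: "pullback C f g p q \<Longrightarrow> qi f \<Longrightarrow> qi q"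
  unfolding qi_def using pullback_Ymon pullback_Yepi by blast

lemmas pushout_Yepi = serre.pullback_Ymon[OF dual_serre, unfolded dual_Ymon]

text \<open>An arrow killing \<open>k\<close> factors through the epic part \<open>e\<close> of
  \<open>x\<close>, which is null. This makes \<open>k\<close> epic modulo Y.\<close>

lemma null_kern_qi:
  assumes "nul x" "kern C k x"
  shows "qi k"
proof -
  note k = kernD[OF assms(2)]
  obtain m e where m: "mon C m" "epi C e" "src m = tgt e" "m \<odot> e = x" "src e = src x" "tgt m = tgt x"
    using image[OF k(2)] by blast
  have e: "nul e"
    by (rule null_mon[of m]) (use m assms(1) in simp_all)
  have me: "m \<odot> (e \<odot> h) = x \<odot> h" if "arr h" "tgt h = src x" for h
    by (rule Comp_eq_comp[OF m(4)]) (use that m in simp_all)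
  have "kern C k e"
    unfolding kern_def
  proof (intro conjI allI impI)
    show "e \<odot> k = zero (src k) (tgt e)"
      using mon_zero[OF m(1), of "e \<odot> k"] me[of k] k(1,3,4) m by simp
  next
    fix h assume h: "arr h" "tgt h = src e" "e \<odot> h = zero (src h) (tgt e)"
    show "\<exists>u. arr u \<and> src u = src h \<and> tgt u = src k \<and> k \<odot> u = h"
      by (rule k(5)) (use me[of h] h m in simp_all)
  qed (use k m in simp_all)
  note c = cokerD[OF epi_coker[OF m(2) this]]
  have "Yepi C Y k"
  proof (rule YepiI)
    fix t assume t: "arr t" "src t = tgt k" "t \<odot> k = zero (src k) (tgt t)"
    have "\<exists>u. arr u \<and> src u = tgt e \<and> tgt u = tgt t \<and> u \<odot> e = t"
      by (rule c(5)) (use t in simp_all)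
    then obtain u where "arr u" "src u = tgt e" "u \<odot> e = t"
      by blast
    with null_comp_left[OF e] show "nul t"
      by blast
  qed (use k in simp)
  with mon_Ymon[OF k(1)] show ?thesis
    unfolding qi_def by blast
qed

end

section \<open>Smallness\<close>

lemma small_subset: "small U A \<Longrightarrow> B \<subseteq> A \<Longrightarrow> small U B"
  unfolding small_def by (meson lesspoll_trans1 subset_imp_lepoll)

lemma small_image: "small U A \<Longrightarrow> small U (f ` A)"
  unfolding small_def by (meson lesspoll_trans1 image_lepoll)

lemma small_finite: "universe U \<Longrightarrow> finite A \<Longrightarrow> small U A"
  unfolding small_def universe_def by (simp add: finite_lesspoll_infinite)

lemma small_inj:
  assumes "small (U :: 'u set) A"
  shows "\<exists>f :: 'b \<Rightarrow> 'u. inj_on f A"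
  using assms unfolding small_def lesspoll_def lepoll_def by blast

text \<open>The universe axioms speak of sets of elements of \<open>'u\<close>; an injection carries
  a small set of any type there.\<close>

lemma small_Pow:
  assumes "universe U" "small U A"
  shows "small U (Pow A)"
proof -
  obtain f :: "'b \<Rightarrow> 'a" where f: "inj_on f A"
    using small_inj[OF assms(2)] by blast
  have "small U (Pow (f ` A))"
    using assms(1) small_image[OF assms(2)] unfolding universe_def by blast
  moreover have "Pow A \<lesssim> Pow (f ` A)"
    unfolding lepoll_def
    by (rule exI[of _ "(`) f"]) (use inj_on_image_Pow[OF f] in auto)
  ultimately show ?thesis
    unfolding small_def by (rule lesspoll_trans1[rotated])
qed

text \<open>The directed poset of finite subsets of \<open>I\<close>, as a category whose objects
  and arrows have the type of the elements of the universe, as the colimit axioms demand.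
  \<open>s\<close> and \<open>t\<close> decode an arrow into its two subsets.\<close>

lemma finite_subset_category:
  fixes U I :: "'u set"
  assumes U: "universe U" and I: "small U I"
  defines "P \<equiv> {F. F \<subseteq> I \<and> finite F}"
  obtains J :: "('u, 'u) category" and ob :: "'u set \<Rightarrow> 'u" and s t :: "'u \<Rightarrow> 'u set" where
    "small_category U J" "filtered J" "Ob J = ob ` P"
    "\<And>x a b. x \<in> Hom J a b \<Longrightarrow> s x \<in> P \<and> t x \<in> P \<and> s x \<subseteq> t x \<and> a = ob (s x) \<and> b = ob (t x)"
    "\<And>F G. F \<in> P \<Longrightarrow> G \<in> P \<Longrightarrow> F \<subseteq> G \<Longrightarrow> \<exists>x. x \<in> Hom J (ob F) (ob G) \<and> s x = F \<and> t x = G"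
    "\<And>F. F \<in> P \<Longrightarrow> s (Id J (ob F)) = F \<and> t (Id J (ob F)) = F"
    "\<And>f g a b c. f \<in> Hom J a b \<Longrightarrow> g \<in> Hom J b c \<Longrightarrow> s (g \<odot>\<^bsub>J\<^esub> f) = s f \<and> t (g \<odot>\<^bsub>J\<^esub> f) = t g"
proof -
  have Psub: "P \<subseteq> Pow I"
    unfolding P_def by blast
  obtain oc :: "'u set \<Rightarrow> 'u" where oc: "inj_on oc (Pow I)"
    using small_inj[OF small_Pow[OF U I]] by blast
  \<comment> \<open>An inclusion \<open>F \<subseteq> G\<close> is coded by the set
    \<open>{F, G}\<close>, from which intersection and union recover \<open>F\<close> and
    \<open>G\<close>. Power sets of small sets are small, so the codes fit into
    \<open>'u\<close>.\<close>
  obtain ac :: "'u set set \<Rightarrow> 'u" where ac: "inj_on ac (Pow (Pow I))"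
    using small_inj[OF small_Pow[OF U small_Pow[OF U I]]] by blast
  define da where "da = inv_into (Pow (Pow I)) ac"
  define J where "J = \<lparr>Ob = oc ` P, Hom = (\<lambda>a b. {ac {F, G} | F G. F \<in> P \<and> G \<in> P \<and> F \<subseteq> G \<and> a = oc F \<and> b = oc G}),
    Id = (\<lambda>a. ac {inv_into (Pow I) oc a}), Comp = (\<lambda>g f. ac {\<Inter>(da f), \<Union>(da g)})\<rparr>"
  have da: "\<Inter>(da (ac {F, G})) = F" "\<Union>(da (ac {F, G})) = G" if "F \<in> P" "G \<in> P" "F \<subseteq> G" for F G
  proof -
    have "da (ac {F, G}) = {F, G}"
      unfolding da_def using that Psub by (intro inv_into_f_f[OF ac]) blast
    then show "\<Inter>(da (ac {F, G})) = F" "\<Union>(da (ac {F, G})) = G"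
      using that by auto
  qed
  have oc_eq: "F = G" if "oc F = oc G" "F \<in> P" "G \<in> P" for F G
    using inj_onD[OF oc that(1)] that(2,3) Psub by blast
  have Jsel: "Ob J = oc ` P"
    "\<And>a b. Hom J a b = {ac {F, G} | F G. F \<in> P \<and> G \<in> P \<and> F \<subseteq> G \<and> a = oc F \<and> b = oc G}"
    "\<And>f g. g \<odot>\<^bsub>J\<^esub> f = ac {\<Inter>(da f), \<Union>(da g)}"
    unfolding J_def by simp_all
  have Idsel: "Id J (oc F) = ac {F, F}" if "F \<in> P" for F
    unfolding J_def using inv_into_f_f[OF oc subsetD[OF Psub that]] by simp
  have HomE: "\<exists>F G. x = ac {F, G} \<and> F \<in> P \<and> G \<in> P \<and> F \<subseteq> G \<and> a = oc F \<and> b = oc G"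
    if "x \<in> Hom J a b" for x a b
    using that unfolding Jsel by blast
  have HomI: "ac {F, G} \<in> Hom J (oc F) (oc G)" if "F \<in> P" "G \<in> P" "F \<subseteq> G" for F G
    using that unfolding Jsel by blast
  have Comp: "ac {G', H} \<odot>\<^bsub>J\<^esub> ac {F, G} = ac {F, H}"
    if "F \<in> P" "G \<in> P" "F \<subseteq> G" "G' \<in> P" "H \<in> P" "G' \<subseteq> H" for F G G' H
    unfolding Jsel da[OF that(1-3)] da[OF that(4-6)] ..
  have cat: "category J"
  proof
    fix f A B assume "f \<in> Hom J A B"
    then obtain F G where f: "f = ac {F, G}" "F \<in> P" "G \<in> P" "F \<subseteq> G" "A = oc F" "B = oc G"
      using HomE by blast
    then show "A \<in> Ob J \<and> B \<in> Ob J"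
      unfolding Jsel by blast
    show "f \<odot>\<^bsub>J\<^esub> Id J A = f" "Id J B \<odot>\<^bsub>J\<^esub> f = f"
      unfolding f(1,5,6) Idsel[OF f(2)] Idsel[OF f(3)]
      using Comp[of F F F G] Comp[of F G G G] f(2-4) by simp_all
  next
    fix f A B A' B' assume "f \<in> Hom J A B" "f \<in> Hom J A' B'"
    then show "A = A' \<and> B = B'"
      using HomE da by metis
  next
    fix A assume "A \<in> Ob J"
    then obtain F where F: "F \<in> P" "A = oc F"
      unfolding Jsel(1) by blast
    show "Id J A \<in> Hom J A A"
      unfolding F(2) Idsel[OF F(1)] by (rule HomI[OF F(1) F(1) order_refl])
  next
    fix f A B g D assume "f \<in> Hom J A B" "g \<in> Hom J B D"
    then obtain F G G' H where f: "f = ac {F, G}" "F \<in> P" "G \<in> P" "F \<subseteq> G" "A = oc F" "B = oc G"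
      "g = ac {G', H}" "G' \<in> P" "H \<in> P" "G' \<subseteq> H" "B = oc G'" "D = oc H"
      using HomE[of f A B] HomE[of g B D] by blast
    have "G' = G"
      using oc_eq f by simp
    with f show "g \<odot>\<^bsub>J\<^esub> f \<in> Hom J A D"
      unfolding f(1,5,7,12) by (subst Comp) (auto intro: HomI)
  next
    fix f A B g D h E assume "f \<in> Hom J A B" "g \<in> Hom J B D" "h \<in> Hom J D E"
    then obtain F G G' H H' K where f: "f = ac {F, G}" "F \<in> P" "G \<in> P" "F \<subseteq> G" "A = oc F" "B = oc G"
      "g = ac {G', H}" "G' \<in> P" "H \<in> P" "G' \<subseteq> H" "B = oc G'" "D = oc H"
      "h = ac {H', K}" "H' \<in> P" "K \<in> P" "H' \<subseteq> K" "D = oc H'"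
      using HomE[of f A B] HomE[of g B D] HomE[of h D E] by metis
    then have "G' = G" "H' = H"
      using oc_eq by metis+
    with f show "h \<odot>\<^bsub>J\<^esub> g \<odot>\<^bsub>J\<^esub> f = h \<odot>\<^bsub>J\<^esub> (g \<odot>\<^bsub>J\<^esub> f)"
      using Comp[of F G G H] Comp[of G H H K] Comp[of F G G K] Comp[of F H H K] by auto
  qed
  have fin: "finite (Hom J a b)" for a b
  proof -
    have "x = y" if "x \<in> Hom J a b" "y \<in> Hom J a b" for x y
      using HomE[OF that(1)] HomE[OF that(2)] oc_eq by metis
    then have "\<exists>x. Hom J a b \<subseteq> {x}"
      by blast
    then show ?thesis
      using finite_subset by blast
  qed
  have 1: "small_category U J"
    unfolding small_category_def Jsel(1)
    using cat small_finite[OF U fin] small_image[OF small_subset[OF small_Pow[OF U I] Psub]] by blast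
  have 2: "filtered J"
    unfolding filtered_def
  proof (intro conjI ballI allI)
    have "{} \<in> P" unfolding P_def by simp
    then show "Ob J \<noteq> {}" unfolding Jsel by blast
    fix i j assume "i \<in> Ob J" "j \<in> Ob J"
    then obtain F G where F: "F \<in> P" "G \<in> P" "i = oc F" "j = oc G"
      unfolding Jsel by blast
    then have "F \<union> G \<in> P" unfolding P_def by simp
    with F HomI[of F "F \<union> G"] HomI[of G "F \<union> G"] show "\<exists>k. Hom J i k \<noteq> {} \<and> Hom J j k \<noteq> {}"
      by blast
  next
    fix i j f g assume fg: "f \<in> Hom J i j" "g \<in> Hom J i j"
    then have "f = g"
      using HomE[OF fg(1)] HomE[OF fg(2)] oc_eq by metis
    moreover have "Id J j \<in> Hom J j j"
      using category.Hom_Ob[OF cat fg(1)] category.Id_Hom[OF cat] by blast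
    ultimately show "\<exists>k. \<exists>h\<in>Hom J j k. h \<odot>\<^bsub>J\<^esub> f = h \<odot>\<^bsub>J\<^esub> g"
      by blast
  qed (rule cat)
  have 3: "\<Inter>(da x) \<in> P \<and> \<Union>(da x) \<in> P \<and> \<Inter>(da x) \<subseteq> \<Union>(da x) \<and> a = oc (\<Inter>(da x)) \<and> b = oc (\<Union>(da x))"
    if "x \<in> Hom J a b" for x a b
    using HomE[OF that] da by force
  have 4: "\<exists>x. x \<in> Hom J (oc F) (oc G) \<and> \<Inter>(da x) = F \<and> \<Union>(da x) = G" if "F \<in> P" "G \<in> P" "F \<subseteq> G" for F G
    using HomI[OF that] da[OF that] by blast
  have 5: "\<Inter>(da (Id J (oc F))) = F \<and> \<Union>(da (Id J (oc F))) = F" if "F \<in> P" for F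
    unfolding Idsel[OF that] using da[OF that that] by simp
  have 6: "\<Inter>(da (g \<odot>\<^bsub>J\<^esub> f)) = \<Inter>(da f) \<and> \<Union>(da (g \<odot>\<^bsub>J\<^esub> f)) = \<Union>(da g)"
    if fg: "f \<in> Hom J a b" "g \<in> Hom J b c" for f g a b c
  proof -
    obtain F G G' H where f: "f = ac {F, G}" "F \<in> P" "G \<in> P" "F \<subseteq> G" "b = oc G"
      "g = ac {G', H}" "G' \<in> P" "H \<in> P" "G' \<subseteq> H" "b = oc G'"
      using HomE[OF fg(1)] HomE[OF fg(2)] by blast
    have GG: "G' = G"
      using oc_eq f by simp
    then have FH: "F \<subseteq> H"
      using f by blast
    have "g \<odot>\<^bsub>J\<^esub> f = ac {F, H}"
      unfolding f(1,6) by (rule Comp[OF f(2-4,7-9)])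
    with da[OF f(2,8) FH] da[OF f(2-4)] da[OF f(7-9)] show ?thesis
      unfolding f(1,6) by simp
  qed
  show ?thesis
    by (rule that[OF 1 2 Jsel(1) 3 4 5 6])
qed

section \<open>Projections of a direct sum\<close>

context grothendieck_category
begin

lemma direct_sum_proj:
  assumes S: "is_direct_sum C I M S \<iota>"
  shows "\<exists>p. (\<forall>i\<in>I. arr (p i) \<and> src (p i) = S \<and> tgt (p i) = M i) \<and>
    (\<forall>i\<in>I. \<forall>j\<in>I. p i \<odot> \<iota> j = (if i = j then Id C (M i) else zero (M j) (M i)))"
proof -
  note a = direct_sum_arr[OF S]
  have "\<forall>i\<in>I. \<exists>h. arr h \<and> src h = S \<and> tgt h = M i \<and>
      (\<forall>j\<in>I. h \<odot> \<iota> j = (if i = j then Id C (M i) else zero (M j) (M i)))"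
    by (intro ballI direct_sum_map[OF S]) (use a in auto)
  from bchoice[OF this] show ?thesis by blast
qed

text \<open>
  Write \<open>r F\<close> for the endomorphism of \<open>S = \<Oplus>M i\<close> that kills the summands in the finite set \<open>F\<close>. For
  infinite \<open>I\<close> the constant system \<open>S\<close> with transition maps \<open>r G\<close> along \<open>F \<subset> G\<close> has colimit \<open>0\<close>,
  and a subobject annihilated by all projections is fixed by every \<open>r F\<close>, so it embeds into that colimit.
\<close>

lemma direct_sum_proj_zero_mon:
  assumes U: "universe U" and I: "small U (I :: 'u set)" and S: "is_direct_sum C I M S \<iota>"
    and p: "\<forall>i\<in>I. arr (p i) \<and> src (p i) = S \<and> tgt (p i) = M i"
    "\<forall>i\<in>I. \<forall>j\<in>I. p i \<odot> \<iota> j = (if i = j then Id C (M i) else zero (M j) (M i))"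
    and k: "mon C k" "tgt k = S" "\<forall>i\<in>I. p i \<odot> k = zero (src k) (M i)"
  shows "k = zero (src k) S"
proof -
  define K where "K = src k"
  note a = direct_sum_arr[OF S]
  have kk: "arr k" "src k = K" "K \<in> Ob C"
    using k(1) K_def by auto
  have "\<forall>F. \<exists>r. arr r \<and> src r = S \<and> tgt r = S \<and> (\<forall>j\<in>I. r \<odot> \<iota> j = (if j \<in> F then zero (M j) S else \<iota> j))"
    by (intro allI direct_sum_map[OF S]) (use a in auto)
  from choice[OF this] obtain r where r: "\<And>F. arr (r F)" "\<And>F. src (r F) = S" "\<And>F. tgt (r F) = S"
    "\<And>F j. j \<in> I \<Longrightarrow> r F \<odot> \<iota> j = (if j \<in> F then zero (M j) S else \<iota> j)"
    by blast
  have r_empty: "r {} = Id C S"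
    by (rule direct_sum_ext[OF S]) (use r a in auto)
  have r_insert: "r (insert i F) = r F \<boxminus> \<iota> i \<odot> p i" if i: "i \<in> I" "i \<notin> F" for i F
  proof (rule direct_sum_ext[OF S])
    have t: "arr (\<iota> i)" "src (\<iota> i) = M i" "tgt (\<iota> i) = S" "arr (p i)" "src (p i) = S" "tgt (p i) = M i" "M i \<in> Ob C"
      using a i p by auto
    then show "arr (r F \<boxminus> \<iota> i \<odot> p i)" "src (r F \<boxminus> \<iota> i \<odot> p i) = S" "tgt (r (insert i F)) = tgt (r F \<boxminus> \<iota> i \<odot> p i)"
      using r by simp_all
    show "\<forall>j\<in>I. r (insert i F) \<odot> \<iota> j = (r F \<boxminus> \<iota> i \<odot> p i) \<odot> \<iota> j"
    proof
      fix j assume j: "j \<in> I"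
      have tj: "arr (\<iota> j)" "src (\<iota> j) = M j" "tgt (\<iota> j) = S" "M j \<in> Ob C"
        using a j by auto
      have "p i \<odot> \<iota> j = (if i = j then Id C (M i) else zero (M j) (M i))"
        using p(2) i j by blast
      then show "r (insert i F) \<odot> \<iota> j = (r F \<boxminus> \<iota> i \<odot> p i) \<odot> \<iota> j"
        using r j tj t i by (cases "i = j") auto
    qed
  qed (use r in auto)
  have r_k: "r F \<odot> k = k" if "finite F" "F \<subseteq> I" for F
    using that
  proof (induction F)
    case empty
    with r_empty k(1,2) show ?case by simp
  next
    case (insert i F)
    then have i: "i \<in> I" and IH: "r F \<odot> k = k"
      by auto
    have t: "arr (\<iota> i)" "src (\<iota> i) = M i" "tgt (\<iota> i) = S" "arr (p i)" "src (p i) = S" "tgt (p i) = M i" "M i \<in> Ob C"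
      using a i p by auto
    have "p i \<odot> k = zero K (M i)"
      using k(3) i kk by simp
    then show ?case
      unfolding r_insert[OF i insert.hyps(2)] using t r k(1,2) kk IH a(1) by simp
  qed
  have r_r: "r G \<odot> r F = r G" if "F \<subseteq> G" for F G
    by (rule direct_sum_ext[OF S]) (use r a that in auto)
  show ?thesis
  proof (cases "finite I")
    case True
    \<comment> \<open>With finitely many summands all of them can be killed at once.\<close>
    have "r I = zero S S"
      by (rule direct_sum_ext[OF S]) (use r a in auto)
    with r_k[OF True] k a show ?thesis
      by simp
  next
    case False
    define P where "P = {F. F \<subseteq> I \<and> finite F}"
    obtain J :: "('u, 'u) category" and ob s t where J: "small_category U J" "filtered J" "Ob J = ob ` P"
      "\<And>x a b. x \<in> Hom J a b \<Longrightarrow> s x \<in> P \<and> t x \<in> P \<and> s x \<subseteq> t x \<and> a = ob (s x) \<and> b = ob (t x)"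
      "\<And>F G. F \<in> P \<Longrightarrow> G \<in> P \<Longrightarrow> F \<subseteq> G \<Longrightarrow> \<exists>x. x \<in> Hom J (ob F) (ob G) \<and> s x = F \<and> t x = G"
      "\<And>F. F \<in> P \<Longrightarrow> s (Id J (ob F)) = F \<and> t (Id J (ob F)) = F"
      "\<And>f g a b c. f \<in> Hom J a b \<Longrightarrow> g \<in> Hom J b c \<Longrightarrow> s (g \<odot>\<^bsub>J\<^esub> f) = s f \<and> t (g \<odot>\<^bsub>J\<^esub> f) = t g"
      by (rule finite_subset_category[OF U I, folded P_def], rule that)
    have catJ: "category J"
      using J(1) unfolding small_category_def by blast
    \<comment> \<open>Constant on objects; the transition along a proper inclusion depends only on
      the larger set. Identity arrows get a separate value because \<open>r F\<close> is in general
      not an identity.\<close>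
    define sys :: "'o \<Rightarrow> ('u set \<Rightarrow> 'm) \<Rightarrow> ('u, 'u, 'o, 'm) ftor" where
      "sys A d = \<lparr>fob = (\<lambda>_. A), farr = (\<lambda>x. if s x = t x then Id C A else d (t x))\<rparr>" for A d
    have sys_sel: "fob (sys A d) j = A" "farr (sys A d) x = (if s x = t x then Id C A else d (t x))" for A d j x
      unfolding sys_def by simp_all
    have sys: "ftor J C (sys A d)"
      if A: "A \<in> Ob C" and d: "\<And>F. F \<in> P \<Longrightarrow> arr (d F) \<and> src (d F) = A \<and> tgt (d F) = A"
        and dd: "\<And>F G. F \<in> P \<Longrightarrow> G \<in> P \<Longrightarrow> F \<subset> G \<Longrightarrow> d G \<odot> d F = d G" for A d
    proof (intro ftor.intro catJ category_axioms ftor_axioms.intro)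
      fix f a b assume f: "f \<in> Hom J a b"
      show "farr (sys A d) f \<in> Hom C (fob (sys A d) a) (fob (sys A d) b)"
        unfolding sys_sel using J(4)[OF f] d[of "t f"] A by auto
    next
      fix j assume "j \<in> Ob J"
      then show "farr (sys A d) (Id J j) = Id C (fob (sys A d) j)"
        unfolding sys_sel using J(3,6) by auto
    next
      fix f a b g c assume fg: "f \<in> Hom J a b" "g \<in> Hom J b c"
      have "b = ob (t f)" "b = ob (s g)"
        using J(4)[OF fg(1)] J(4)[OF fg(2)] by auto
      have "t f = s g"
      proof -
        have "t f = s (Id J b)" "s g = s (Id J b)"
          using J(4)[OF fg(1)] J(4)[OF fg(2)] J(6) by metis+
        then show ?thesis by simp
      qed
      moreover have sub: "s f \<subseteq> t f" "s g \<subseteq> t g" "t f \<in> P" "t g \<in> P"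
        using J(4)[OF fg(1)] J(4)[OF fg(2)] by auto
      moreover have "d (t g) \<odot> d (t f) = d (t g)" if "t f \<noteq> t g"
        using dd[OF sub(3,4)] sub(2) that \<open>t f = s g\<close> by blast
      moreover have "s f = t g \<Longrightarrow> t f = t g"
        using sub \<open>t f = s g\<close> by blast
      ultimately show "farr (sys A d) (g \<odot>\<^bsub>J\<^esub> f) = farr (sys A d) g \<odot> farr (sys A d) f"
        unfolding sys_sel using J(7)[OF fg] d[of "t f"] d[of "t g"] A
        by (cases "s f = t f"; cases "s g = t g"; cases "s f = t g"; simp)
    qed (use A sys_sel in auto)
    obtain q where "coker C q k"
      using ex_coker[OF kk(1)] by blast
    note q = cokerD[OF this] and q' = this
    define D where "D = tgt q"
    have qt: "arr q" "src q = S" "tgt q = D" "D \<in> Ob C"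
      using q(1,3) k(2) D_def by auto
    \<comment> \<open>\<open>r F\<close> fixes \<open>k\<close>, so it descends to the cokernel
      \<open>D\<close>; this completes a short exact sequence of systems
      \<open>K \<rightarrow> S \<rightarrow> D\<close>.\<close>
    have "\<forall>F\<in>P. \<exists>u. arr u \<and> src u = D \<and> tgt u = D \<and> u \<odot> q = q \<odot> r F"
    proof
      fix F assume "F \<in> P"
      then have "q \<odot> r F \<odot> k = zero (src k) (tgt (q \<odot> r F))"
        using r_k[of F] r qt kk k(2) q(4) unfolding P_def by simp
      with q(5)[of "q \<odot> r F"] show "\<exists>u. arr u \<and> src u = D \<and> tgt u = D \<and> u \<odot> q = q \<odot> r F"
        using qt r k(2) by simp
    qed
    from bchoice[OF this] obtain d where d: "\<And>F. F \<in> P \<Longrightarrow> arr (d F) \<and> src (d F) = D \<and> tgt (d F) = D \<and> d F \<odot> q = q \<odot> r F"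
      by blast
    have dd: "d G \<odot> d F = d G" if FG: "F \<in> P" "G \<in> P" "F \<subset> G" for F G
    proof (rule epi_cancel[OF q(1)])
      note dF = d[OF FG(1)] and dG = d[OF FG(2)]
      have "d G \<odot> (q \<odot> r F) = (q \<odot> r G) \<odot> r F"
        by (rule Comp_eq_comp) (use dG r qt in simp_all)
      also have "\<dots> = q \<odot> r G"
        using r_r[of F G] r qt FG by simp
      finally show "d G \<odot> d F \<odot> q = d G \<odot> q"
        using dF dG qt by simp
    qed (use d[OF FG(1)] d[OF FG(2)] qt in simp_all)
    let ?FK = "sys K (\<lambda>_. Id C K)" and ?FS = "sys S r" and ?FD = "sys D d"
    have FK: "ftor J C ?FK"
      by (rule sys) (use kk in simp_all)
    have FS: "ftor J C ?FS"
      by (rule sys) (use r r_r a in auto)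
    have FD: "ftor J C ?FD"
      by (rule sys) (use d dd qt in auto)
    have nk: "natural J C ?FK ?FS (\<lambda>_. k)"
      unfolding natural_def sys_sel
    proof (intro conjI allI ballI)
      fix x a b assume "x \<in> Hom J a b"
      then have "t x \<in> P" using J(4) by blast
      then show "k \<odot> (if s x = t x then Id C K else Id C K) = (if s x = t x then Id C S else r (t x)) \<odot> k"
        using r_k[of "t x"] kk k(2) unfolding P_def by simp
    qed (use kk k(2) a in simp)
    have nq: "natural J C ?FS ?FD (\<lambda>_. q)"
      unfolding natural_def sys_sel
    proof (intro conjI allI ballI)
      fix x a b assume "x \<in> Hom J a b"
      then have "t x \<in> P" using J(4) by blast
      from d[OF this] show "q \<odot> (if s x = t x then Id C S else r (t x)) = (if s x = t x then Id C D else d (t x)) \<odot> q"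
        using qt by simp
    qed (use qt a in simp)
    have ex: "\<forall>i\<in>Ob J. short_exact C (fob ?FK i) (fob ?FS i) (fob ?FD i) k q"
      unfolding short_exact_def sys_sel is_kernel_iff is_cokernel_iff
      using mon_kern[OF k(1) q'] q' qt kk k(2) by simp
    obtain T' c' where c': "is_colimit J C ?FS T' c'"
      using ex_filtered_colimit[OF J(1,2) FS] by blast
    obtain T'' c'' where c'': "is_colimit J C ?FD T'' c''"
      using ex_filtered_colimit[OF J(1,2) FD] by blast
    have emp: "{} \<in> P" "ob {} \<in> Ob J"
      unfolding J(3) P_def by auto
    \<comment> \<open>The system on \<open>K\<close> is constant and every object receives an arrow
      from \<open>ob {}\<close>, so its colimit is \<open>K\<close> itself.\<close>
    have colK: "is_colimit J C ?FK K (\<lambda>_. Id C K)"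
      unfolding is_colimit_def
    proof (intro conjI allI impI)
      show "cocone J C ?FK K (\<lambda>_. Id C K)"
        unfolding cocone_def sys_sel using kk by simp
      fix T c assume "cocone J C ?FK T c"
      then have c: "T \<in> Ob C" "\<And>i. i \<in> Ob J \<Longrightarrow> arr (c i) \<and> src (c i) = K \<and> tgt (c i) = T"
        "\<And>i j f. f \<in> Hom J i j \<Longrightarrow> c j \<odot> Id C K = c i"
        unfolding cocone_def sys_sel Hom_iff if_cancel by blast+
      have ceq: "c i = c (ob {})" if i: "i \<in> Ob J" for i
      proof -
        obtain F where "F \<in> P" "i = ob F" using i unfolding J(3) by blast
        then obtain x where "x \<in> Hom J (ob {}) i"
          using J(5)[OF emp(1), of F] by blast
        from c(3)[OF this] c(2)[OF i] show ?thesis by simp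
      qed
      show "\<exists>!h. h \<in> Hom C K T \<and> (\<forall>i\<in>Ob J. h \<odot> Id C K = c i)"
      proof (rule ex1I[of _ "c (ob {})"])
        show "c (ob {}) \<in> Hom C K T \<and> (\<forall>i\<in>Ob J. c (ob {}) \<odot> Id C K = c i)"
          using c(1) c(2)[OF emp(2)] kk ceq by simp
      next
        fix h assume "h \<in> Hom C K T \<and> (\<forall>i\<in>Ob J. h \<odot> Id C K = c i)"
        with emp(2) show "h = c (ob {})"
          by auto
      qed
    qed
    have c'c: "T' \<in> Ob C" "\<And>i. i \<in> Ob J \<Longrightarrow> arr (c' i) \<and> src (c' i) = S \<and> tgt (c' i) = T'"
      "\<And>i j f. f \<in> Hom J i j \<Longrightarrow> c' j \<odot> (if s f = t f then Id C S else r (t f)) = c' i"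
      using c'[unfolded is_colimit_def, THEN conjunct1] unfolding cocone_def sys_sel Hom_iff by blast+
    have c''c: "T'' \<in> Ob C" "\<And>i. i \<in> Ob J \<Longrightarrow> arr (c'' i) \<and> src (c'' i) = D \<and> tgt (c'' i) = T''"
      "\<And>i j f. f \<in> Hom J i j \<Longrightarrow> c'' j \<odot> (if s f = t f then Id C D else d (t f)) = c'' i"
      using c''[unfolded is_colimit_def, THEN conjunct1] unfolding cocone_def sys_sel Hom_iff by blast+
    have c'0: "c' i = zero S T'" if i: "i \<in> Ob J" for i
    proof (rule direct_sum_ext[OF S])
      obtain F where F: "F \<in> P" "i = ob F" using i unfolding J(3) by blast
      show "\<forall>j\<in>I. c' i \<odot> \<iota> j = zero S T' \<odot> \<iota> j"
      proof
        fix j assume j: "j \<in> I"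
        \<comment> \<open>The extra element \<open>e\<close> makes \<open>G\<close> larger than
          \<open>F\<close> even when \<open>j\<close> lies in \<open>F\<close>; for
          \<open>F = G\<close> the transition would be the identity and would not kill the summand
          \<open>j\<close>.\<close>
        obtain e where e: "e \<in> I" "e \<notin> F"
          using False F(1) unfolding P_def by (metis mem_Collect_eq rev_finite_subset subsetI)
        define G where "G = insert e (insert j F)"
        have G: "G \<in> P" "F \<subseteq> G" "F \<noteq> G" "j \<in> G"
          using F(1) e j unfolding P_def G_def by auto
        obtain x where x: "x \<in> Hom J i (ob G)" "s x = F" "t x = G"
          using J(5)[OF F(1) G(1,2)] F(2) by blast
        have obG: "ob G \<in> Ob J" using G(1) J(3) by blast
        have "c' (ob G) \<odot> r G = c' i"
          using c'c(3)[OF x(1)] x(2,3) G(3) by simp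
        then have "c' (ob G) \<odot> (r G \<odot> \<iota> j) = c' i \<odot> \<iota> j"
          by (rule Comp_eq_comp) (use c'c(2)[OF obG] r(1-3) a(2)[OF j] in simp_all)
        then have "c' i \<odot> \<iota> j = c' (ob G) \<odot> (r G \<odot> \<iota> j)" ..
        also have "\<dots> = zero (M j) T'"
          using r(4)[OF j, of G] G(4) c'c(2)[OF obG] a(2)[OF j] by simp
        finally show "c' i \<odot> \<iota> j = zero S T' \<odot> \<iota> j"
          using a j c'c(1) by simp
      qed
    qed (use c'c(1) c'c(2)[OF i] a(1) in simp_all)
    have "cocone J C ?FS T'' (\<lambda>i. c'' i \<odot> q)"
      unfolding cocone_def sys_sel
    proof (intro conjI ballI allI)
      fix i assume "i \<in> Ob J"
      from c''c(2)[OF this] c''c(1) show "c'' i \<odot> q \<in> Hom C S T''"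
        using qt a(1) by simp
    next
      fix i j x assume x: "x \<in> Hom J i j"
      then have tx: "t x \<in> P" and ij: "i \<in> Ob J" "j \<in> Ob J"
        using J(4)[OF x] J(3) by auto
      note ci = c''c(2)[OF ij(1)] and cj = c''c(2)[OF ij(2)]
      have "c'' j \<odot> (q \<odot> (if s x = t x then Id C S else r (t x)))
          = c'' j \<odot> ((if s x = t x then Id C D else d (t x)) \<odot> q)"
        using d[OF tx] qt by simp
      also have "\<dots> = (c'' j \<odot> (if s x = t x then Id C D else d (t x))) \<odot> q"
        using d[OF tx] qt cj by simp
      also have "\<dots> = c'' i \<odot> q"
        unfolding c''c(3)[OF x] ..
      finally show "c'' j \<odot> q \<odot> (if s x = t x then Id C S else r (t x)) = c'' i \<odot> q"
        using cj qt r a(1) by simp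
    qed (rule c''c(1))
    then obtain g where g: "g \<in> Hom C T' T''" "\<forall>i\<in>Ob J. g \<odot> c' i = c'' i \<odot> q"
      using c' unfolding is_colimit_def by blast
    have "short_exact C K T' T'' (zero K T') g"
    proof (rule exact_filtered_colimit[OF J(1,2) FK FS FD nk nq ex colK c' c'' _ _ g])
      show "zero K T' \<in> Hom C K T'"
        using kk c'c(1) by simp
      show "\<forall>i\<in>Ob J. zero K T' \<odot> Id C K = c' i \<odot> k"
        using c'0 kk k(2) c'c(1) by simp
    qed
    \<comment> \<open>Exactness of the colimit makes \<open>K \<rightarrow> T'\<close> monic, and
      this arrow is zero, so the identity of \<open>K\<close> is zero.\<close>
    then have "mon C (zero K T')"
      unfolding short_exact_def is_kernel_iff using kernD(1) by blast
    from mon_zero[OF this, of "Id C K"] have "Id C K = zero K K"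
      using kk c'c(1) by simp
    then have "k = k \<odot> zero K K"
      using kk by (metis Comp_Id_src)
    with kk k(2) show ?thesis by simp
  qed
qed

text \<open>The projections annihilate the image of \<open>h\<close> as well, since its epic part
  cancels; this reduces the claim to monics.\<close>

lemma direct_sum_proj_zero:
  assumes U: "universe U" and I: "small U (I :: 'u set)" and S: "is_direct_sum C I M S \<iota>"
    and p: "\<forall>i\<in>I. arr (p i) \<and> src (p i) = S \<and> tgt (p i) = M i"
    "\<forall>i\<in>I. \<forall>j\<in>I. p i \<odot> \<iota> j = (if i = j then Id C (M i) else zero (M j) (M i))"
    and h: "arr h" "tgt h = S" "\<forall>i\<in>I. p i \<odot> h = zero (src h) (M i)"
  shows "h = zero (src h) S"
proof -
  obtain m e where m: "mon C m" "epi C e" "src m = tgt e" "m \<odot> e = h" "src e = src h" "tgt m = tgt h"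
    using image[OF h(1)] by blast
  have "\<forall>i\<in>I. p i \<odot> m = zero (src m) (M i)"
  proof
    fix i assume i: "i \<in> I"
    have t: "arr (p i)" "src (p i) = S" "tgt (p i) = M i" "M i \<in> Ob C"
      using p i direct_sum_arr(2)[OF S] by auto
    have "(p i \<odot> m) \<odot> e = zero (src e) (M i)"
      using t m h i by simp
    with epi_zero[OF m(2), of "p i \<odot> m"] show "p i \<odot> m = zero (src m) (M i)"
      using t m h by simp
  qed
  from direct_sum_proj_zero_mon[OF U I S p m(1) _ this] have "m = zero (src m) S"
    using m(6) h(2) by simp
  with m(4) have "h = zero (src m) S \<odot> e"
    by simp
  also have "\<dots> = zero (src h) S"
    using m(2,3,5) direct_sum_arr(1)[OF S] by simp
  finally show ?thesis .
qed

end

section \<open>Torsion\<close>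

locale localizing_subcategory = grothendieck_category U C + serre C Y
  for U :: "'u set" and C :: "('o, 'm, 'z) ab_category_scheme" (structure) and Y :: "'o set" +
  assumes univ: "universe U"
    and Y_sum: "\<lbrakk>small U (I :: 'u set); \<forall>i\<in>I. M i \<in> Y; is_direct_sum C I M S \<iota>\<rbrakk> \<Longrightarrow> S \<in> Y"

context localizing_subcategory
begin

lemma ex_sum:
  assumes "small U (I :: 'u set)" "\<And>i. i \<in> I \<Longrightarrow> M i \<in> Ob C"
  shows "\<exists>S \<iota>. is_direct_sum C I M S \<iota>"
  by (rule ex_direct_sum) (use assms in auto)

text \<open>The objects of Y through which the \<open>t \<odot> \<iota> i\<close> factor are
  collected in one direct sum, again in Y, through which \<open>t\<close> factors.\<close>

lemma null_direct_sum:
  assumes I: "small U (I :: 'u set)" and S: "is_direct_sum C I M S \<iota>" and t: "arr t" "src t = S"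
    and n: "\<And>i. i \<in> I \<Longrightarrow> nul (t \<odot> \<iota> i)"
  shows "nul t"
proof -
  note a = direct_sum_arr[OF S]
  have "\<forall>i\<in>I. \<exists>x. arr (fst x) \<and> arr (snd x) \<and> tgt (fst x) = src (snd x) \<and> src (snd x) \<in> Y \<and>
      snd x \<odot> fst x = t \<odot> \<iota> i \<and> src (fst x) = M i \<and> tgt (snd x) = tgt t"
  proof
    fix i assume i: "i \<in> I"
    obtain b c where "arr b" "arr c" "tgt b = src c" "src c \<in> Y" "c \<odot> b = t \<odot> \<iota> i"
      "src b = src (t \<odot> \<iota> i)" "tgt c = tgt (t \<odot> \<iota> i)"
      using nullE[OF n[OF i]] by blast
    with a(2)[OF i] t show "\<exists>x. arr (fst x) \<and> arr (snd x) \<and> tgt (fst x) = src (snd x) \<and> src (snd x) \<in> Y \<and>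
      snd x \<odot> fst x = t \<odot> \<iota> i \<and> src (fst x) = M i \<and> tgt (snd x) = tgt t"
      by (intro exI[of _ "(b, c)"]) simp
  qed
  from bchoice[OF this] obtain x where x: "\<And>i. i \<in> I \<Longrightarrow> arr (fst (x i)) \<and> arr (snd (x i)) \<and>
      tgt (fst (x i)) = src (snd (x i)) \<and> src (snd (x i)) \<in> Y \<and>
      snd (x i) \<odot> fst (x i) = t \<odot> \<iota> i \<and> src (fst (x i)) = M i \<and> tgt (snd (x i)) = tgt t"
    by blast
  define b c where "b i = fst (x i)" and "c i = snd (x i)" for i
  have x: "arr (b i)" "arr (c i)" "tgt (b i) = src (c i)" "src (c i) \<in> Y" "c i \<odot> b i = t \<odot> \<iota> i"
    "src (b i) = M i" "tgt (c i) = tgt t" if "i \<in> I" for i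
    using x[OF that] unfolding b_def c_def by blast+
  obtain T \<kappa> where T: "is_direct_sum C I (\<lambda>i. src (c i)) T \<kappa>"
    using ex_sum[OF I, of "\<lambda>i. src (c i)"] x by auto
  note aT = direct_sum_arr[OF T]
  have TY: "T \<in> Y"
    using Y_sum[OF I _ T] x by blast
  have "\<exists>h. arr h \<and> src h = S \<and> tgt h = T \<and> (\<forall>i\<in>I. h \<odot> \<iota> i = \<kappa> i \<odot> b i)"
    by (rule direct_sum_map[OF S aT(1)]) (use aT(2) x in auto)
  then obtain h where h: "arr h" "src h = S" "tgt h = T" "\<And>i. i \<in> I \<Longrightarrow> h \<odot> \<iota> i = \<kappa> i \<odot> b i"
    by blast
  have "\<exists>h. arr h \<and> src h = T \<and> tgt h = tgt t \<and> (\<forall>i\<in>I. h \<odot> \<kappa> i = c i)"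
    by (rule direct_sum_map[OF T]) (use t x in auto)
  then obtain k where k: "arr k" "src k = T" "tgt k = tgt t" "\<And>i. i \<in> I \<Longrightarrow> k \<odot> \<kappa> i = c i"
    by blast
  have "k \<odot> h = t"
  proof (rule direct_sum_ext[OF S])
    show "\<forall>i\<in>I. (k \<odot> h) \<odot> \<iota> i = t \<odot> \<iota> i"
    proof
      fix i assume i: "i \<in> I"
      have "k \<odot> (\<kappa> i \<odot> b i) = c i \<odot> b i"
        by (rule Comp_eq_comp[OF k(4)[OF i]]) (use k aT(2)[OF i] x[OF i] in simp_all)
      then show "(k \<odot> h) \<odot> \<iota> i = t \<odot> \<iota> i"
        using h k(1-3) a(2)[OF i] x(5)[OF i] i by simp
    qed
  qed (use k h t in simp_all)
  with k h TY show ?thesis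
    by (intro nullI[of h k]) simp_all
qed

section \<open>The generator and small sets of subobjects\<close>

definition separator :: "'o \<Rightarrow> bool" where
  "separator G \<longleftrightarrow> G \<in> Ob C \<and>
     (\<forall>f. arr f \<longrightarrow> (\<forall>x. arr x \<longrightarrow> src x = G \<longrightarrow> tgt x = src f \<longrightarrow> f \<odot> x = zero G (tgt f)) \<longrightarrow>
        f = zero (src f) (tgt f))"

lemma ex_separator: "\<exists>G. separator G"
proof -
  obtain G where G: "generator C G"
    using ex_generator by blast
  then have Gob: "G \<in> Ob C"
    unfolding generator_def by blast
  have "f = zero (src f) (tgt f)"
    if f: "arr f" and z: "\<And>x. arr x \<Longrightarrow> src x = G \<Longrightarrow> tgt x = src f \<Longrightarrow> f \<odot> x = zero G (tgt f)" for f
  proof (rule ccontr)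
    assume ne: "f \<noteq> zero (src f) (tgt f)"
    have "f \<in> Hom C (src f) (tgt f)" "zero (src f) (tgt f) \<in> Hom C (src f) (tgt f)"
      using f by auto
    with G ne obtain x where x: "x \<in> Hom C G (src f)" "f \<odot> x \<noteq> zero (src f) (tgt f) \<odot> x"
      unfolding generator_def by blast
    with z[of x] f show False by simp
  qed
  with Gob show ?thesis
    unfolding separator_def by blast
qed

lemma separatorD:
  assumes "separator G" "arr f" "\<And>x. \<lbrakk>arr x; src x = G; tgt x = src f\<rbrakk> \<Longrightarrow> f \<odot> x = zero G (tgt f)"
  shows "f = zero (src f) (tgt f)"
  using assms unfolding separator_def by blast

text \<open>A subobject is determined by the arrows from the generator that factor through it.\<close>

lemma small_subobjects:
  assumes M: "M \<in> Ob C"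
  shows "\<exists>(I :: 'u set) m. small U I \<and> (\<forall>i\<in>I. mon C (m i) \<and> tgt (m i) = M \<and> Pr (m i)) \<and>
    (\<forall>n. mon C n \<longrightarrow> tgt n = M \<longrightarrow> Pr n \<longrightarrow>
       (\<exists>i\<in>I. \<exists>w. arr w \<and> src w = src n \<and> tgt w = src (m i) \<and> m i \<odot> w = n))"
proof -
  obtain G where G: "separator G"
    using ex_separator by blast
  define key where "key n = {n \<odot> x | x. arr x \<and> src x = G \<and> tgt x = src n}" for n
  define W where "W = {n. mon C n \<and> tgt n = M \<and> Pr n}"
  have "G \<in> Ob C"
    using G unfolding separator_def by blast
  then have "key n \<subseteq> Hom C G M" if "n \<in> W" for n
    using that M unfolding key_def W_def by auto
  then have small: "small U (key ` W)"
    by (intro small_subset[OF small_Pow[OF univ small_Hom]]) blast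
  from small_inj[OF this] obtain e :: "'m set \<Rightarrow> 'u" where e: "inj_on e (key ` W)"
    by blast
  have I: "small U (e ` key ` W)"
    by (rule small_image[OF small])
  have "\<forall>i\<in>e ` key ` W. \<exists>n. n \<in> W \<and> e (key n) = i"
    by blast
  from bchoice[OF this] obtain m where m: "\<And>i. i \<in> e ` key ` W \<Longrightarrow> m i \<in> W \<and> e (key (m i)) = i"
    by blast
  have "\<exists>i\<in>e ` key ` W. \<exists>w. arr w \<and> src w = src n \<and> tgt w = src (m i) \<and> m i \<odot> w = n" if n: "n \<in> W" for n
  proof
    define i where "i = e (key n)"
    show i: "e (key n) \<in> e ` key ` W"
      using n by blast
    have mi: "m i \<in> W" "key (m i) = key n"
      using m[OF i] inj_onD[OF e] n unfolding i_def by blast+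
    have mi': "mon C (m i)" "tgt (m i) = M" and n': "mon C n" "tgt n = M"
      using mi(1) n unfolding W_def by blast+
    \<comment> \<open>\<open>m i\<close> is the kernel of \<open>q\<close>, so \<open>n\<close>
      factors through it once \<open>q \<odot> n\<close> vanishes. This is tested on arrows from
      \<open>G\<close>, where equality of the keys applies.\<close>
    obtain q where "coker C q (m i)"
      using ex_coker[OF mon_arr[OF mi'(1)]] by blast
    note q = kernD[OF mon_kern[OF mi'(1) this]]
    have qn: "arr (q \<odot> n)" "src (q \<odot> n) = src n" "tgt (q \<odot> n) = tgt q"
      using q(2,3) mi'(2) n' by simp_all
    have "q \<odot> n = zero (src (q \<odot> n)) (tgt (q \<odot> n))"
    proof (rule separatorD[OF G])
      fix x assume x: "arr x" "src x = G" "tgt x = src (q \<odot> n)"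
      then have "n \<odot> x \<in> key n"
        unfolding key_def using qn by auto
      then have "n \<odot> x \<in> key (m i)"
        by (simp only: mi(2))
      then have "\<exists>y. n \<odot> x = m i \<odot> y \<and> arr y \<and> src y = G \<and> tgt y = src (m i)"
        unfolding key_def mem_Collect_eq .
      then obtain y where y: "arr y" "src y = G" "tgt y = src (m i)" "n \<odot> x = m i \<odot> y"
        by iprover
      have "q \<odot> n \<odot> x = q \<odot> (m i \<odot> y)"
        unfolding y(4)[symmetric] using q(2,3) mi'(2) n' x qn by simp
      also have "\<dots> = zero G (tgt q)"
        using q(2,3) mi'(1) y(1-3) by (simp add: Comp_eq_comp[OF q(4)])
      finally show "q \<odot> n \<odot> x = zero G (tgt (q \<odot> n))"
        using qn by simp
    qed (rule qn)
    then have "q \<odot> n = zero (src n) (tgt q)"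
      unfolding qn .
    from q(5)[OF this] have "\<exists>u. arr u \<and> src u = src n \<and> tgt u = src (m i) \<and> m i \<odot> u = n"
      using q(3) mi'(2) n' by simp
    then show "\<exists>w. arr w \<and> src w = src n \<and> tgt w = src (m (e (key n))) \<and> m (e (key n)) \<odot> w = n"
      unfolding i_def .
  qed
  moreover have "\<forall>i\<in>e ` key ` W. mon C (m i) \<and> tgt (m i) = M \<and> Pr (m i)"
    using m unfolding W_def by blast
  ultimately show ?thesis
    using I unfolding W_def by (intro exI[of _ "e ` key ` W"] exI[of _ m]) (auto simp: W_def)
qed

text \<open>The image of the direct sum of a small set of representatives of all subobjects in Y. A
  null arrow into \<open>M\<close> has its image in Y, so it factors through this subobject.\<close>

lemma ex_torsion:
  assumes M: "M \<in> Ob C"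
  shows "\<exists>t. mon C t \<and> tgt t = M \<and> src t \<in> Y \<and>
    (\<forall>h. nul h \<longrightarrow> tgt h = M \<longrightarrow> (\<exists>u. arr u \<and> src u = src h \<and> tgt u = src t \<and> t \<odot> u = h))"
proof -
  obtain I :: "'u set" and m where I: "small U I"
    and m: "\<forall>i\<in>I. mon C (m i) \<and> tgt (m i) = M \<and> src (m i) \<in> Y"
    and all: "\<forall>n. mon C n \<longrightarrow> tgt n = M \<longrightarrow> src n \<in> Y \<longrightarrow>
       (\<exists>i\<in>I. \<exists>w. arr w \<and> src w = src n \<and> tgt w = src (m i) \<and> m i \<odot> w = n)"
    using small_subobjects[OF M, of "\<lambda>n. src n \<in> Y"] by blast
  obtain S \<iota> where S: "is_direct_sum C I (\<lambda>i. src (m i)) S \<iota>"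
    using ex_sum[OF I, of "\<lambda>i. src (m i)"] m by auto
  note a = direct_sum_arr[OF S]
  have SY: "S \<in> Y"
    using Y_sum[OF I _ S] m by blast
  have "\<exists>h. arr h \<and> src h = S \<and> tgt h = M \<and> (\<forall>i\<in>I. h \<odot> \<iota> i = m i)"
    by (rule direct_sum_map[OF S M]) (use m in auto)
  then obtain \<sigma> where \<sigma>: "arr \<sigma>" "src \<sigma> = S" "tgt \<sigma> = M" "\<forall>i\<in>I. \<sigma> \<odot> \<iota> i = m i"
    by blast
  obtain t e where t: "mon C t" "epi C e" "src t = tgt e" "t \<odot> e = \<sigma>" "src e = src \<sigma>" "tgt t = tgt \<sigma>"
    using image[OF \<sigma>(1)] by blast
  have tY: "src t \<in> Y"
    using Y_quot[OF t(2)] t \<sigma> SY by simp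
  have "\<exists>u. arr u \<and> src u = src h \<and> tgt u = src t \<and> t \<odot> u = h" if h: "nul h" "tgt h = M" for h
  proof -
    obtain n e' where n: "mon C n" "epi C e'" "src n = tgt e'" "n \<odot> e' = h" "src e' = src h" "tgt n = tgt h"
      using image[OF null_arr[OF h(1)]] by blast
    have "src n \<in> Y"
      using null_image[of n e'] n h by simp
    with all n(1,6) h(2) obtain i w where iw: "i \<in> I" "arr w" "src w = src n" "tgt w = src (m i)" "m i \<odot> w = n"
      by metis
    have ai: "arr (\<iota> i)" "src (\<iota> i) = src (m i)" "tgt (\<iota> i) = S"
      using a(2)[OF iw(1)] by blast+
    have "t \<odot> (e \<odot> (\<iota> i \<odot> w)) = \<sigma> \<odot> (\<iota> i \<odot> w)"
      by (rule Comp_eq_comp[OF t(4)]) (use t \<sigma> ai iw(2-4) in simp_all)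
    also have "\<dots> = m i \<odot> w"
      by (rule Comp_eq_comp) (use \<sigma> ai iw in simp_all)
    finally have n_eq: "t \<odot> (e \<odot> (\<iota> i \<odot> w)) = n"
      using iw(5) by simp
    have "t \<odot> ((e \<odot> (\<iota> i \<odot> w)) \<odot> e') = n \<odot> e'"
      by (rule Comp_eq_comp[OF n_eq]) (use t(1-3,5) \<sigma>(1-3) ai iw(2-4) n(1-3) in simp_all)
    then show ?thesis
      using t(1-3,5) \<sigma>(1-3) ai iw(2-4) n(1-5)
      by (intro exI[of _ "(e \<odot> (\<iota> i \<odot> w)) \<odot> e'"]) simp
  qed
  with t(1,6) \<sigma>(3) tY show ?thesis by blast
qed

text \<open>Torsionfreeness expressed by null arrows into \<open>M\<close> instead of subobjects in
  Y; \<open>torsionfree_iff\<close> identifies it with \<open>torsionfree\<close>.\<close>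

definition tf :: "'o \<Rightarrow> bool" where
  "tf M \<longleftrightarrow> M \<in> Ob C \<and> (\<forall>h. nul h \<longrightarrow> tgt h = M \<longrightarrow> h = zero (src h) M)"

lemma tf_Ob: "tf M \<Longrightarrow> M \<in> Ob C"
  unfolding tf_def by blast

lemma tfD: "tf M \<Longrightarrow> nul h \<Longrightarrow> tgt h = M \<Longrightarrow> h = zero (src h) M"
  unfolding tf_def by blast

lemma tf_sub:
  assumes "mon C m" "tf (tgt m)"
  shows "tf (src m)"
  unfolding tf_def
proof (intro conjI allI impI)
  fix h assume h: "nul h" "tgt h = src m"
  have "m \<odot> h = zero (src h) (tgt m)"
    using tfD[OF assms(2) null_comp_left[OF h(1)], of m] assms h by simp
  from mon_zero[OF assms(1) this] h show "h = zero (src h) (src m)"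
    by simp
qed (use assms in simp)

lemma tf_Ymon_mon:
  assumes "Ymon C Y j" "tf (src j)"
  shows "mon C j"
proof (rule monI)
  note j = YmonD[OF assms(1)]
  show "arr j" by (rule j)
  fix h assume h: "arr h" "tgt h = src j" "j \<odot> h = zero (src h) (tgt j)"
  then have "nul h"
    using j by simp
  with tfD[OF assms(2)] h show "h = zero (src h) (src j)" by blast
qed

text \<open>A null arrow into \<open>S\<close> has null, hence zero, projections;
  \<open>direct_sum_proj_zero\<close> then makes it zero.\<close>

lemma tf_direct_sum:
  assumes I: "small U (I :: 'u set)" and S: "is_direct_sum C I M S \<iota>" and M: "\<And>i. i \<in> I \<Longrightarrow> tf (M i)"
  shows "tf S"
  unfolding tf_def
proof (intro conjI allI impI)
  show "S \<in> Ob C" by (rule direct_sum_arr(1)[OF S])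
  obtain p where p: "\<forall>i\<in>I. arr (p i) \<and> src (p i) = S \<and> tgt (p i) = M i"
    "\<forall>i\<in>I. \<forall>j\<in>I. p i \<odot> \<iota> j = (if i = j then Id C (M i) else zero (M j) (M i))"
    using direct_sum_proj[OF S] by blast
  fix h assume h: "nul h" "tgt h = S"
  have "\<forall>i\<in>I. p i \<odot> h = zero (src h) (M i)"
  proof
    fix i assume i: "i \<in> I"
    have "nul (p i \<odot> h)"
      by (rule null_comp_left[OF h(1)]) (use p(1) i h in simp_all)
    from tfD[OF M[OF i] this] show "p i \<odot> h = zero (src h) (M i)"
      using p(1) i h by simp
  qed
  from direct_sum_proj_zero[OF univ I S p null_arr[OF h(1)] h(2) this] show "h = zero (src h) S" .
qed

text \<open>The quotient by the largest subobject in Y. A null arrow into it pulls back along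
  \<open>q\<close> to a null arrow into \<open>M\<close>, which factors through that subobject and
  is therefore killed by \<open>q\<close>.\<close>

lemma ex_tf_quotient:
  assumes M: "M \<in> Ob C"
  shows "\<exists>q. epi C q \<and> qi q \<and> src q = M \<and> tf (tgt q)"
proof -
  obtain t where t: "mon C t" "tgt t = M" "src t \<in> Y"
    "\<And>h. nul h \<Longrightarrow> tgt h = M \<Longrightarrow> \<exists>u. arr u \<and> src u = src h \<and> tgt u = src t \<and> t \<odot> u = h"
    using ex_torsion[OF M] by blast
  obtain q where "coker C q t"
    using ex_coker[OF mon_arr[OF t(1)]] by blast
  note q = cokerD[OF this] and k = mon_kern[OF t(1) this]
  have Ymon: "Ymon C Y q"
    using Ymon_kern[OF k t(3)] .
  have "tf (tgt q)"
    unfolding tf_def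
  proof (intro conjI allI impI)
    fix h assume h: "nul h" "tgt h = tgt q"
    obtain p r where pr: "pullback C q h p r"
      using ex_pullback[of q h] q(1) h by auto
    note d = pullbackD[OF pr]
    have r: "epi C r"
      by (rule pullback_epi[OF pr q(1)])
    have "nul (q \<odot> p)"
      unfolding d(9) by (rule null_comp_right[OF h(1)]) (use d in simp_all)
    then have "nul p"
      by (rule YmonD(2)[OF Ymon]) (use d in simp_all)
    from t(4)[OF this] obtain u where u: "arr u" "src u = src p" "tgt u = src t" "t \<odot> u = p"
      using d(6) q(3) t(2) by auto
    have "q \<odot> (t \<odot> u) = zero (src u) (tgt q)"
      using u(1-3) q(1,3) t(1) by (simp add: Comp_eq_comp[OF q(4)])
    then have "h \<odot> r = zero (src r) (tgt h)"
      using d(8,9) u(2,4) h by simp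
    from epi_zero[OF r this d(2) d(7)[symmetric]] show "h = zero (src h) (tgt q)"
      unfolding d(7) h(2) .
  qed (use q in simp)
  with q(1) Ymon epi_Yepi[OF q(1)] q(3) t(2) show ?thesis
    unfolding qi_def by blast
qed

definition closed_object :: "'o \<Rightarrow> bool" where
  "closed_object E \<longleftrightarrow> E \<in> Ob C \<and>
     (\<forall>s f. qi s \<longrightarrow> arr f \<longrightarrow> src f = src s \<longrightarrow> tgt f = E \<longrightarrow>
        (\<exists>!h. arr h \<and> src h = tgt s \<and> tgt h = E \<and> h \<odot> s = f))"

lemma Yepi_cancel:
  assumes "Yepi C Y s" "tf E" "x \<odot> s = y \<odot> s" "arr x" "arr y" "src x = tgt s" "src y = tgt s" "tgt x = E" "tgt y = E"
  shows "x = y"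
proof -
  note s = YepiD[OF assms(1)]
  have "(x \<boxminus> y) \<odot> s = zero (src s) E"
    using assms s(1) by simp
  then have "nul ((x \<boxminus> y) \<odot> s)"
    using s(1) tf_Ob[OF assms(2)] by simp
  then have "nul (x \<boxminus> y)"
    by (rule s(2)) (use assms in simp_all)
  from tfD[OF assms(2) this] assms show ?thesis
    by simp
qed

text \<open>An arrow in \<open>qi\<close> is an epic followed by a monic. Into a torsionfree object,
  extension along the epic part is automatic, as the kernel of that part is null and so is killed;
  the monic part is left to the assumption \<open>ext\<close>.\<close>

lemma closed_objectI:
  assumes E: "tf E"
    and ext: "\<And>s f. \<lbrakk>mon C s; Yepi C Y s; arr f; src f = src s; tgt f = E\<rbrakk> \<Longrightarrow>
      \<exists>h. arr h \<and> src h = tgt s \<and> tgt h = E \<and> h \<odot> s = f"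
  shows "closed_object E"
  unfolding closed_object_def
proof (intro conjI allI impI)
  fix s f assume s: "qi s" and f: "arr f" "src f = src s" "tgt f = E"
  then have s': "Ymon C Y s" "Yepi C Y s" "arr s"
    unfolding qi_def using YmonD by blast+
  obtain m e where m: "mon C m" "epi C e" "src m = tgt e" "m \<odot> e = s" "src e = src s" "tgt m = tgt s"
    using image[OF s'(3)] by blast
  obtain k where k: "kern C k e"
    using ex_kern[OF epi_arr[OF m(2)]] by blast
  note k' = kernD[OF k] and c = cokerD[OF epi_coker[OF m(2) k]]
  have "m \<odot> (e \<odot> k) = s \<odot> k"
    by (rule Comp_eq_comp[OF m(4)]) (use m k' in simp_all)
  then have "s \<odot> k = zero (src k) (tgt m)"
    unfolding k'(4) using m(1,3) k'(1) by simp
  then have "nul (s \<odot> k)"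
    using k'(1) m(1) by simp
  then have "nul k"
    by (rule YmonD(2)[OF s'(1)]) (use k' m in simp_all)
  then have "nul (f \<odot> k)"
    by (rule null_comp_left) (use f k' m in simp_all)
  from tfD[OF E this] have "f \<odot> k = zero (src k) (tgt f)"
    using f k'(1,3) m by simp
  from c(5)[OF this] obtain g where g: "arr g" "src g = tgt e" "tgt g = tgt f" "g \<odot> e = f"
    using f k'(1,3) m by auto
  have "Yepi C Y (m \<odot> e)"
    using s'(2) m(4) by simp
  then have "Yepi C Y m"
    by (rule Yepi_first) (use m in simp_all)
  from ext[OF m(1) this g(1)] obtain h where h: "arr h" "src h = tgt m" "tgt h = E" "h \<odot> m = g"
    using g m f by auto
  have "h \<odot> (m \<odot> e) = g \<odot> e"
    by (rule Comp_eq_comp[OF h(4)]) (use h m in simp_all)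
  with g m have hs: "h \<odot> s = f"
    by simp
  show "\<exists>!h. arr h \<and> src h = tgt s \<and> tgt h = E \<and> h \<odot> s = f"
  proof (rule ex1I[of _ h])
    show "arr h \<and> src h = tgt s \<and> tgt h = E \<and> h \<odot> s = f"
      using h m(6) hs by simp
    fix h' assume h': "arr h' \<and> src h' = tgt s \<and> tgt h' = E \<and> h' \<odot> s = f"
    show "h' = h"
      by (rule Yepi_cancel[OF s'(2) E]) (use h' h m(6) hs in simp_all)
  qed
qed (rule tf_Ob[OF E])

text \<open>Monicity comes from the projections, which jointly detect zero; epicity modulo Y comes
  from the injections, by \<open>null_direct_sum\<close>.\<close>

lemma direct_sum_mon_Yepi:
  assumes I: "small U (I :: 'u set)" and S: "is_direct_sum C I L S \<iota>" and T: "is_direct_sum C I A T \<kappa>"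
    and s: "\<And>i. i \<in> I \<Longrightarrow> mon C (s i)" "\<And>i. i \<in> I \<Longrightarrow> Yepi C Y (s i)"
      "\<And>i. i \<in> I \<Longrightarrow> src (s i) = L i" "\<And>i. i \<in> I \<Longrightarrow> tgt (s i) = A i"
    and \<sigma>: "arr \<sigma>" "src \<sigma> = S" "tgt \<sigma> = T" "\<And>i. i \<in> I \<Longrightarrow> \<sigma> \<odot> \<iota> i = \<kappa> i \<odot> s i"
  shows "mon C \<sigma>" "Yepi C Y \<sigma>"
proof -
  note a = direct_sum_arr[OF S] and b = direct_sum_arr[OF T]
  obtain p where p: "\<forall>i\<in>I. arr (p i) \<and> src (p i) = S \<and> tgt (p i) = L i"
    "\<forall>i\<in>I. \<forall>j\<in>I. p i \<odot> \<iota> j = (if i = j then Id C (L i) else zero (L j) (L i))"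
    using direct_sum_proj[OF S] by blast
  obtain q where q: "\<forall>i\<in>I. arr (q i) \<and> src (q i) = T \<and> tgt (q i) = A i"
    "\<forall>i\<in>I. \<forall>j\<in>I. q i \<odot> \<kappa> j = (if i = j then Id C (A i) else zero (A j) (A i))"
    using direct_sum_proj[OF T] by blast
  have sp: "s i \<odot> p i = q i \<odot> \<sigma>" if i: "i \<in> I" for i
  proof (rule direct_sum_ext[OF S])
    have ti: "mon C (s i)" "src (s i) = L i" "tgt (s i) = A i" "arr (p i)" "src (p i) = S" "tgt (p i) = L i"
      "arr (q i)" "src (q i) = T" "tgt (q i) = A i"
      using s i p(1) q(1) by auto
    then show "arr (s i \<odot> p i)" "arr (q i \<odot> \<sigma>)" "src (s i \<odot> p i) = S" "src (q i \<odot> \<sigma>) = S"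
      "tgt (s i \<odot> p i) = tgt (q i \<odot> \<sigma>)"
      using \<sigma> by simp_all
    show "\<forall>j\<in>I. (s i \<odot> p i) \<odot> \<iota> j = (q i \<odot> \<sigma>) \<odot> \<iota> j"
    proof
      fix j assume j: "j \<in> I"
      have tj: "mon C (s j)" "src (s j) = L j" "tgt (s j) = A j" "arr (\<iota> j)" "src (\<iota> j) = L j" "tgt (\<iota> j) = S"
        "arr (\<kappa> j)" "src (\<kappa> j) = A j" "tgt (\<kappa> j) = T" "L j \<in> Ob C" "A j \<in> Ob C"
        using s j a(2) b(2) by auto
      have pj: "p i \<odot> \<iota> j = (if i = j then Id C (L i) else zero (L j) (L i))"
        and qj: "q i \<odot> \<kappa> j = (if i = j then Id C (A i) else zero (A j) (A i))"
        using p(2) q(2) i j by blast+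
      have "(q i \<odot> \<sigma>) \<odot> \<iota> j = q i \<odot> (\<kappa> j \<odot> s j)"
        using ti tj \<sigma> j by simp
      also have "\<dots> = (if i = j then Id C (A i) else zero (A j) (A i)) \<odot> s j"
        by (rule Comp_eq_comp[OF qj]) (use ti tj in simp_all)
      also have "\<dots> = s i \<odot> (p i \<odot> \<iota> j)"
        unfolding pj using ti tj src_Ob[of "s i"] tgt_Ob[of "s i"] by (cases "i = j") simp_all
      finally show "(s i \<odot> p i) \<odot> \<iota> j = (q i \<odot> \<sigma>) \<odot> \<iota> j"
        using ti tj by simp
    qed
  qed
  show "mon C \<sigma>"
  proof (rule monI[OF \<sigma>(1)])
    fix h assume h: "arr h" "tgt h = src \<sigma>" "\<sigma> \<odot> h = zero (src h) (tgt \<sigma>)"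
    have "\<forall>i\<in>I. p i \<odot> h = zero (src h) (L i)"
    proof
      fix i assume i: "i \<in> I"
      have ti: "mon C (s i)" "src (s i) = L i" "tgt (s i) = A i" "arr (p i)" "src (p i) = S" "tgt (p i) = L i"
        "arr (q i)" "src (q i) = T" "tgt (q i) = A i"
        using s i p(1) q(1) by auto
      have "s i \<odot> (p i \<odot> h) = (q i \<odot> \<sigma>) \<odot> h"
        by (rule Comp_eq_comp[OF sp[OF i]]) (use ti h \<sigma> in simp_all)
      also have "\<dots> = zero (src h) (tgt (s i))"
        using ti h \<sigma> by simp
      finally show "p i \<odot> h = zero (src h) (L i)"
        using mon_zero[OF ti(1), of "p i \<odot> h"] ti h \<sigma> by simp
    qed
    from direct_sum_proj_zero[OF univ I S p h(1) _ this] h \<sigma> show "h = zero (src h) (src \<sigma>)"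
      by simp
  qed
  show "Yepi C Y \<sigma>"
  proof (rule YepiI[OF \<sigma>(1)])
    fix t assume t: "arr t" "src t = tgt \<sigma>" "t \<odot> \<sigma> = zero (src \<sigma>) (tgt t)"
    show "nul t"
    proof (rule null_direct_sum[OF I T t(1)])
      fix i assume i: "i \<in> I"
      have ti: "mon C (s i)" "src (s i) = L i" "tgt (s i) = A i" "arr (\<iota> i)" "src (\<iota> i) = L i" "tgt (\<iota> i) = S"
        "arr (\<kappa> i)" "src (\<kappa> i) = A i" "tgt (\<kappa> i) = T" "L i \<in> Ob C"
        using s i a(2) b(2) by auto
      have "(t \<odot> \<kappa> i) \<odot> s i = t \<odot> (\<sigma> \<odot> \<iota> i)"
        unfolding \<sigma>(4)[OF i] using t ti \<sigma> by simp
      also have "\<dots> = zero (L i) (tgt t)"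
        using t ti \<sigma>(1-3) by (simp add: Comp_eq_comp[OF t(3)])
      finally have "nul ((t \<odot> \<kappa> i) \<odot> s i)"
        using ti t by simp
      then show "nul (t \<odot> \<kappa> i)"
        by (rule YepiD(2)[OF s(2)[OF i]]) (use t ti \<sigma> in simp_all)
    qed (use t \<sigma> in simp)
  qed
qed

end

section \<open>Closed envelopes\<close>

context localizing_subcategory
begin

text \<open>Arrows into \<open>src j\<close> from dense subobjects of \<open>A\<close> (monic, and
  epic modulo Y) extend to \<open>A\<close> after composition with \<open>j\<close>. This is what a
  single pushout can provide.\<close>

definition extends :: "'m \<Rightarrow> 'o \<Rightarrow> bool" where
  "extends j A \<longleftrightarrow> (\<forall>s f. mon C s \<longrightarrow> Yepi C Y s \<longrightarrow> tgt s = A \<longrightarrow> arr f \<longrightarrow> src f = src s \<longrightarrow> tgt f = src j \<longrightarrow>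
     (\<exists>h. arr h \<and> src h = A \<and> tgt h = tgt j \<and> h \<odot> s = j \<odot> f))"

lemma extendsD:
  assumes "extends j A" "mon C s" "Yepi C Y s" "tgt s = A" "arr f" "src f = src s" "tgt f = src j"
  shows "\<exists>h. arr h \<and> src h = A \<and> tgt h = tgt j \<and> h \<odot> s = j \<odot> f"
  using assms unfolding extends_def by blast

text \<open>
  All extension problems \<open>G \<leftarrow> L \<rightarrow> N\<close> are solved simultaneously by one pushout along \<open>\<Oplus>L \<rightarrow> \<Oplus>G\<close>;
  they form a small set because they are subobjects of \<open>G \<oplus> N\<close>.
\<close>

lemma ex_extends_separator:
  assumes G: "G \<in> Ob C" and N: "N \<in> Ob C"
  shows "\<exists>j. qi j \<and> src j = N \<and> tf (tgt j) \<and> extends j G"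
proof -
  obtain Z i0 j0 p0 q0 where "biproduct C G N Z i0 j0 p0 q0"
    using ex_biproduct'[OF G N] by blast
  note z = biproductD[OF this]
  note r = Comp_eq_comp[OF z(16)] Comp_eq_comp[OF z(17)] Comp_eq_comp[OF z(18)] Comp_eq_comp[OF z(19)]
  \<comment> \<open>A subobject of \<open>G \<oplus> N\<close> whose first coordinate is monic and
    epic modulo Y is the graph of an extension problem: an arrow to \<open>N\<close> from a dense
    subobject of \<open>G\<close>.\<close>
  obtain I :: "'u set" and m where I: "small U I"
    and m: "\<forall>i\<in>I. mon C (m i) \<and> tgt (m i) = Z \<and> mon C (p0 \<odot> m i) \<and> Yepi C Y (p0 \<odot> m i)"
    and all: "\<forall>n. mon C n \<longrightarrow> tgt n = Z \<longrightarrow> mon C (p0 \<odot> n) \<and> Yepi C Y (p0 \<odot> n) \<longrightarrow>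
       (\<exists>i\<in>I. \<exists>w. arr w \<and> src w = src n \<and> tgt w = src (m i) \<and> m i \<odot> w = n)"
    using small_subobjects[OF z(15), of "\<lambda>n. mon C (p0 \<odot> n) \<and> Yepi C Y (p0 \<odot> n)"] by blast
  define s f where "s i = p0 \<odot> m i" and "f i = q0 \<odot> m i" for i
  have sf: "mon C (m i)" "tgt (m i) = Z" "mon C (s i)" "Yepi C Y (s i)" "src (s i) = src (m i)" "tgt (s i) = G"
    "arr (f i)" "src (f i) = src (m i)" "tgt (f i) = N" if "i \<in> I" for i
    using m that z(7-12) unfolding s_def f_def by simp_all
  obtain S \<iota> where S: "is_direct_sum C I (\<lambda>i. src (m i)) S \<iota>"
    using ex_sum[OF I, of "\<lambda>i. src (m i)"] sf(1) by auto
  obtain T \<kappa> where T: "is_direct_sum C I (\<lambda>i. G) T \<kappa>"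
    using ex_sum[OF I, of "\<lambda>i. G"] G by auto
  note a = direct_sum_arr[OF S] and b = direct_sum_arr[OF T]
  have "\<exists>h. arr h \<and> src h = S \<and> tgt h = T \<and> (\<forall>i\<in>I. h \<odot> \<iota> i = \<kappa> i \<odot> s i)"
    by (rule direct_sum_map[OF S b(1)]) (use b(2) sf in simp_all)
  then obtain \<sigma> where \<sigma>: "arr \<sigma>" "src \<sigma> = S" "tgt \<sigma> = T" "\<And>i. i \<in> I \<Longrightarrow> \<sigma> \<odot> \<iota> i = \<kappa> i \<odot> s i"
    by blast
  have "\<exists>h. arr h \<and> src h = S \<and> tgt h = N \<and> (\<forall>i\<in>I. h \<odot> \<iota> i = f i)"
    by (rule direct_sum_map[OF S N]) (use sf in simp_all)
  then obtain \<phi> where \<phi>: "arr \<phi>" "src \<phi> = S" "tgt \<phi> = N" "\<And>i. i \<in> I \<Longrightarrow> \<phi> \<odot> \<iota> i = f i"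
    by blast
  have \<sigma>': "mon C \<sigma>" "Yepi C Y \<sigma>"
    by (rule direct_sum_mon_Yepi[OF I S T _ _ _ _ \<sigma>]; use sf in blast)+
  obtain x y where po: "pullback (dual C) \<sigma> \<phi> x y"
    using ex_pushout[of \<sigma> \<phi>] \<sigma> \<phi> by auto
  note d = pushoutD[OF po]
  have "Yepi C Y y"
    by (rule pushout_Yepi[OF po \<sigma>'(2)])
  with mon_Ymon[OF pushout_mon[OF po \<sigma>'(1)]] have y: "qi y"
    unfolding qi_def by blast
  \<comment> \<open>The pushout need not be torsionfree; its torsionfree quotient keeps the
    extensions and provides their uniqueness.\<close>
  obtain c where c: "epi C c" "qi c" "src c = tgt y" "tf (tgt c)"
    using ex_tf_quotient[of "tgt y"] d(4) by auto
  have "extends (c \<odot> y) G"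
    unfolding extends_def
  proof (intro allI impI)
    fix s' f' assume s': "mon C s'" "Yepi C Y s'" "tgt s' = G" and f': "arr f'" "src f' = src s'" "tgt f' = src (c \<odot> y)"
    have f'N: "tgt f' = N"
      using f'(3) c d(4,7) \<phi> by simp
    \<comment> \<open>The graph of the given problem. It factors through a chosen \<open>m i\<close>
      by some \<open>w\<close>, so the solution \<open>x \<odot> \<kappa> i\<close> of the problem
      for \<open>i\<close> also solves the given one.\<close>
    define n where "n = i0 \<odot> s' \<boxplus> j0 \<odot> f'"
    have n: "arr n" "src n = src s'" "tgt n = Z" "p0 \<odot> n = s'" "q0 \<odot> n = f'"
      unfolding n_def using z(1-15) s' f'(1,2) f'N by (simp_all add: r)
    have "mon C n"
      by (rule mon_second[of p0]) (use n z(7,8) s' in simp_all)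
    with all n s' obtain i w where iw: "i \<in> I" "arr w" "src w = src n" "tgt w = src (m i)" "m i \<odot> w = n"
      by metis
    note sfi = sf[OF iw(1)]
    have ti: "arr (\<iota> i)" "src (\<iota> i) = src (m i)" "tgt (\<iota> i) = S" "arr (\<kappa> i)" "src (\<kappa> i) = G" "tgt (\<kappa> i) = T"
      using a(2)[OF iw(1)] b(2)[OF iw(1)] by blast+
    have sw: "s i \<odot> w = s'" "f i \<odot> w = f'"
      unfolding s_def f_def using n iw(2-5) sfi(1,2) z(7-12) by simp_all
    have "x \<odot> (\<kappa> i \<odot> s i) = x \<odot> (\<sigma> \<odot> \<iota> i)"
      using \<sigma>(4)[OF iw(1)] by simp
    also have "\<dots> = (y \<odot> \<phi>) \<odot> \<iota> i"
      by (rule Comp_eq_comp[OF d(9)]) (use \<sigma>(1-3) ti d(3,6) in simp_all)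
    also have "\<dots> = y \<odot> f i"
      using \<phi> iw(1) ti d(4,7) by simp
    finally have xk: "(x \<odot> \<kappa> i) \<odot> s i = y \<odot> f i"
      using ti d(3,6) \<sigma>(3) sfi(3,6) by simp
    have "(x \<odot> \<kappa> i) \<odot> (s i \<odot> w) = (y \<odot> f i) \<odot> w"
      by (rule Comp_eq_comp[OF xk]) (use ti d(3,6) \<sigma>(3) sfi iw(2,4) in simp_all)
    then have xs: "(x \<odot> \<kappa> i) \<odot> s' = y \<odot> f'"
      using sw sfi(7,8,9) iw(2,4) d(4,7) \<phi>(3) by simp
    have xk_t: "arr (x \<odot> \<kappa> i)" "src (x \<odot> \<kappa> i) = G" "tgt (x \<odot> \<kappa> i) = tgt y"
      using ti d(3,6,8) \<sigma>(3) by simp_all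
    have "c \<odot> (x \<odot> \<kappa> i) \<odot> s' = c \<odot> (y \<odot> f')"
      unfolding xs[symmetric] using xk_t c(1,3) s' by (simp del: assoc add: assoc[of s' "x \<odot> \<kappa> i" c])
    then show "\<exists>h. arr h \<and> src h = G \<and> tgt h = tgt (c \<odot> y) \<and> h \<odot> s' = c \<odot> y \<odot> f'"
      using xk_t c(1,3) d(4,7) \<phi>(3) f' f'N by (intro exI[of _ "c \<odot> (x \<odot> \<kappa> i)"]) simp
  qed
  moreover have "qi (c \<odot> y)" "src (c \<odot> y) = N" "tgt (c \<odot> y) = tgt c"
    using qi_comp[OF y c(2,3)] c(1,3) d(4,7) \<phi>(3) by simp_all
  ultimately show ?thesis
    using c(4) by (intro exI[of _ "c \<odot> y"]) simp
qed

text \<open>A counterpart of Baer's criterion. \<open>A\<close> is covered by a direct sum of copies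
  of \<open>G\<close>, the problem is solved on each copy, and the solutions descend to
  \<open>A\<close>. Extensions into a torsionfree object are unique, which takes the place of the
  maximality argument.\<close>

lemma extends_all:
  assumes G: "separator G" and j: "qi j" "tf (tgt j)" "extends j G" and A: "A \<in> Ob C"
  shows "extends j A"
  unfolding extends_def
proof (intro allI impI)
  fix s f assume s: "mon C s" "Yepi C Y s" "tgt s = A" and f: "arr f" "src f = src s" "tgt f = src j"
  define L where "L = src s"
  define E where "E = tgt j"
  have sL: "arr s" "src s = L" "L \<in> Ob C" and fL: "src f = L" and jE: "arr j" "tgt j = E" "E \<in> Ob C"
    using s(1) f(2) j(1) unfolding L_def E_def by simp_all
  have GOb: "G \<in> Ob C"
    using G unfolding separator_def by blast
  have small: "small U (Hom C G A)"
    by (rule small_Hom)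
  obtain e :: "'m \<Rightarrow> 'u" where e: "inj_on e (Hom C G A)"
    using small_inj[OF small] by blast
  define I where "I = e ` Hom C G A"
  define g where "g = inv_into (Hom C G A) e"
  have I: "small U I"
    unfolding I_def by (rule small_image[OF small])
  have g: "arr (g i)" "src (g i) = G" "tgt (g i) = A" if "i \<in> I" for i
    using inv_into_into[of i e "Hom C G A"] that unfolding I_def g_def by auto
  have g_surj: "\<exists>i\<in>I. g i = x" if "arr x" "src x = G" "tgt x = A" for x
  proof
    have x: "x \<in> Hom C G A"
      using that GOb A by simp
    then show "e x \<in> I" unfolding I_def by (rule imageI)
    show "g (e x) = x" unfolding g_def by (rule inv_into_f_f[OF e x])
  qed
  obtain T \<kappa> where T: "is_direct_sum C I (\<lambda>i. G) T \<kappa>"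
    using ex_sum[OF I, of "\<lambda>i. G"] GOb by auto
  note b = direct_sum_arr[OF T]
  have "\<exists>h. arr h \<and> src h = T \<and> tgt h = A \<and> (\<forall>i\<in>I. h \<odot> \<kappa> i = g i)"
    by (rule direct_sum_map[OF T A]) (use g in simp)
  then obtain \<pi> where \<pi>: "arr \<pi>" "src \<pi> = T" "tgt \<pi> = A" "\<And>i. i \<in> I \<Longrightarrow> \<pi> \<odot> \<kappa> i = g i"
    by blast
  have \<pi>_epi: "epi C \<pi>"
  proof (rule epiI[OF \<pi>(1)])
    fix t assume t: "arr t" "src t = tgt \<pi>" "t \<odot> \<pi> = zero (src \<pi>) (tgt t)"
    have "t = zero (src t) (tgt t)"
    proof (rule separatorD[OF G t(1)])
      fix x assume x: "arr x" "src x = G" "tgt x = src t"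
      then obtain i where i: "i \<in> I" "g i = x"
        using g_surj[of x] t(2) \<pi>(3) by auto
      have "t \<odot> (\<pi> \<odot> \<kappa> i) = zero (src \<pi>) (tgt t) \<odot> \<kappa> i"
        by (rule Comp_eq_comp[OF t(3)]) (use t \<pi> b(2)[OF i(1)] in simp_all)
      with i \<pi> b(2)[OF i(1)] t(1) show "t \<odot> x = zero G (tgt t)"
        by simp
    qed
    then show "t = zero (tgt \<pi>) (tgt t)"
      unfolding t(2) .
  qed
  have "\<forall>i\<in>I. \<exists>x. pullback C s (g i) (fst x) (snd x)"
  proof
    fix i assume "i \<in> I"
    then obtain p q where "pullback C s (g i) p q"
      using ex_pullback[of s "g i"] sL s(3) g by auto
    then show "\<exists>x. pullback C s (g i) (fst x) (snd x)"
      by (intro exI[of _ "(p, q)"]) simp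
  qed
  from bchoice[OF this] obtain x where "\<And>i. i \<in> I \<Longrightarrow> pullback C s (g i) (fst (x i)) (snd (x i))"
    by blast
  then obtain p q where pq: "\<And>i. i \<in> I \<Longrightarrow> pullback C s (g i) (p i) (q i)"
    by (rule that[of "\<lambda>i. fst (x i)" "\<lambda>i. snd (x i)"])
  have t: "arr (p i)" "tgt (p i) = L" "arr (q i)" "tgt (q i) = G" "src (p i) = src (q i)"
    "s \<odot> p i = g i \<odot> q i" "mon C (q i)" "Yepi C Y (q i)" if i: "i \<in> I" for i
    using pullbackD(3,4,6-9)[OF pq[OF i]] g[OF i] sL pullback_mon[OF pq[OF i] s(1)]
      pullback_Yepi[OF pq[OF i] s(2)] by simp_all
  have "\<forall>i\<in>I. \<exists>h. arr h \<and> src h = G \<and> tgt h = tgt j \<and> h \<odot> q i = j \<odot> (f \<odot> p i)"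
  proof
    fix i assume i: "i \<in> I"
    show "\<exists>h. arr h \<and> src h = G \<and> tgt h = tgt j \<and> h \<odot> q i = j \<odot> (f \<odot> p i)"
      by (rule extendsD[OF j(3)]) (use t[OF i] f fL in simp_all)
  qed
  from bchoice[OF this] obtain h0 where "\<forall>i\<in>I. arr (h0 i) \<and> src (h0 i) = G \<and> tgt (h0 i) = tgt j \<and> h0 i \<odot> q i = j \<odot> (f \<odot> p i)"
    by blast
  then have h0: "arr (h0 i)" "src (h0 i) = G" "tgt (h0 i) = E" "h0 i \<odot> q i = j \<odot> (f \<odot> p i)" if "i \<in> I" for i
    using that unfolding E_def by blast+
  have "\<exists>h. arr h \<and> src h = T \<and> tgt h = E \<and> (\<forall>i\<in>I. h \<odot> \<kappa> i = h0 i)"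
    by (rule direct_sum_map[OF T jE(3)]) (use h0 in simp)
  then obtain h where h: "arr h" "src h = T" "tgt h = E" "\<And>i. i \<in> I \<Longrightarrow> h \<odot> \<kappa> i = h0 i"
    by blast
  obtain S \<iota> where S: "is_direct_sum C I (\<lambda>i. src (q i)) S \<iota>"
    using ex_sum[OF I, of "\<lambda>i. src (q i)"] t(3) by auto
  note a = direct_sum_arr[OF S]
  have "\<exists>h. arr h \<and> src h = S \<and> tgt h = T \<and> (\<forall>i\<in>I. h \<odot> \<iota> i = \<kappa> i \<odot> q i)"
    by (rule direct_sum_map[OF S b(1)]) (use b(2) t in simp_all)
  then obtain \<sigma> where \<sigma>: "arr \<sigma>" "src \<sigma> = S" "tgt \<sigma> = T" "\<And>i. i \<in> I \<Longrightarrow> \<sigma> \<odot> \<iota> i = \<kappa> i \<odot> q i"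
    by blast
  have \<sigma>_Yepi: "Yepi C Y \<sigma>"
    by (rule direct_sum_mon_Yepi(2)[OF I S T _ _ _ _ \<sigma>]; use t in blast)
  have "\<exists>h. arr h \<and> src h = S \<and> tgt h = L \<and> (\<forall>i\<in>I. h \<odot> \<iota> i = p i)"
    by (rule direct_sum_map[OF S sL(3)]) (use t in simp_all)
  then obtain lam where lam: "arr lam" "src lam = S" "tgt lam = L" "\<And>i. i \<in> I \<Longrightarrow> lam \<odot> \<iota> i = p i"
    by blast
  have s_lam: "s \<odot> lam = \<pi> \<odot> \<sigma>"
  proof (rule direct_sum_ext[OF S])
    show "\<forall>i\<in>I. (s \<odot> lam) \<odot> \<iota> i = (\<pi> \<odot> \<sigma>) \<odot> \<iota> i"
    proof
      fix i assume i: "i \<in> I"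
      note ti = t[OF i] a(2)[OF i] b(2)[OF i] g[OF i]
      have "\<pi> \<odot> (\<kappa> i \<odot> q i) = g i \<odot> q i"
        by (rule Comp_eq_comp[OF \<pi>(4)[OF i]]) (use ti \<pi>(1-3) in simp_all)
      then show "(s \<odot> lam) \<odot> \<iota> i = (\<pi> \<odot> \<sigma>) \<odot> \<iota> i"
        using ti(6) sL lam(1-3) lam(4)[OF i] \<sigma>(1-3) \<sigma>(4)[OF i] \<pi>(1-3) a(2)[OF i] by simp
    qed
  qed (use sL s(3) lam(1-3) \<sigma>(1-3) \<pi>(1-3) in simp_all)
  have h\<sigma>: "h \<odot> \<sigma> = j \<odot> (f \<odot> lam)"
  proof (rule direct_sum_ext[OF S])
    show "\<forall>i\<in>I. (h \<odot> \<sigma>) \<odot> \<iota> i = (j \<odot> (f \<odot> lam)) \<odot> \<iota> i"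
    proof
      fix i assume i: "i \<in> I"
      note ti = t[OF i] a(2)[OF i] b(2)[OF i]
      have "h \<odot> (\<kappa> i \<odot> q i) = h0 i \<odot> q i"
        by (rule Comp_eq_comp[OF h(4)[OF i]]) (use ti h(1-3) in simp_all)
      then show "(h \<odot> \<sigma>) \<odot> \<iota> i = (j \<odot> (f \<odot> lam)) \<odot> \<iota> i"
        using h0(4)[OF i] f(1,3) fL jE lam(1-3) lam(4)[OF i] \<sigma>(1-3) \<sigma>(4)[OF i] h(1-3) a(2)[OF i] by simp
    qed
  qed (use f(1,3) fL jE lam(1-3) \<sigma>(1-3) h(1-3) in simp_all)
  obtain k where k: "kern C k \<pi>"
    using ex_kern[OF \<pi>(1)] by blast
  note k' = kernD[OF k] and c = cokerD[OF epi_coker[OF \<pi>_epi k]]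
  have k'a: "arr k" "tgt k = T"
    using k'(1,3) \<pi>(2) by simp_all
  \<comment> \<open>On the dense part \<open>S\<close> of \<open>T\<close>, \<open>h\<close> is
    \<open>j f lam\<close>. Over the pullback of \<open>\<sigma>\<close> and \<open>k\<close>,
    \<open>s \<odot> lam = \<pi> \<odot> \<sigma>\<close> vanishes, so \<open>lam\<close> vanishes
    as \<open>s\<close> is monic. Hence \<open>h \<odot> k\<close> is null, and zero because
    \<open>E\<close> is torsionfree.\<close>
  have "h \<odot> k = zero (src k) E"
  proof -
    obtain u v where uv: "pullback C \<sigma> k u v"
      using ex_pullback[of \<sigma> k] \<sigma>(1,3) k'a by auto
    note d = pullbackD[OF uv]
    have v: "Yepi C Y v"
      by (rule pullback_Yepi[OF uv \<sigma>_Yepi])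
    have ua: "arr u" "tgt u = S" "arr v" "tgt v = src k" "src u = src v"
      using d \<sigma> by simp_all
    have "s \<odot> (lam \<odot> u) = (\<pi> \<odot> \<sigma>) \<odot> u"
      by (rule Comp_eq_comp[OF s_lam]) (use sL lam(1-3) ua in simp_all)
    also have "\<dots> = \<pi> \<odot> (k \<odot> v)"
      using \<sigma>(1-3) \<pi>(1-3) ua d(9) by simp
    also have "\<dots> = zero (src v) A"
      using k'a \<pi>(1-3) ua A by (simp add: Comp_eq_comp[OF k'(4)])
    finally have "lam \<odot> u = zero (src v) L"
      using mon_zero[OF s(1), of "lam \<odot> u"] ua lam(1-3) sL s(3) by simp
    then have "j \<odot> (f \<odot> (lam \<odot> u)) = zero (src v) E"
      using f(1,3) fL jE ua(3) sL(3) src_Ob[OF jE(1)] by simp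
    moreover have "h \<odot> (\<sigma> \<odot> u) = (j \<odot> (f \<odot> lam)) \<odot> u"
      by (rule Comp_eq_comp[OF h\<sigma>]) (use \<sigma>(1-3) h(1-3) ua in simp_all)
    ultimately have "(h \<odot> k) \<odot> v = zero (src v) E"
      using d(9) h(1-3) k'a ua f(1,3) fL jE lam(1-3) by simp
    then have "nul ((h \<odot> k) \<odot> v)"
      using ua jE(3) by simp
    then have "nul (h \<odot> k)"
      by (rule YepiD(2)[OF v]) (use h(1-3) k'a ua in simp_all)
    from tfD[OF j(2) this] show ?thesis
      using h(1-3) k'a jE(2) by simp
  qed
  then have "\<exists>u. arr u \<and> src u = tgt \<pi> \<and> tgt u = tgt h \<and> u \<odot> \<pi> = h"
    by (intro c(5)) (use h(1-3) k'a in simp_all)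
  then obtain h' where h': "arr h'" "src h' = A" "tgt h' = E" "h' \<odot> \<pi> = h"
    using \<pi>(3) h(3) by auto
  have "h' \<odot> s = j \<odot> f"
  proof -
    \<comment> \<open>To compare \<open>h' s\<close> with \<open>j f\<close>, their source is
      covered by the pullback of \<open>\<pi>\<close> and \<open>s\<close>. They agree on
      \<open>S\<close>, which maps to that pullback by \<open>w\<close>, epic modulo Y, and from
      there to \<open>src s\<close> by the epic \<open>y\<close>.\<close>
    obtain x y where xy: "pullback C \<pi> s x y"
      using ex_pullback[of \<pi> s] \<pi>(1,3) sL s(3) by auto
    note d = pullbackD[OF xy]
    have y: "epi C y"
      by (rule pullback_epi[OF xy \<pi>_epi])
    have x: "mon C x"
      by (rule pullback_mon[OF pullback_sym[OF xy] s(1)])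
    have xa: "arr x" "tgt x = T" "arr y" "tgt y = L" "src x = src y"
      using d(3,4,6-8) \<pi>(2) sL by simp_all
    have "\<exists>u. arr u \<and> src u = src \<sigma> \<and> tgt u = src x \<and> x \<odot> u = \<sigma> \<and> y \<odot> u = lam"
      by (rule d(10)) (use s_lam \<sigma>(1-3) lam(1-3) \<pi>(2) sL(2) in simp_all)
    then obtain w where w: "arr w" "src w = S" "tgt w = src y" "x \<odot> w = \<sigma>" "y \<odot> w = lam"
      using \<sigma>(2) xa(5) by auto
    have w_Yepi: "Yepi C Y w"
    proof -
      \<comment> \<open>The pullback of \<open>\<sigma>\<close> along the monic \<open>x\<close>
        factors through \<open>w\<close>, which so inherits epicity modulo Y.\<close>
      obtain u v where uv: "pullback C \<sigma> x u v"
        using ex_pullback[of \<sigma> x] \<sigma>(1,3) xa by auto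
      note d' = pullbackD[OF uv]
      have v: "Yepi C Y v"
        by (rule pullback_Yepi[OF uv \<sigma>_Yepi])
      have ua: "arr u" "tgt u = S" "arr v" "tgt v = src y" "src u = src v"
        using d'(3,4,6-8) \<sigma>(2) xa(5) by simp_all
      have "x \<odot> (w \<odot> u) = \<sigma> \<odot> u"
        by (rule Comp_eq_comp[OF w(4)]) (use w(1-3) xa ua in simp_all)
      then have "x \<odot> (w \<odot> u) = x \<odot> v"
        using d'(9) by simp
      then have "w \<odot> u = v"
        by (rule mon_cancel[OF x]) (use w(1-3) xa ua in simp_all)
      with v have "Yepi C Y (w \<odot> u)" by simp
      then show ?thesis
        by (rule Yepi_first) (use w(1-3) ua in simp_all)
    qed
    have "h' \<odot> (s \<odot> lam) = h \<odot> \<sigma>"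
      unfolding s_lam using Comp_eq_comp[OF h'(4), of \<sigma>] h'(1-3) \<pi>(1-3) \<sigma>(1-3) by simp
    then have eq: "h' \<odot> s \<odot> y \<odot> w = j \<odot> f \<odot> y \<odot> w"
      using h\<sigma> h'(1-3) sL s(3) f(1,3) fL jE w xa lam(1-3) by simp
    have "h' \<odot> s \<odot> y = j \<odot> f \<odot> y"
      by (rule Yepi_cancel[OF w_Yepi j(2) eq]) (use h'(1-3) sL s(3) f(1,3) fL jE w(1-3) xa in simp_all)
    then show ?thesis
      by (rule epi_cancel[OF y]) (use h'(1-3) sL s(3) f(1,3) fL jE xa in simp_all)
  qed
  with h' show "\<exists>h. arr h \<and> src h = A \<and> tgt h = tgt j \<and> h \<odot> s = j \<odot> f"
    unfolding jE(2) by blast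
qed

text \<open>After passing to a torsionfree quotient, \<open>j\<close> is monic. An arrow
  \<open>f\<close> into \<open>tgt j\<close>, restricted to the preimage of \<open>src j\<close>,
  still lives on a dense subobject and takes values in \<open>src j\<close>, so it extends;
  uniqueness shows that the extension restricts to \<open>f\<close> itself. Thus a single step of
  the construction suffices.\<close>

lemma ex_envelope:
  assumes B: "B \<in> Ob C"
  shows "\<exists>j. qi j \<and> src j = B \<and> closed_object (tgt j)"
proof -
  obtain G where G: "separator G"
    using ex_separator by blast
  then have GOb: "G \<in> Ob C"
    unfolding separator_def by blast
  obtain r where r: "epi C r" "qi r" "src r = B" "tf (tgt r)"
    using ex_tf_quotient[OF B] by blast
  obtain j where j: "qi j" "src j = tgt r" "tf (tgt j)" "extends j G"
    using ex_extends_separator[OF GOb tgt_Ob] r(1) epi_arr by blast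
  have jm: "mon C j"
    using tf_Ymon_mon j(1,2) r(4) unfolding qi_def by metis
  have ja: "arr j" using j(1) by simp
  have "closed_object (tgt j)"
  proof (rule closed_objectI[OF j(3)])
    fix s f assume s: "mon C s" "Yepi C Y s" and f: "arr f" "src f = src s" "tgt f = tgt j"
    obtain x y where xy: "pullback C j f x y"
      using ex_pullback[of j f] ja f by auto
    note d = pullbackD[OF xy]
    have y: "mon C y" "Yepi C Y y"
      using pullback_mon[OF xy jm] pullback_qi[OF xy j(1)] unfolding qi_def by blast+
    have ya: "arr x" "tgt x = src j" "arr y" "tgt y = src s" "src x = src y"
      using d(3,4,6-8) f(2) by simp_all
    have sy: "mon C (s \<odot> y)" "Yepi C Y (s \<odot> y)"
      using mon_comp[OF y(1) s(1)] Yepi_comp[OF y(2) s(2)] ya(4) by simp_all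
    obtain h where h: "arr h" "src h = tgt s" "tgt h = tgt j" "h \<odot> (s \<odot> y) = j \<odot> x"
      using extendsD[OF extends_all[OF G j(1,3,4) tgt_Ob[OF mon_arr[OF s(1)]]] sy _ ya(1) _ ya(2)] ya s(1) by auto
    have "h \<odot> s \<odot> y = f \<odot> y"
      using h d(9) s(1) ya by simp
    then have "h \<odot> s = f"
      by (rule Yepi_cancel[OF y(2) j(3)]) (use h(1-3) s(1) f ya in simp_all)
    with h(1-3) show "\<exists>h. arr h \<and> src h = tgt s \<and> tgt h = tgt j \<and> h \<odot> s = f"
      by blast
  qed
  moreover have "qi (j \<odot> r)" "src (j \<odot> r) = B" "tgt (j \<odot> r) = tgt j"
    using qi_comp[OF r(2) j(1,2)] r(1,3) j(2) ja by simp_all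
  ultimately show ?thesis
    by (intro exI[of _ "j \<odot> r"]) simp
qed

end

section \<open>The Gabriel quotient as a Kleisli category\<close>

context localizing_subcategory
begin

definition \<eta> :: "'o \<Rightarrow> 'm" where
  "\<eta> B = (SOME j. qi j \<and> src j = B \<and> closed_object (tgt j))"

definition hull :: "'o \<Rightarrow> 'o" where
  "hull B = tgt (\<eta> B)"

definition lift :: "'m \<Rightarrow> 'm \<Rightarrow> 'm" where
  "lift s f = (THE h. arr h \<and> src h = tgt s \<and> tgt h = tgt f \<and> h \<odot> s = f)"

lemma closed_ex1:
  assumes "closed_object E" "qi s" "arr f" "src f = src s" "tgt f = E"
  shows "\<exists>!h. arr h \<and> src h = tgt s \<and> tgt h = E \<and> h \<odot> s = f"
  using assms unfolding closed_object_def by blast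

text \<open>If a null arrow has image \<open>m\<close>, the arrow from a zero object to
  \<open>src m\<close> is in \<open>qi\<close>; uniqueness of extensions along it identifies
  \<open>m\<close> with zero.\<close>

lemma closed_tf:
  assumes E: "closed_object E"
  shows "tf E"
  unfolding tf_def
proof (intro conjI allI impI)
  show EOb: "E \<in> Ob C"
    using E unfolding closed_object_def by blast
  fix h assume h: "nul h" "tgt h = E"
  obtain m e where m: "mon C m" "epi C e" "src m = tgt e" "m \<odot> e = h" "src e = src h" "tgt m = tgt h"
    using image[OF null_arr[OF h(1)]] by blast
  have mY: "src m \<in> Y"
    using null_image[of m e] m h by simp
  obtain Z where "zero_object C Z"
    using ex_zero by blast
  then have Z: "Z \<in> Ob C" "Z \<in> Y"
    using Y_zero unfolding zero_object_def by auto
  let ?s = "zero Z (src m)"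
  have s: "arr ?s" "src ?s = Z" "tgt ?s = src m"
    using Z m(1) by simp_all
  have "Ymon C Y ?s"
    by (rule YmonI) (use s Z Y_null(2) in auto)
  moreover have "Yepi C Y ?s"
    by (rule YepiI) (use s mY Y_null(1) in auto)
  ultimately have qi: "qi ?s"
    unfolding qi_def by blast
  have "\<exists>!g. arr g \<and> src g = tgt ?s \<and> tgt g = E \<and> g \<odot> ?s = zero Z E"
    by (rule closed_ex1[OF E qi]) (use Z EOb s in simp_all)
  moreover have "arr m \<and> src m = tgt ?s \<and> tgt m = E \<and> m \<odot> ?s = zero Z E"
    "arr (zero (src m) E) \<and> src (zero (src m) E) = tgt ?s \<and> tgt (zero (src m) E) = E \<and> zero (src m) E \<odot> ?s = zero Z E"
    using m(1,6) h(2) s Z EOb by simp_all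
  ultimately have "m = zero (src m) E"
    by blast
  then have "h = zero (src m) E \<odot> e"
    using m(4) by simp
  also have "\<dots> = zero (src h) E"
    using m(2,3,5) EOb by simp
  finally show "h = zero (src h) E" .
qed

lemma lift:
  assumes "qi s" "closed_object (tgt f)" "arr f" "src f = src s"
  shows "arr (lift s f)" "src (lift s f) = tgt s" "tgt (lift s f) = tgt f" "lift s f \<odot> s = f"
proof -
  have "\<exists>!h. arr h \<and> src h = tgt s \<and> tgt h = tgt f \<and> h \<odot> s = f"
    by (rule closed_ex1[OF assms(2,1,3,4) refl])
  from theI'[OF this] show "arr (lift s f)" "src (lift s f) = tgt s" "tgt (lift s f) = tgt f" "lift s f \<odot> s = f"
    unfolding lift_def by blast+
qed

lemma lift_unique:
  assumes "qi s" "closed_object (tgt h)" "arr h" "src h = tgt s" "h \<odot> s = f"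
  shows "lift s f = h"
proof -
  have f: "arr f" "src f = src s" "tgt f = tgt h"
    using assms by auto
  have "\<exists>!h. arr h \<and> src h = tgt s \<and> tgt h = tgt f \<and> h \<odot> s = f"
    unfolding f(3) by (rule closed_ex1[OF assms(2,1) f])
  with f assms show ?thesis
    unfolding lift_def by (intro the1_equality) simp_all
qed

lemma hull:
  assumes "B \<in> Ob C"
  shows "qi (\<eta> B)" "arr (\<eta> B)" "src (\<eta> B) = B" "tgt (\<eta> B) = hull B" "closed_object (hull B)" "hull B \<in> Ob C"
    "tf (hull B)"
proof -
  have "qi (\<eta> B) \<and> src (\<eta> B) = B \<and> closed_object (tgt (\<eta> B))"
    unfolding \<eta>_def by (rule someI_ex) (rule ex_envelope[OF assms])
  then show "qi (\<eta> B)" "arr (\<eta> B)" "src (\<eta> B) = B" "tgt (\<eta> B) = hull B" "closed_object (hull B)" "hull B \<in> Ob C" "tf (hull B)"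
    using closed_tf by (auto simp: hull_def)
qed

lemma qi_cancel:
  assumes "qi s" "tf E" "x \<odot> s = y \<odot> s" "arr x" "arr y" "src x = tgt s" "src y = tgt s" "tgt x = E" "tgt y = E"
  shows "x = y"
  using Yepi_cancel[OF _ assms(2-)] assms(1) unfolding qi_def by blast

text \<open>The extension operator of the Kleisli triple of \<open>hull\<close>, with unit
  \<open>\<eta>\<close>.\<close>

definition ext :: "'m \<Rightarrow> 'm" where
  "ext k = lift (\<eta> (src k)) k"

lemma ext:
  assumes "arr k" "tgt k = hull P" "P \<in> Ob C"
  shows "arr (ext k)" "src (ext k) = hull (src k)" "tgt (ext k) = hull P" "ext k \<odot> \<eta> (src k) = k"
proof -
  note h = hull[OF src_Ob[OF assms(1)]]
  have "closed_object (tgt k)"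
    unfolding assms(2) by (rule hull(5)[OF assms(3)])
  from lift[OF h(1) this assms(1) h(3)[symmetric]] assms h
  show "arr (ext k)" "src (ext k) = hull (src k)" "tgt (ext k) = hull P" "ext k \<odot> \<eta> (src k) = k"
    unfolding ext_def by simp_all
qed

lemma ext_unique:
  assumes "arr h" "src h = hull N" "N \<in> Ob C" "tgt h = hull P" "P \<in> Ob C"
  shows "ext (h \<odot> \<eta> N) = h"
proof -
  note n = hull[OF assms(3)] and p = hull[OF assms(5)]
  have "src (h \<odot> \<eta> N) = N"
    using assms n by simp
  then show ?thesis
    unfolding ext_def using lift_unique[of "\<eta> N" h "h \<odot> \<eta> N"] assms n p by simp
qed

lemma ext_\<eta>: "N \<in> Ob C \<Longrightarrow> ext (\<eta> N) = Id C (hull N)"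
  using ext_unique[of "Id C (hull N)" N N] hull by simp

lemma ext_ext:
  assumes "arr k" "tgt k = hull P" "P \<in> Ob C" "arr l" "src l = P" "tgt l = hull R" "R \<in> Ob C"
  shows "ext (ext l \<odot> k) = ext l \<odot> ext k"
proof -
  note k = ext[OF assms(1-3)] and l = ext[OF assms(4,6,7)] and n = hull[OF src_Ob[OF assms(1)]]
  have "(ext l \<odot> ext k) \<odot> \<eta> (src k) = ext l \<odot> k"
    using k l n assms by simp
  with ext_unique[of "ext l \<odot> ext k" "src k" R] k l assms n show ?thesis
    by simp
qed

text \<open>The fraction \<open>f s^-1\<close> followed by \<open>\<eta> N\<close>, as an honest
  arrow from \<open>M\<close> to \<open>hull N\<close>. It exists because the envelope is
  closed.\<close>

definition roof_map :: "'m \<times> 'm \<Rightarrow> 'm" where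
  "roof_map x = lift (fst x) (\<eta> (tgt (snd x)) \<odot> snd x)"

definition roof_set :: "'o \<Rightarrow> 'o \<Rightarrow> 'm \<Rightarrow> ('m \<times> 'm) set" where
  "roof_set M N h = {x \<in> roofs C Y M N. roof_map x = h}"

lemma roofs_iff:
  "(s, f) \<in> roofs C Y M N \<longleftrightarrow> qi s \<and> arr f \<and> src f = src s \<and> tgt s = M \<and> tgt f = N"
proof -
  have "(s, f) \<in> roofs C Y M N \<longleftrightarrow> (\<exists>L. s \<in> Hom C L M \<and> f \<in> Hom C L N \<and> qi s)"
    unfolding roofs_def quotient_iso_iff by simp
  then show ?thesis by auto
qed

lemma roof_map:
  assumes "(s, f) \<in> roofs C Y M N"
  shows "arr (roof_map (s, f))" "src (roof_map (s, f)) = M" "tgt (roof_map (s, f)) = hull N" "roof_map (s, f) \<odot> s = \<eta> N \<odot> f"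
proof -
  have r: "qi s" "arr f" "src f = src s" "tgt s = M" "tgt f = N" "N \<in> Ob C"
    using assms unfolding roofs_iff by auto
  note n = hull[OF r(6)]
  have "roof_map (s, f) = lift s (\<eta> N \<odot> f)"
    unfolding roof_map_def using r by simp
  with lift[OF r(1), of "\<eta> N \<odot> f"] r n
  show "arr (roof_map (s, f))" "src (roof_map (s, f)) = M" "tgt (roof_map (s, f)) = hull N" "roof_map (s, f) \<odot> s = \<eta> N \<odot> f"
    by simp_all
qed

lemma roof_map_unique:
  assumes "(s, f) \<in> roofs C Y M N" "arr h" "src h = M" "tgt h = hull N" "h \<odot> s = \<eta> N \<odot> f"
  shows "roof_map (s, f) = h"
proof -
  have r: "qi s" "tgt s = M" "N \<in> Ob C"
    using assms(1) unfolding roofs_iff by auto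
  show ?thesis
    by (rule qi_cancel[OF r(1) hull(7)[OF r(3)]]) (use roof_map[OF assms(1)] assms r in simp_all)
qed

text \<open>
  Two roofs \<open>(s, f)\<close>, \<open>(t, g)\<close> with the same extension agree, over the pullback of \<open>s\<close> and \<open>t\<close>, up to
  an arrow killed by \<open>\<eta> N\<close>; restricting to its kernel makes them equal.
\<close>

lemma roof_equiv_iff:
  "(x, y) \<in> roof_equiv C Y \<longleftrightarrow> (\<exists>M N. x \<in> roofs C Y M N \<and> y \<in> roofs C Y M N \<and> roof_map x = roof_map y)"
proof -
  obtain s f t g where xy: "x = (s, f)" "y = (t, g)"
    by (metis surj_pair)
  have "((s, f), (t, g)) \<in> roof_equiv C Y \<longleftrightarrow>
      (\<exists>M N. (s, f) \<in> roofs C Y M N \<and> (t, g) \<in> roofs C Y M N \<and> roof_map (s, f) = roof_map (t, g))"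
  proof
    assume "((s, f), (t, g)) \<in> roof_equiv C Y"
    then obtain M N L L' P u v where h: "s \<in> Hom C L M" "f \<in> Hom C L N" "qi s" "t \<in> Hom C L' M" "g \<in> Hom C L' N" "qi t"
      "u \<in> Hom C P L" "v \<in> Hom C P L'" "s \<odot> u = t \<odot> v" "f \<odot> u = g \<odot> v" "qi (s \<odot> u)"
      unfolding roof_equiv_def quotient_iso_iff by blast
    have rs: "(s, f) \<in> roofs C Y M N" "(t, g) \<in> roofs C Y M N"
      unfolding roofs_iff using h by simp_all
    note a = roof_map[OF rs(1)] and b = roof_map[OF rs(2)]
    have N: "N \<in> Ob C" using h by simp
    note n = hull[OF N]
    have "roof_map (s, f) \<odot> (s \<odot> u) = (\<eta> N \<odot> f) \<odot> u"
      by (rule Comp_eq_comp[OF a(4)]) (use a h in simp_all)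
    also have "\<dots> = (\<eta> N \<odot> g) \<odot> v"
      using h n by simp
    also have "\<dots> = roof_map (t, g) \<odot> (t \<odot> v)"
      by (rule Comp_eq_comp[OF b(4), symmetric]) (use b h in simp_all)
    finally have eq: "roof_map (s, f) \<odot> (s \<odot> u) = roof_map (t, g) \<odot> (s \<odot> u)"
      unfolding h(9) .
    have "roof_map (s, f) = roof_map (t, g)"
      by (rule qi_cancel[OF h(11) n(7) eq]) (use a b h in simp_all)
    with rs show "\<exists>M N. (s, f) \<in> roofs C Y M N \<and> (t, g) \<in> roofs C Y M N \<and> roof_map (s, f) = roof_map (t, g)"
      by blast
  next
    assume "\<exists>M N. (s, f) \<in> roofs C Y M N \<and> (t, g) \<in> roofs C Y M N \<and> roof_map (s, f) = roof_map (t, g)"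
    then obtain M N where rs: "(s, f) \<in> roofs C Y M N" "(t, g) \<in> roofs C Y M N" and eq: "roof_map (s, f) = roof_map (t, g)"
      by blast
    note a = roof_map[OF rs(1)] and b = roof_map[OF rs(2)]
    have h: "qi s" "arr f" "src f = src s" "tgt s = M" "tgt f = N"
      "qi t" "arr g" "src g = src t" "tgt t = M" "tgt g = N"
      using rs unfolding roofs_iff by blast+
    have N: "N \<in> Ob C" using h by auto
    note n = hull[OF N]
    obtain u v where uv: "pullback C s t u v"
      using ex_pullback[of s t] h by auto
    note d = pullbackD(3,4,6-9)[OF uv]
    have u: "qi u"
      by (rule pullback_qi[OF pullback_sym[OF uv] h(6)])
    have "\<eta> N \<odot> (f \<odot> u) = (roof_map (s, f) \<odot> s) \<odot> u"
      unfolding a(4) using n h d by simp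
    also have "\<dots> = roof_map (s, f) \<odot> (s \<odot> u)"
      using a(1-3) h d by simp
    also have "\<dots> = (roof_map (t, g) \<odot> t) \<odot> v"
      unfolding eq d(6) using b(1-3) h d by simp
    also have "\<dots> = \<eta> N \<odot> (g \<odot> v)"
      unfolding b(4) using n h d by simp
    finally have "\<eta> N \<odot> (f \<odot> u \<boxminus> g \<odot> v) = zero (src v) (hull N)"
      using n h d by simp
    then have nul\<eta>: "nul (\<eta> N \<odot> (f \<odot> u \<boxminus> g \<odot> v))"
      using n d by simp
    have Ymon: "Ymon C Y (\<eta> N)"
      using n(1) unfolding qi_def by blast
    have nul: "nul (f \<odot> u \<boxminus> g \<odot> v)"
      by (rule YmonD(2)[OF Ymon nul\<eta>]) (use h d n in simp_all)
    obtain k where k: "kern C k (f \<odot> u \<boxminus> g \<odot> v)"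
      using ex_kern[OF null_arr[OF nul]] by blast
    note k' = kernD(1,3,4)[OF k] and kqi = null_kern_qi[OF nul k]
    have ka: "arr k" "tgt k = src v"
      using k' h d by simp_all
    have "f \<odot> (u \<odot> k) \<boxminus> g \<odot> (v \<odot> k) = zero (src k) N"
      using k'(3) ka h d by simp
    then have fk: "f \<odot> (u \<odot> k) = g \<odot> (v \<odot> k)"
      using ka h d by simp
    have sk: "s \<odot> (u \<odot> k) = t \<odot> (v \<odot> k)"
    proof -
      have "s \<odot> (u \<odot> k) = (t \<odot> v) \<odot> k"
        by (rule Comp_eq_comp[OF d(6)]) (use ka h d in simp_all)
      then show ?thesis
        using ka h d by simp
    qed
    have qk: "qi (u \<odot> k)"
      by (rule qi_comp[OF kqi u]) (use ka d in simp)
    have sqk: "qi (s \<odot> (u \<odot> k))"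
      by (rule qi_comp[OF qk h(1)]) (use ka d in simp)
    have "M \<in> Ob C"
      using h(1,4) by auto
    then have "s \<in> Hom C (src s) M" "f \<in> Hom C (src s) N" "t \<in> Hom C (src t) M" "g \<in> Hom C (src t) N"
      "u \<odot> k \<in> Hom C (src k) (src s)" "v \<odot> k \<in> Hom C (src k) (src t)"
      using h N ka d(1-5) by simp_all
    with fk sk sqk h(1,6) show "((s, f), (t, g)) \<in> roof_equiv C Y"
      unfolding roof_equiv_def quotient_iso_iff mem_Collect_eq prod.case by blast
  qed
  then show ?thesis unfolding xy .
qed

text \<open>Roofs determine their end objects, so the \<open>M\<close> and \<open>N\<close> hidden
  in \<open>roof_equiv\<close> cannot vary within a class.\<close>

lemma roof_class:
  assumes "x \<in> roofs C Y M N"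
  shows "roof_equiv C Y `` {x} = roof_set M N (roof_map x)"
proof -
  have *: "y \<in> roofs C Y M N" if "x \<in> roofs C Y M' N'" "y \<in> roofs C Y M' N'" for y M' N'
    using that assms roofs_iff by (metis surj_pair)
  show ?thesis
    unfolding roof_set_def Image_singleton roof_equiv_iff
    by (rule Collect_cong) (use assms * in metis)
qed

text \<open>The pullback of \<open>\<eta> N\<close> along \<open>h\<close> is a roof; its left leg
  is in \<open>qi\<close> because \<open>\<eta> N\<close> is.\<close>

lemma ex_roof:
  assumes "arr h" "tgt h = hull N" "N \<in> Ob C"
  shows "\<exists>x. x \<in> roofs C Y (src h) N \<and> roof_map x = h"
proof -
  note n = hull[OF assms(3)]
  obtain p q where pq: "pullback C (\<eta> N) h p q"
    using ex_pullback[of "\<eta> N" h] n assms by auto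
  note d = pullbackD(3,4,6-9)[OF pq]
  have "qi q"
    by (rule pullback_qi[OF pq n(1)])
  then have r: "(q, p) \<in> roofs C Y (src h) N"
    unfolding roofs_iff using d n by simp
  have "roof_map (q, p) = h"
    by (rule roof_map_unique[OF r]) (use d assms in simp_all)
  with r show ?thesis by blast
qed

section \<open>Hom sets and composition of X/Y in terms of envelopes\<close>

abbreviation "Q \<equiv> gabriel_quotient C Y"

lemma Q_sel:
  "Ob Q = Ob C" "Hom Q M N = roofs C Y M N // roof_equiv C Y" "g \<odot>\<^bsub>Q\<^esub> f = roof_comp C Y g f"
  "Id Q M = roof_equiv C Y `` {(Id C M, Id C M)}"
  unfolding gabriel_quotient_def by simp_all

lemma Hom_Q:
  "c \<in> Hom Q M N \<longleftrightarrow> M \<in> Ob C \<and> N \<in> Ob C \<and> (\<exists>h. arr h \<and> src h = M \<and> tgt h = hull N \<and> c = roof_set M N h)"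
proof
  assume "c \<in> Hom Q M N"
  then obtain x where x: "x \<in> roofs C Y M N" "c = roof_equiv C Y `` {x}"
    unfolding Q_sel by (rule quotientE)
  obtain s f where sf: "x = (s, f)"
    by (metis surj_pair)
  from x(1) have "M \<in> Ob C" "N \<in> Ob C"
    unfolding sf roofs_iff by auto
  with roof_map[of s f M N] x roof_class[OF x(1)] sf
  show "M \<in> Ob C \<and> N \<in> Ob C \<and> (\<exists>h. arr h \<and> src h = M \<and> tgt h = hull N \<and> c = roof_set M N h)"
    by metis
next
  assume "M \<in> Ob C \<and> N \<in> Ob C \<and> (\<exists>h. arr h \<and> src h = M \<and> tgt h = hull N \<and> c = roof_set M N h)"
  then obtain h where h: "N \<in> Ob C" "arr h" "src h = M" "tgt h = hull N" "c = roof_set M N h"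
    by blast
  obtain x where x: "x \<in> roofs C Y M N" "roof_map x = h"
    using ex_roof[OF h(2,4,1)] h(3) by blast
  have "c = roof_equiv C Y `` {x}"
    unfolding roof_class[OF x(1)] x(2) h(5) ..
  with x(1) show "c \<in> Hom Q M N"
    unfolding Q_sel by (simp add: quotientI)
qed

text \<open>The fibre over \<open>h\<close> is nonempty, and any roof in it determines
  \<open>M\<close>, \<open>N\<close> and \<open>h\<close>.\<close>

lemma roof_set_inj:
  assumes "roof_set M N h = roof_set M' N' h'" "arr h" "src h = M" "tgt h = hull N" "N \<in> Ob C"
  shows "M = M' \<and> N = N' \<and> h = h'"
proof -
  obtain x where x: "x \<in> roofs C Y M N" "roof_map x = h"
    using ex_roof[of h N] assms by blast
  then have "x \<in> roof_set M' N' h'"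
    unfolding assms(1)[symmetric] by (simp add: roof_set_def)
  then have x': "x \<in> roofs C Y M' N'" "roof_map x = h'"
    by (simp_all add: roof_set_def)
  obtain s f where "x = (s, f)"
    by (metis surj_pair)
  with x x' show ?thesis
    using roofs_iff by auto
qed

lemma Id_Q: "M \<in> Ob C \<Longrightarrow> Id Q M = roof_set M M (\<eta> M)"
proof -
  assume M: "M \<in> Ob C"
  then have r: "(Id C M, Id C M) \<in> roofs C Y M M"
    unfolding roofs_iff using qi_Id by simp
  have "roof_map (Id C M, Id C M) = \<eta> M"
    by (rule roof_map_unique[OF r]) (use M hull[OF M] in simp_all)
  with roof_class[OF r] show ?thesis
    unfolding Q_sel by simp
qed

lemma quotient_functor_sel:
  "fob (quotient_functor C Y) A = A"
  "arr f \<Longrightarrow> farr (quotient_functor C Y) f = roof_set (src f) (tgt f) (\<eta> (tgt f) \<odot> f)"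
proof -
  show "fob (quotient_functor C Y) A = A"
    unfolding quotient_functor_def by simp
  assume f: "arr f"
  then have r: "(Id C (src f), f) \<in> roofs C Y (src f) (tgt f)"
    unfolding roofs_iff using qi_Id by simp
  have "roof_map (Id C (src f), f) = \<eta> (tgt f) \<odot> f"
    by (rule roof_map_unique[OF r]) (use f hull[OF tgt_Ob[OF f]] in simp_all)
  with roof_class[OF r] show "farr (quotient_functor C Y) f = roof_set (src f) (tgt f) (\<eta> (tgt f) \<odot> f)"
    unfolding quotient_functor_def by simp
qed

text \<open>Kleisli composition. The union defining \<open>roof_comp\<close> ranges over all
  fillings of a square; each gives the same fibre, and the pullback of \<open>f\<close> and
  \<open>t\<close> shows that there is at least one.\<close>

lemma Comp_Q:
  assumes h: "arr h" "src h = M" "tgt h = hull N" and k: "arr k" "src k = N" "tgt k = hull P"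
    and NP: "N \<in> Ob C" "P \<in> Ob C"
  shows "roof_set N P k \<odot>\<^bsub>Q\<^esub> roof_set M N h = roof_set M P (ext k \<odot> h)"
proof -
  note e = ext[OF k(1,3) NP(2)] and n = hull[OF NP(1)] and p = hull[OF NP(2)]
  have *: "roof_equiv C Y `` {(s \<odot> u, g \<odot> v)} = roof_set M P (ext k \<odot> h)"
    if sf: "(s, f) \<in> roof_set M N h" and tg: "(t, g) \<in> roof_set N P k"
      and x: "f \<in> Hom C L N'" "t \<in> Hom C L' N'" "u \<in> Hom C Z L" "v \<in> Hom C Z L'" "f \<odot> u = t \<odot> v" "qi u"
    for s f t g u v L L' N' Z
  proof -
    have rs: "(s, f) \<in> roofs C Y M N" "(t, g) \<in> roofs C Y N P" and th_eq: "roof_map (s, f) = h" "roof_map (t, g) = k"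
      using sf tg unfolding roof_set_def by blast+
    have a: "h \<odot> s = \<eta> N \<odot> f" "k \<odot> t = \<eta> P \<odot> g"
      using roof_map(4)[OF rs(1)] roof_map(4)[OF rs(2)] unfolding th_eq .
    have b: "qi s" "arr f" "src f = src s" "tgt s = M" "tgt f = N" "qi t" "arr g" "src g = src t" "tgt t = N" "tgt g = P"
      using rs unfolding roofs_iff by blast+
    have c: "arr u" "tgt u = src s" "arr v" "tgt v = src t" "src u = src v"
      using x b by auto
    have r: "(s \<odot> u, g \<odot> v) \<in> roofs C Y M P"
      unfolding roofs_iff using b c qi_comp[OF x(6) b(1)] by simp
    have "ext k \<odot> h \<odot> (s \<odot> u) = ext k \<odot> (\<eta> N \<odot> (f \<odot> u))"
      using Comp_eq_comp[OF a(1), of u] e h k b c n by simp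
    also have "\<dots> = (k \<odot> t) \<odot> v"
      unfolding x(5) using Comp_eq_comp[OF e(4), of "t \<odot> v"] e k b c n by simp
    also have "\<dots> = \<eta> P \<odot> (g \<odot> v)"
      unfolding a(2) using p b c by simp
    finally have "roof_map (s \<odot> u, g \<odot> v) = ext k \<odot> h"
      by (intro roof_map_unique[OF r]) (use e h k in simp_all)
    with roof_class[OF r] show ?thesis by simp
  qed
  obtain x where "x \<in> roofs C Y M N" "roof_map x = h"
    using ex_roof[OF h(1,3) NP(1)] h(2) by blast
  then obtain s f where sf: "(s, f) \<in> roof_set M N h"
    unfolding roof_set_def by (metis (mono_tags, lifting) mem_Collect_eq surj_pair)
  obtain y where "y \<in> roofs C Y N P" "roof_map y = k"
    using ex_roof[OF k(1,3) NP(2)] k(2) by blast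
  then obtain t g where tg: "(t, g) \<in> roof_set N P k"
    unfolding roof_set_def by (metis (mono_tags, lifting) mem_Collect_eq surj_pair)
  have b: "qi s" "arr f" "src f = src s" "tgt s = M" "tgt f = N" "qi t" "arr g" "src g = src t" "tgt t = N" "tgt g = P"
    using sf tg unfolding roof_set_def roofs_iff mem_Collect_eq by blast+
  obtain u v where uv: "pullback C f t u v"
    using ex_pullback[of f t] b by auto
  note d = pullbackD(3,4,6-9)[OF uv]
  have u: "qi u"
    by (rule pullback_qi[OF pullback_sym[OF uv] b(6)])
  have tuv: "f \<in> Hom C (src f) N" "t \<in> Hom C (src t) N" "u \<in> Hom C (src v) (src f)" "v \<in> Hom C (src v) (src t)"
    using b d NP by simp_all
  \<comment> \<open>The family whose union is \<open>roof_comp\<close>; it remains to see that it is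
    a singleton.\<close>
  define F where "F = {roof_equiv C Y `` {(s \<odot> u, g \<odot> v)} | s f t g u v.
     (s, f) \<in> roof_set M N h \<and> (t, g) \<in> roof_set N P k \<and>
     (\<exists>L L' N P. f \<in> Hom C L N \<and> t \<in> Hom C L' N \<and> u \<in> Hom C P L \<and> v \<in> Hom C P L' \<and>
        f \<odot> u = t \<odot> v \<and> quotient_iso C Y u)}"
  have "F \<subseteq> {roof_set M P (ext k \<odot> h)}"
    unfolding F_def quotient_iso_iff using * by blast
  moreover have "roof_equiv C Y `` {(s \<odot> u, g \<odot> v)} \<in> F"
    unfolding F_def
  proof (rule CollectI, rule exI[of _ s], rule exI[of _ f], rule exI[of _ t], rule exI[of _ g],
      rule exI[of _ u], rule exI[of _ v], intro conjI refl sf tg)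
    show "\<exists>L L' N P. f \<in> Hom C L N \<and> t \<in> Hom C L' N \<and> u \<in> Hom C P L \<and> v \<in> Hom C P L' \<and>
        f \<odot> u = t \<odot> v \<and> quotient_iso C Y u"
      unfolding quotient_iso_iff using tuv d(6) u by blast
  qed
  ultimately have "F = {roof_set M P (ext k \<odot> h)}"
    by (metis equals0D subset_singletonD)
  then have "\<Union>F = roof_set M P (ext k \<odot> h)"
    by simp
  then show ?thesis
    unfolding Q_sel roof_comp_def F_def .
qed

lemma category_Q: "category Q"
proof
  fix f A B assume "f \<in> Hom Q A B"
  then obtain h where f: "A \<in> Ob C" "B \<in> Ob C" "arr h" "src h = A" "tgt h = hull B" "f = roof_set A B h"
    unfolding Hom_Q by blast
  note a = hull[OF f(1)] and b = hull[OF f(2)]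
  show "A \<in> Ob Q \<and> B \<in> Ob Q"
    using f unfolding Q_sel by blast
  show "f \<odot>\<^bsub>Q\<^esub> Id Q A = f"
    unfolding Id_Q[OF f(1)] f(6)
    using Comp_Q[of "\<eta> A" A A h B] ext(4)[of h B] f a by simp
  show "Id Q B \<odot>\<^bsub>Q\<^esub> f = f"
    unfolding Id_Q[OF f(2)] f(6)
    using Comp_Q[of h A B "\<eta> B" B] ext_\<eta> f b by simp
next
  fix f A B A' B' assume "f \<in> Hom Q A B" "f \<in> Hom Q A' B'"
  then show "A = A' \<and> B = B'"
    unfolding Hom_Q using roof_set_inj by metis
next
  fix A assume "A \<in> Ob Q"
  then have "A \<in> Ob C" unfolding Q_sel .
  with hull[OF this] Id_Q[OF this] show "Id Q A \<in> Hom Q A A"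
    unfolding Hom_Q by blast
next
  fix f A B g D assume "f \<in> Hom Q A B" "g \<in> Hom Q B D"
  then obtain h k where h: "A \<in> Ob C" "B \<in> Ob C" "D \<in> Ob C" "arr h" "src h = A" "tgt h = hull B" "f = roof_set A B h"
    "arr k" "src k = B" "tgt k = hull D" "g = roof_set B D k"
    unfolding Hom_Q by blast
  have "g \<odot>\<^bsub>Q\<^esub> f = roof_set A D (ext k \<odot> h)"
    unfolding h(7,11) by (rule Comp_Q) (use h in simp_all)
  moreover have "arr (ext k \<odot> h)" "src (ext k \<odot> h) = A" "tgt (ext k \<odot> h) = hull D"
    using ext[OF h(8,10,3)] h by simp_all
  ultimately show "g \<odot>\<^bsub>Q\<^esub> f \<in> Hom Q A D"
    unfolding Hom_Q using h(1,3) by blast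
next
  fix f A B g D l E assume "f \<in> Hom Q A B" "g \<in> Hom Q B D" "l \<in> Hom Q D E"
  then obtain h k m where h: "A \<in> Ob C" "B \<in> Ob C" "D \<in> Ob C" "E \<in> Ob C" "arr h" "src h = A" "tgt h = hull B" "f = roof_set A B h"
    "arr k" "src k = B" "tgt k = hull D" "g = roof_set B D k" "arr m" "src m = D" "tgt m = hull E" "l = roof_set D E m"
    unfolding Hom_Q by blast
  note k = ext[OF h(9,11,3)] and m = ext[OF h(13,15,4)]
  have "g \<odot>\<^bsub>Q\<^esub> f = roof_set A D (ext k \<odot> h)"
    unfolding h(8,12) by (rule Comp_Q) (use h in simp_all)
  moreover have "l \<odot>\<^bsub>Q\<^esub> g = roof_set B E (ext m \<odot> k)"
    unfolding h(12,16) by (rule Comp_Q) (use h in simp_all)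
  moreover have "roof_set B E (ext m \<odot> k) \<odot>\<^bsub>Q\<^esub> f = roof_set A E (ext (ext m \<odot> k) \<odot> h)"
    unfolding h(8) by (rule Comp_Q) (use h k m in simp_all)
  moreover have "l \<odot>\<^bsub>Q\<^esub> roof_set A D (ext k \<odot> h) = roof_set A E (ext m \<odot> (ext k \<odot> h))"
    unfolding h(16) by (rule Comp_Q) (use h k m in simp_all)
  moreover have "ext (ext m \<odot> k) = ext m \<odot> ext k"
    by (rule ext_ext[OF h(9,11,3,13-15,4)])
  ultimately show "l \<odot>\<^bsub>Q\<^esub> g \<odot>\<^bsub>Q\<^esub> f = l \<odot>\<^bsub>Q\<^esub> (g \<odot>\<^bsub>Q\<^esub> f)"
    using h k m by simp
qed

text \<open>Recovers the Kleisli arrow from its class; it serves as the adjunction bijection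
  below.\<close>

definition roof_set_arr :: "('m \<times> 'm) set \<Rightarrow> 'm" where
  "roof_set_arr c = (THE h. \<exists>M N. N \<in> Ob C \<and> arr h \<and> src h = M \<and> tgt h = hull N \<and> c = roof_set M N h)"

lemma roof_set_arr:
  assumes "arr h" "src h = M" "tgt h = hull N" "N \<in> Ob C"
  shows "roof_set_arr (roof_set M N h) = h"
  unfolding roof_set_arr_def
proof (rule the_equality)
  show "\<exists>M' N'. N' \<in> Ob C \<and> arr h \<and> src h = M' \<and> tgt h = hull N' \<and> roof_set M N h = roof_set M' N' h"
    using assms by blast
  fix h' assume "\<exists>M' N'. N' \<in> Ob C \<and> arr h' \<and> src h' = M' \<and> tgt h' = hull N' \<and> roof_set M N h = roof_set M' N' h'"
  then show "h' = h"
    using roof_set_inj[OF _ assms] by metis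
qed

lemma ftor_quotient: "ftor C Q (quotient_functor C Y)"
proof (intro ftor.intro category_axioms category_Q ftor_axioms.intro)
  fix A assume "A \<in> Ob C"
  then show "fob (quotient_functor C Y) A \<in> Ob Q"
    unfolding quotient_functor_sel Q_sel .
next
  fix f A B assume f: "f \<in> Hom C A B"
  then have "\<eta> B \<odot> f \<in> Hom C A (hull B)"
    using hull[of B] by simp
  with f show "farr (quotient_functor C Y) f \<in> Hom Q (fob (quotient_functor C Y) A) (fob (quotient_functor C Y) B)"
    unfolding quotient_functor_sel(1) Hom_Q using quotient_functor_sel(2)[of f] by auto
next
  fix A assume A: "A \<in> Ob C"
  then show "farr (quotient_functor C Y) (Id C A) = Id Q (fob (quotient_functor C Y) A)"
    using quotient_functor_sel(2)[of "Id C A"] Id_Q[OF A] hull[OF A] unfolding quotient_functor_sel(1) by simp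
next
  fix f A B g D assume fg: "f \<in> Hom C A B" "g \<in> Hom C B D"
  then have t: "arr f" "src f = A" "tgt f = B" "arr g" "src g = B" "tgt g = D" "A \<in> Ob C" "B \<in> Ob C" "D \<in> Ob C"
    by auto
  note b = hull[OF t(8)] and d = hull[OF t(9)]
  have "farr (quotient_functor C Y) g \<odot>\<^bsub>Q\<^esub> farr (quotient_functor C Y) f = roof_set A D (ext (\<eta> D \<odot> g) \<odot> (\<eta> B \<odot> f))"
    unfolding quotient_functor_sel(2)[OF t(1)] quotient_functor_sel(2)[OF t(4)] t
    by (rule Comp_Q) (use t b d in simp_all)
  also have "ext (\<eta> D \<odot> g) \<odot> (\<eta> B \<odot> f) = (\<eta> D \<odot> g) \<odot> f"
    by (rule Comp_eq_comp) (use ext[of "\<eta> D \<odot> g" D] t b d in simp_all)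
  finally show "farr (quotient_functor C Y) (g \<odot> f) = farr (quotient_functor C Y) g \<odot>\<^bsub>Q\<^esub> farr (quotient_functor C Y) f"
    using quotient_functor_sel(2)[of "g \<odot> f"] t d by simp
qed

text \<open>The usual right adjoint out of a Kleisli category: \<open>N\<close> goes to
  \<open>hull N\<close> and a Kleisli arrow to its extension. Arrows of X/Y from \<open>A\<close> to
  \<open>B\<close> are arrows \<open>A \<rightarrow> hull B\<close> by construction, so
  \<open>roof_set_arr\<close> is the bijection for all objects at once.\<close>

lemma ex_right_adjoint:
  "\<exists>R. right_adjoint C Q (quotient_functor C Y) R \<and> (\<forall>B. fob R B = hull B)"
proof -
  define R :: "('o, ('m \<times> 'm) set, 'o, 'm) ftor" where "R = \<lparr>fob = hull, farr = (\<lambda>c. ext (roof_set_arr c))\<rparr>"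
  have R_sel: "fob R B = hull B" "farr R c = ext (roof_set_arr c)" for B c
    unfolding R_def by simp_all
  have "ftor Q C R"
  proof (intro ftor.intro category_axioms category_Q ftor_axioms.intro)
    fix A assume "A \<in> Ob Q"
    then show "fob R A \<in> Ob C"
      unfolding R_sel Q_sel by (rule hull)
  next
    fix f A B assume "f \<in> Hom Q A B"
    then obtain h where h: "A \<in> Ob C" "B \<in> Ob C" "arr h" "src h = A" "tgt h = hull B" "f = roof_set A B h"
      unfolding Hom_Q by blast
    with roof_set_arr[OF h(3-5,2)] ext[OF h(3,5,2)] hull[OF h(1)] hull[OF h(2)]
    show "farr R f \<in> Hom C (fob R A) (fob R B)"
      unfolding R_sel by simp
  next
    fix A assume "A \<in> Ob Q"
    then have A: "A \<in> Ob C" unfolding Q_sel .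
    note a = hull[OF A]
    show "farr R (Id Q A) = Id C (fob R A)"
      unfolding R_sel Id_Q[OF A] roof_set_arr[OF a(2-4) A] by (rule ext_\<eta>[OF A])
  next
    fix f A B g D assume "f \<in> Hom Q A B" "g \<in> Hom Q B D"
    then obtain h k where h: "A \<in> Ob C" "B \<in> Ob C" "D \<in> Ob C" "arr h" "src h = A" "tgt h = hull B" "f = roof_set A B h"
      "arr k" "src k = B" "tgt k = hull D" "g = roof_set B D k"
      unfolding Hom_Q by blast
    have gf: "g \<odot>\<^bsub>Q\<^esub> f = roof_set A D (ext k \<odot> h)"
      unfolding h(7,11) by (rule Comp_Q) (use h in simp_all)
    have "roof_set_arr (g \<odot>\<^bsub>Q\<^esub> f) = ext k \<odot> h"
      unfolding gf by (rule roof_set_arr) (use ext[OF h(8,10,3)] h in simp_all)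
    moreover have "roof_set_arr f = h" "roof_set_arr g = k"
      unfolding h(7,11) by (rule roof_set_arr; use h in simp)+
    ultimately show "farr R (g \<odot>\<^bsub>Q\<^esub> f) = farr R g \<odot> farr R f"
      unfolding R_sel using ext_ext[of h B k D] h by simp
  qed
  moreover have "bij_betw roof_set_arr (Hom Q (fob (quotient_functor C Y) A) B) (Hom C A (fob R B))"
    if AB: "A \<in> Ob C" "B \<in> Ob Q" for A B
  proof -
    have B: "B \<in> Ob C" using AB(2) unfolding Q_sel .
    show ?thesis
      unfolding quotient_functor_sel R_sel
    proof (rule bij_betw_byWitness[where f' = "roof_set A B"])
      show "\<forall>c\<in>Hom Q A B. roof_set A B (roof_set_arr c) = c"
      proof
        fix c assume "c \<in> Hom Q A B"
        then obtain h where h: "arr h" "src h = A" "tgt h = hull B" "c = roof_set A B h"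
          unfolding Hom_Q by blast
        show "roof_set A B (roof_set_arr c) = c"
          unfolding h(4) roof_set_arr[OF h(1-3) B] ..
      qed
      show "\<forall>h\<in>Hom C A (hull B). roof_set_arr (roof_set A B h) = h"
        using roof_set_arr B by simp
      show "roof_set_arr ` Hom Q A B \<subseteq> Hom C A (hull B)"
      proof
        fix x assume "x \<in> roof_set_arr ` Hom Q A B"
        then obtain h where h: "arr h" "src h = A" "tgt h = hull B" "x = roof_set_arr (roof_set A B h)"
          unfolding image_iff Bex_def Hom_Q by blast
        show "x \<in> Hom C A (hull B)"
          unfolding h(4) roof_set_arr[OF h(1-3) B] using h(1-3) AB(1) hull[OF B] by simp
      qed
      show "roof_set A B ` Hom C A (hull B) \<subseteq> Hom Q A B"
      proof
        fix x assume "x \<in> roof_set A B ` Hom C A (hull B)"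
        then show "x \<in> Hom Q A B"
          unfolding image_iff Bex_def Hom_Q Hom_iff using B by blast
      qed
    qed
  qed
  moreover have "roof_set_arr (b \<odot>\<^bsub>Q\<^esub> h \<odot>\<^bsub>Q\<^esub> farr (quotient_functor C Y) a) = farr R b \<odot> roof_set_arr h \<odot> a"
    if a: "a \<in> Hom C A' A" and b: "b \<in> Hom Q B B'" and h: "h \<in> Hom Q (fob (quotient_functor C Y) A) B" for A A' B B' a b h
  proof -
    obtain k l where t: "A \<in> Ob C" "B \<in> Ob C" "B' \<in> Ob C" "arr k" "src k = A" "tgt k = hull B" "h = roof_set A B k"
      "arr l" "src l = B" "tgt l = hull B'" "b = roof_set B B' l"
      using b h unfolding quotient_functor_sel Hom_Q by blast
    have a: "arr a" "src a = A'" "tgt a = A" "A' \<in> Ob C"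
      using a by auto
    note ha = hull[OF t(1)] and l = ext[OF t(8,10,3)]
    have 1: "b \<odot>\<^bsub>Q\<^esub> h = roof_set A B' (ext l \<odot> k)"
      unfolding t(7,11) by (rule Comp_Q) (use t in simp_all)
    have 2: "roof_set A B' (ext l \<odot> k) \<odot>\<^bsub>Q\<^esub> farr (quotient_functor C Y) a = roof_set A' B' (ext (ext l \<odot> k) \<odot> (\<eta> A \<odot> a))"
      unfolding quotient_functor_sel(2)[OF a(1)] a
      by (rule Comp_Q) (use a t ha l in simp_all)
    have lk: "arr (ext l \<odot> k)" "src (ext l \<odot> k) = A" "tgt (ext l \<odot> k) = hull B'"
      using l t by simp_all
    note e = ext[OF lk(1,3) t(3), unfolded lk(2)]
    have 3: "ext (ext l \<odot> k) \<odot> (\<eta> A \<odot> a) = (ext l \<odot> k) \<odot> a"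
      by (rule Comp_eq_comp[OF e(4)]) (use e ha a in simp_all)
    have "roof_set_arr (roof_set A' B' ((ext l \<odot> k) \<odot> a)) = (ext l \<odot> k) \<odot> a"
      by (rule roof_set_arr) (use lk a t in simp_all)
    moreover have "roof_set_arr h = k" "roof_set_arr b = l"
      unfolding t(7,11) by (rule roof_set_arr; use t in simp)+
    ultimately show ?thesis
      unfolding 1 2 3 R_sel using l t a by simp
  qed
  ultimately have "right_adjoint C Q (quotient_functor C Y) R"
    unfolding right_adjoint_def using ftor_quotient
    by (intro conjI exI[of _ "\<lambda>A B. roof_set_arr"]) blast+
  with R_sel(1) show ?thesis by blast
qed

end

section \<open>Weakly closed subcategories\<close>

text \<open>\<open>e\<close> and \<open>e'\<close> are the counits at \<open>B\<close>, and the two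
  factors are the comparison arrows between the adjoints. Swapping the roles of \<open>R\<close> and
  \<open>R'\<close> gives the other order of composition.\<close>

lemma right_adjoint_comp_Id:
  assumes F: "ftor C D F" and R: "ftor D C R" and R': "ftor D C R'"
    and bij: "\<And>A B. A \<in> Ob C \<Longrightarrow> B \<in> Ob D \<Longrightarrow> bij_betw (\<Phi> A B) (Hom D (fob F A) B) (Hom C A (fob R B))"
    and nat: "\<And>A A' B B' a b h. \<lbrakk>a \<in> Hom C A' A; b \<in> Hom D B B'; h \<in> Hom D (fob F A) B\<rbrakk> \<Longrightarrow>
        \<Phi> A' B' (b \<odot>\<^bsub>D\<^esub> h \<odot>\<^bsub>D\<^esub> farr F a) = farr R b \<odot>\<^bsub>C\<^esub> \<Phi> A B h \<odot>\<^bsub>C\<^esub> a"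
    and bij': "\<And>A B. A \<in> Ob C \<Longrightarrow> B \<in> Ob D \<Longrightarrow> bij_betw (\<Phi>' A B) (Hom D (fob F A) B) (Hom C A (fob R' B))"
    and nat': "\<And>A A' B B' a b h. \<lbrakk>a \<in> Hom C A' A; b \<in> Hom D B B'; h \<in> Hom D (fob F A) B\<rbrakk> \<Longrightarrow>
        \<Phi>' A' B' (b \<odot>\<^bsub>D\<^esub> h \<odot>\<^bsub>D\<^esub> farr F a) = farr R' b \<odot>\<^bsub>C\<^esub> \<Phi>' A B h \<odot>\<^bsub>C\<^esub> a"
    and B: "B \<in> Ob D"
    and e: "e \<in> Hom D (fob F (fob R B)) B" "\<Phi> (fob R B) B e = Id C (fob R B)"
    and e': "e' \<in> Hom D (fob F (fob R' B)) B" "\<Phi>' (fob R' B) B e' = Id C (fob R' B)"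
  shows "\<Phi> (fob R' B) B e' \<odot>\<^bsub>C\<^esub> \<Phi>' (fob R B) B e = Id C (fob R B)"
proof -
  interpret F: ftor C D F by (rule F)
  interpret R: ftor D C R by (rule R)
  interpret R': ftor D C R' by (rule R')
  have RB: "fob R B \<in> Ob C" "fob R' B \<in> Ob C"
    using R.fob_Ob R'.fob_Ob B by blast+
  have u: "\<Phi>' (fob R B) B e \<in> Hom C (fob R B) (fob R' B)"
    using bij'[OF RB(1) B] e(1) by (rule bij_betwE[THEN bspec])
  have v: "\<Phi> (fob R' B) B e' \<in> Hom C (fob R' B) (fob R B)"
    using bij[OF RB(2) B] e'(1) by (rule bij_betwE[THEN bspec])
  note I = F.target.Id_Hom[OF B]
  \<comment> \<open>Naturality of \<open>\<Phi>'\<close> shows that \<open>?x\<close>, the counit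
    \<open>e'\<close> precomposed with the comparison arrow, is \<open>e\<close>; naturality of
    \<open>\<Phi>\<close> then evaluates it. The identity in front gives it the shape of the
    naturality law.\<close>
  let ?x = "Id D B \<odot>\<^bsub>D\<^esub> e' \<odot>\<^bsub>D\<^esub> farr F (\<Phi>' (fob R B) B e)"
  have x: "?x \<in> Hom D (fob F (fob R B)) B"
    using F.target.Comp_Hom[OF F.farr_Hom[OF u] F.target.Comp_Hom[OF e'(1) I]] .
  have "\<Phi>' (fob R B) B ?x = \<Phi>' (fob R B) B e"
    using nat'[OF u I e'(1)] F.source.Id_Comp[OF u] F.source.Comp_Id[OF F.source.Id_Hom[OF RB(2)]]
    unfolding e'(2) R'.farr_Id[OF B] by simp
  then have xe: "?x = e"
    using bij_betw_imp_inj_on[OF bij'[OF RB(1) B]] x e(1) by (meson inj_onD)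
  have "\<Phi> (fob R B) B ?x = \<Phi> (fob R' B) B e' \<odot>\<^bsub>C\<^esub> \<Phi>' (fob R B) B e"
    using nat[OF u I e'(1)] F.source.Id_Comp[OF v] unfolding R.farr_Id[OF B] by simp
  then show ?thesis
    unfolding xe e(2) by simp
qed

lemma right_adjoint_isomorphic:
  assumes R: "right_adjoint C D F R" and R': "right_adjoint C D F R'" and B: "B \<in> Ob D"
  shows "isomorphic C (fob R B) (fob R' B)"
proof -
  from R obtain \<Phi> where f: "ftor C D F" "ftor D C R"
    and bij: "\<And>A B. A \<in> Ob C \<Longrightarrow> B \<in> Ob D \<Longrightarrow> bij_betw (\<Phi> A B) (Hom D (fob F A) B) (Hom C A (fob R B))"
    and nat: "\<And>A A' B B' a b h. \<lbrakk>a \<in> Hom C A' A; b \<in> Hom D B B'; h \<in> Hom D (fob F A) B\<rbrakk> \<Longrightarrow>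
        \<Phi> A' B' (b \<odot>\<^bsub>D\<^esub> h \<odot>\<^bsub>D\<^esub> farr F a) = farr R b \<odot>\<^bsub>C\<^esub> \<Phi> A B h \<odot>\<^bsub>C\<^esub> a"
    unfolding right_adjoint_def by blast
  from R' obtain \<Phi>' where f': "ftor D C R'"
    and bij': "\<And>A B. A \<in> Ob C \<Longrightarrow> B \<in> Ob D \<Longrightarrow> bij_betw (\<Phi>' A B) (Hom D (fob F A) B) (Hom C A (fob R' B))"
    and nat': "\<And>A A' B B' a b h. \<lbrakk>a \<in> Hom C A' A; b \<in> Hom D B B'; h \<in> Hom D (fob F A) B\<rbrakk> \<Longrightarrow>
        \<Phi>' A' B' (b \<odot>\<^bsub>D\<^esub> h \<odot>\<^bsub>D\<^esub> farr F a) = farr R' b \<odot>\<^bsub>C\<^esub> \<Phi>' A B h \<odot>\<^bsub>C\<^esub> a"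
    unfolding right_adjoint_def by blast
  have RB: "fob R B \<in> Ob C" "fob R' B \<in> Ob C"
    using ftor.fob_Ob[OF f(2) B] ftor.fob_Ob[OF f' B] .
  have cat: "category C"
    using f(1) unfolding ftor_def by blast
  obtain e where e: "e \<in> Hom D (fob F (fob R B)) B" "\<Phi> (fob R B) B e = Id C (fob R B)"
    using bij_betw_imp_surj_on[OF bij[OF RB(1) B]] category.Id_Hom[OF cat RB(1)] by (metis imageE)
  obtain e' where e': "e' \<in> Hom D (fob F (fob R' B)) B" "\<Phi>' (fob R' B) B e' = Id C (fob R' B)"
    using bij_betw_imp_surj_on[OF bij'[OF RB(2) B]] category.Id_Hom[OF cat RB(2)] by (metis imageE)
  have u: "\<Phi>' (fob R B) B e \<in> Hom C (fob R B) (fob R' B)"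
    using bij'[OF RB(1) B] e(1) by (rule bij_betwE[THEN bspec])
  have v: "\<Phi> (fob R' B) B e' \<in> Hom C (fob R' B) (fob R B)"
    using bij[OF RB(2) B] e'(1) by (rule bij_betwE[THEN bspec])
  have "\<Phi> (fob R' B) B e' \<odot>\<^bsub>C\<^esub> \<Phi>' (fob R B) B e = Id C (fob R B)"
    by (rule right_adjoint_comp_Id[OF f f' bij nat bij' nat' B e e'])
  moreover have "\<Phi>' (fob R B) B e \<odot>\<^bsub>C\<^esub> \<Phi> (fob R' B) B e' = Id C (fob R' B)"
    by (rule right_adjoint_comp_Id[OF f(1) f' f(2) bij' nat' bij nat B e' e])
  ultimately show ?thesis
    unfolding isomorphic_def using u v by blast
qed

context category
begin

lemma weakly_closed_sub:
  "\<lbrakk>weakly_closed V C Z; monic C A B f; B \<in> Z\<rbrakk> \<Longrightarrow> A \<in> Z"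
  and weakly_closed_quot:
  "\<lbrakk>weakly_closed V C Z; epic C A B f; A \<in> Z\<rbrakk> \<Longrightarrow> B \<in> Z"
  unfolding weakly_closed_def by blast+

lemma weakly_closed_sum:
  fixes V I :: "'v set"
  shows "\<lbrakk>weakly_closed V C Z; small V I; \<And>i. i \<in> I \<Longrightarrow> M i \<in> Z; is_direct_sum C I M S \<iota>\<rbrakk> \<Longrightarrow> S \<in> Z"
  unfolding weakly_closed_def by blast

end

section \<open>Stability, torsionfreeness and closure in terms of envelopes and null arrows\<close>

context localizing_subcategory
begin

text \<open>\<open>section_functor\<close> is a choice among all right adjoints, so it is tied to
  \<open>hull\<close> only up to isomorphism, by uniqueness of adjoints.\<close>

lemma section_hull:
  assumes "B \<in> Ob C"
  shows "isomorphic C (fob (section_functor C Y) B) (hull B)"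
proof -
  obtain R where R: "right_adjoint C Q (quotient_functor C Y) R" "\<forall>B. fob R B = hull B"
    using ex_right_adjoint by blast
  have "right_adjoint C Q (quotient_functor C Y) (section_functor C Y)"
    unfolding section_functor_def using R(1) by (rule someI)
  from right_adjoint_isomorphic[OF this R(1), of B] assms R(2) show ?thesis
    unfolding Q_sel by simp
qed

text \<open>A weakly closed class is closed under isomorphism, so \<open>hull\<close> may replace
  the chosen section functor.\<close>

lemma essentially_stable_iff:
  assumes "weakly_closed U C Z"
  shows "essentially_stable C Y Z \<longleftrightarrow> (\<forall>M\<in>Z. hull M \<in> Z)"
proof -
  have "fob (section_functor C Y) M \<in> Z \<longleftrightarrow> hull M \<in> Z" if "M \<in> Z" for M
  proof -
    have "M \<in> Ob C"
      using assms that unfolding weakly_closed_def by blast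
    from section_hull[OF this] show ?thesis
      using weakly_closed_iso[OF assms] isomorphic_sym by blast
  qed
  then show ?thesis
    unfolding essentially_stable_def quotient_functor_sel by blast
qed

text \<open>If the largest subobject in Y is zero, the image of a null arrow factors through it and
  vanishes. Conversely, for \<open>tf M\<close> the zero subobject is the largest one in Y, since
  arrows from objects of Y are null.\<close>

lemma torsionfree_iff: "torsionfree C Y M \<longleftrightarrow> tf M"
proof
  assume "torsionfree C Y M"
  then obtain T t where M: "M \<in> Ob C" and t: "monic C T M t" "zero_object C T"
    "\<And>S s. S \<in> Y \<Longrightarrow> monic C S M s \<Longrightarrow> \<exists>u\<in>Hom C S T. t \<odot> u = s"
    unfolding torsionfree_def is_torsion_subobject_def by blast
  have t': "arr t" "src t = T" "tgt t = M"
    using t(1) unfolding monic_iff by auto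
  have T: "T \<in> Ob C"
    using t(2) unfolding zero_object_def by blast
  have z: "u = zero S T" if "arr u" "src u = S" "tgt u = T" for u S
  proof -
    have "u \<in> Hom C S T" "zero S T \<in> Hom C S T" "S \<in> Ob C"
      using that T by auto
    then show ?thesis
      using t(2) unfolding zero_object_def by blast
  qed
  show "tf M"
    unfolding tf_def
  proof (intro conjI allI impI M)
    fix h assume h: "nul h" "tgt h = M"
    obtain m e where m: "mon C m" "epi C e" "src m = tgt e" "m \<odot> e = h" "src e = src h" "tgt m = tgt h"
      using image[OF null_arr[OF h(1)]] by blast
    have "src m \<in> Y"
      using null_image[of m e] m h by simp
    moreover have "monic C (src m) M m"
      unfolding monic_iff using m(1,6) h(2) by simp
    ultimately obtain u where "u \<in> Hom C (src m) T" "t \<odot> u = m"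
      using t(3) by blast
    then have u: "arr u" "src u = src m" "tgt u = T" "t \<odot> u = m"
      by auto
    have "m = zero (src m) M"
      using u(4) t' T m(1) unfolding z[OF u(1-3)] by simp
    then have "h = zero (src m) M \<odot> e"
      using m(4) by simp
    also have "\<dots> = zero (src h) M"
      using m(2,3,5) M by simp
    finally show "h = zero (src h) M" .
  qed
next
  assume M: "tf M"
  obtain T where T: "zero_object C T"
    using ex_zero by blast
  then have T': "T \<in> Ob C" "T \<in> Y"
    using Y_zero unfolding zero_object_def by blast+
  have MO: "M \<in> Ob C"
    using tf_Ob[OF M] .
  have z: "u = v" if "arr u" "src u = S" "tgt u = T" "arr v" "src v = S" "tgt v = T" for u v S
  proof -
    have "u \<in> Hom C S T" "v \<in> Hom C S T" "S \<in> Ob C"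
      using that T' by auto
    then show ?thesis
      using T unfolding zero_object_def by blast
  qed
  have "mon C (zero T M)"
  proof (rule monI)
    fix h assume h: "arr h" "tgt h = src (zero T M)"
    then have "tgt h = T"
      using T' MO by simp
    with z[of h "src h" "zero (src h) T"] h(1) T' MO show "h = zero (src h) (src (zero T M))"
      by simp
  qed (use T' MO in simp)
  then have "monic C T M (zero T M)"
    unfolding monic_iff using T' MO by simp
  moreover have "\<exists>u\<in>Hom C S T. zero T M \<odot> u = s" if s: "S \<in> Y" "monic C S M s" for S s
  proof
    have s': "arr s" "src s = S" "tgt s = M" "S \<in> Ob C"
      using s(2) unfolding monic_iff by auto
    have "nul s"
      by (rule Y_null(1)[OF s(1) s'(1,2)])
    from tfD[OF M this s'(3)] show "zero T M \<odot> zero S T = s"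
      using s'(2,4) T' MO by simp
    show "zero S T \<in> Hom C S T"
      using s' T' by simp
  qed
  ultimately show "torsionfree C Y M"
    unfolding torsionfree_def is_torsion_subobject_def using T T' MO by blast
qed

definition tf_quotients :: "'o set \<Rightarrow> 'o set" where
  "tf_quotients W = {tgt e | e. epi C e \<and> src e \<in> W \<and> tf (src e)}"

text \<open>The direct sum occurring in \<open>generated\<close> consists of torsionfree objects of
  \<open>W\<close>, so it is itself one and can stand alone as a source. Conversely, a single object
  is a direct sum over a one-element index set.\<close>

lemma generated_tf:
  assumes W: "weakly_closed U C W"
  shows "generated U C {M \<in> W. torsionfree C Y M} = tf_quotients W"
proof (intro equalityI subsetI)
  fix A assume "A \<in> generated U C {M \<in> W. torsionfree C Y M}"
  then obtain I :: "'u set" and M S \<iota> e where h: "small U I" "\<forall>i\<in>I. M i \<in> {M \<in> W. torsionfree C Y M}"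
    "is_direct_sum C I M S \<iota>" "epic C S A e"
    unfolding generated_def by blast
  have "S \<in> W"
    by (rule weakly_closed_sum[OF W h(1) _ h(3)]) (use h(2) in blast)
  moreover have "tf S"
    by (rule tf_direct_sum[OF h(1,3)]) (use h(2) torsionfree_iff in blast)
  ultimately show "A \<in> tf_quotients W"
    using h(4) unfolding epic_iff tf_quotients_def by blast
next
  fix A assume "A \<in> tf_quotients W"
  then obtain e where e: "epi C e" "src e \<in> W" "tf (src e)" "A = tgt e"
    unfolding tf_quotients_def by blast
  define I :: "'u set" where "I = {undefined}"
  have "small U I"
    unfolding I_def by (rule small_finite[OF univ]) simp
  moreover have "is_direct_sum C I (\<lambda>_. src e) (src e) (\<lambda>_. Id C (src e))"
    unfolding is_direct_sum_def
  proof (intro conjI ballI allI impI)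
    fix T f assume f: "\<forall>i\<in>I. f i \<in> Hom C (src e) T"
    then have "f undefined \<in> Hom C (src e) T"
      unfolding I_def by blast
    then show "\<exists>!h. h \<in> Hom C (src e) T \<and> (\<forall>i\<in>I. h \<odot> Id C (src e) = f i)"
      by (intro ex1I[of _ "f undefined"]) (auto simp: I_def)
  qed (use e(1) in simp_all)
  moreover have "epic C (src e) A e"
    unfolding epic_iff using e by simp
  moreover have "\<forall>i\<in>I. src e \<in> {M \<in> W. torsionfree C Y M}"
    using e torsionfree_iff by blast
  ultimately show "A \<in> generated U C {M \<in> W. torsionfree C Y M}"
    unfolding generated_def
    by (intro CollectI exI[of _ I] exI[of _ "\<lambda>_. src e"] exI[of _ "src e"] exI[of _ "\<lambda>_. Id C (src e)"]
        exI[of _ e] conjI)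
qed

lemma tf_quotients_sub:
  assumes "weakly_closed U C W"
  shows "tf_quotients W \<subseteq> W"
proof
  fix A assume "A \<in> tf_quotients W"
  then obtain e where e: "epi C e" "src e \<in> W" "A = tgt e"
    unfolding tf_quotients_def by blast
  then have "epic C (src e) A e"
    unfolding epic_iff by simp
  from weakly_closed_quot[OF assms this e(2)] show "A \<in> W" .
qed

lemma tf_quotientsI: "tf N \<Longrightarrow> N \<in> W \<Longrightarrow> N \<in> tf_quotients W"
  unfolding tf_quotients_def mem_Collect_eq
  by (rule exI[of _ "Id C N"]) (use tf_Ob epi_Id in auto)

text \<open>All closure properties lift to covers: a subobject is covered by the pullback of the
  cover, which embeds in a torsionfree object of \<open>W\<close>; a direct sum is covered by the
  direct sum of the covers.\<close>

lemma weakly_closed_tf_quotients: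
  assumes W: "weakly_closed U C W"
  shows "weakly_closed U C (tf_quotients W)"
  unfolding weakly_closed_def
proof (intro conjI allI impI)
  show "tf_quotients W \<subseteq> Ob C"
    using tf_quotients_sub[OF W] W unfolding weakly_closed_def by blast
next
  fix A B m assume m: "monic C A B m" and B: "B \<in> tf_quotients W"
  then have m': "mon C m" "src m = A" "tgt m = B"
    unfolding monic_iff by auto
  obtain e where e: "epi C e" "src e \<in> W" "tf (src e)" "tgt e = B"
    using B unfolding tf_quotients_def by blast
  obtain x y where xy: "pullback C e m x y"
    using ex_pullback[of e m] e m' by auto
  note d = pullbackD(3,4,6-8)[OF xy]
  have x: "mon C x"
    by (rule pullback_mon[OF pullback_sym[OF xy] m'(1)])
  have y: "epi C y"
    by (rule pullback_epi[OF xy e(1)])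
  have "monic C (src x) (src e) x"
    unfolding monic_iff using x d by simp
  then have "src x \<in> W"
    by (rule weakly_closed_sub[OF W _ e(2)])
  moreover have "tf (src x)"
    using tf_sub[OF x] d(3) e(3) by simp
  ultimately show "A \<in> tf_quotients W"
    using y d(4,5) m'(2) unfolding tf_quotients_def mem_Collect_eq by (intro exI[of _ y]) simp
next
  fix A B f assume f: "epic C A B f" and A: "A \<in> tf_quotients W"
  then have f': "epi C f" "src f = A" "tgt f = B"
    unfolding epic_iff by auto
  obtain e where e: "epi C e" "src e \<in> W" "tf (src e)" "tgt e = A"
    using A unfolding tf_quotients_def by blast
  with f' epi_comp[of e f] show "B \<in> tf_quotients W"
    unfolding tf_quotients_def mem_Collect_eq by (intro exI[of _ "f \<odot> e"]) simp
next
  fix I :: "'u set" and M S \<iota>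
  assume I: "small U I" and M: "\<forall>i\<in>I. M i \<in> tf_quotients W" and S: "is_direct_sum C I M S \<iota>"
  note a = direct_sum_arr[OF S]
  have "\<forall>i\<in>I. \<exists>e. epi C e \<and> src e \<in> W \<and> tf (src e) \<and> tgt e = M i"
  proof
    fix i assume "i \<in> I"
    with M have "M i \<in> tf_quotients W" by blast
    then show "\<exists>e. epi C e \<and> src e \<in> W \<and> tf (src e) \<and> tgt e = M i"
      unfolding tf_quotients_def mem_Collect_eq by metis
  qed
  from bchoice[OF this] obtain e where e: "\<And>i. i \<in> I \<Longrightarrow> epi C (e i) \<and> src (e i) \<in> W \<and> tf (src (e i)) \<and> tgt (e i) = M i"
    by blast
  obtain T \<kappa> where T: "is_direct_sum C I (\<lambda>i. src (e i)) T \<kappa>"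
    using ex_sum[OF I, of "\<lambda>i. src (e i)"] e by auto
  note b = direct_sum_arr[OF T]
  have "\<exists>h. arr h \<and> src h = T \<and> tgt h = S \<and> (\<forall>i\<in>I. h \<odot> \<kappa> i = \<iota> i \<odot> e i)"
    by (rule direct_sum_map[OF T a(1)]) (use a(2) e in simp)
  then obtain h where h: "arr h" "src h = T" "tgt h = S" "\<And>i. i \<in> I \<Longrightarrow> h \<odot> \<kappa> i = \<iota> i \<odot> e i"
    by blast
  have "epi C h"
  proof (rule epiI[OF h(1)])
    fix t assume t: "arr t" "src t = tgt h" "t \<odot> h = zero (src h) (tgt t)"
    have "t = zero S (tgt t)"
    proof (rule direct_sum_ext[OF S])
      show "\<forall>i\<in>I. t \<odot> \<iota> i = zero S (tgt t) \<odot> \<iota> i"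
      proof
        fix i assume i: "i \<in> I"
        note ti = a(2)[OF i] b(2)[OF i] e[OF i]
        have "(t \<odot> \<iota> i) \<odot> e i = t \<odot> (h \<odot> \<kappa> i)"
          unfolding h(4)[OF i] using ti t h(1-3) by simp
        also have "\<dots> = zero (src (e i)) (tgt t)"
          using ti t(1,2) h(1-3) by (simp add: Comp_eq_comp[OF t(3)])
        finally have "t \<odot> \<iota> i = zero (M i) (tgt t)"
          using epi_zero[of "e i" "t \<odot> \<iota> i"] ti t(1,2) h(1-3) by simp
        then show "t \<odot> \<iota> i = zero S (tgt t) \<odot> \<iota> i"
          using ti t(1) by simp
      qed
    qed (use t(1,2) h(3) a(1) in simp_all)
    with h(3) show "t = zero (tgt h) (tgt t)" by simp
  qed
  moreover have "T \<in> W"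
    by (rule weakly_closed_sum[OF W I _ T]) (use e in blast)
  moreover have "tf T"
    by (rule tf_direct_sum[OF I T]) (use e in blast)
  ultimately show "S \<in> tf_quotients W"
    using h(2,3) unfolding tf_quotients_def mem_Collect_eq by (intro exI[of _ h]) simp
qed

text \<open>Kleisli arrows \<open>A \<rightarrow> hull B\<close> correspond by \<open>ext\<close> to
  arrows between envelopes, compatibly with composition.\<close>

lemma isomorphic_Q_iff:
  assumes A: "A \<in> Ob C" and B: "B \<in> Ob C"
  shows "isomorphic Q A B \<longleftrightarrow> isomorphic C (hull A) (hull B)"
proof
  note a = hull[OF A] and b = hull[OF B]
  assume "isomorphic Q A B"
  then obtain c d where cd: "c \<in> Hom Q A B" "d \<in> Hom Q B A" "d \<odot>\<^bsub>Q\<^esub> c = Id Q A" "c \<odot>\<^bsub>Q\<^esub> d = Id Q B"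
    unfolding isomorphic_def by blast
  obtain h where h: "arr h" "src h = A" "tgt h = hull B" "c = roof_set A B h"
    using cd(1) unfolding Hom_Q by blast
  obtain k where k: "arr k" "src k = B" "tgt k = hull A" "d = roof_set B A k"
    using cd(2) unfolding Hom_Q by blast
  note eh = ext[OF h(1,3) B, unfolded h(2)] and ek = ext[OF k(1,3) A, unfolded k(2)]
  have "roof_set A A (ext k \<odot> h) = roof_set A A (\<eta> A)" "roof_set B B (ext h \<odot> k) = roof_set B B (\<eta> B)"
    using cd(3,4) Comp_Q[OF h(1-3) k(1-3) B A] Comp_Q[OF k(1-3) h(1-3) A B]
    unfolding h(4) k(4) Id_Q[OF A] Id_Q[OF B] by simp_all
  moreover have "arr (ext k \<odot> h)" "src (ext k \<odot> h) = A" "tgt (ext k \<odot> h) = hull A"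
    "arr (ext h \<odot> k)" "src (ext h \<odot> k) = B" "tgt (ext h \<odot> k) = hull B"
    using eh ek h k by simp_all
  ultimately have "ext k \<odot> h = \<eta> A" "ext h \<odot> k = \<eta> B"
    using roof_set_inj A B by metis+
  then have "ext k \<odot> ext h = Id C (hull A)" "ext h \<odot> ext k = Id C (hull B)"
    using ext_ext[OF h(1,3) B k(1-3) A] ext_ext[OF k(1,3) A h(1-3) B] ext_\<eta> A B by simp_all
  then show "isomorphic C (hull A) (hull B)"
    by (rule isomorphicI[OF eh(1-3) ek(1-3)])
next
  note a = hull[OF A] and b = hull[OF B]
  assume "isomorphic C (hull A) (hull B)"
  then obtain u v where uv: "arr u" "src u = hull A" "tgt u = hull B" "arr v" "src v = hull B" "tgt v = hull A"
    "v \<odot> u = Id C (hull A)" "u \<odot> v = Id C (hull B)"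
    by (rule isomorphicE)
  have h: "arr (u \<odot> \<eta> A)" "src (u \<odot> \<eta> A) = A" "tgt (u \<odot> \<eta> A) = hull B" "ext (u \<odot> \<eta> A) = u"
    using uv a ext_unique[OF uv(1,2) A uv(3) B] by simp_all
  have k: "arr (v \<odot> \<eta> B)" "src (v \<odot> \<eta> B) = B" "tgt (v \<odot> \<eta> B) = hull A" "ext (v \<odot> \<eta> B) = v"
    using uv b ext_unique[OF uv(4,5) B uv(6) A] by simp_all
  have "roof_set B A (v \<odot> \<eta> B) \<odot>\<^bsub>Q\<^esub> roof_set A B (u \<odot> \<eta> A) = Id Q A"
    unfolding Comp_Q[OF h(1-3) k(1-3) B A] k(4) Id_Q[OF A] Comp_eq_comp[OF uv(7) uv(1,4) a(2) uv(5)[folded uv(3)] uv(2)[folded a(4)]]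
    using a by simp
  moreover have "roof_set A B (u \<odot> \<eta> A) \<odot>\<^bsub>Q\<^esub> roof_set B A (v \<odot> \<eta> B) = Id Q B"
    unfolding Comp_Q[OF k(1-3) h(1-3) A B] h(4) Id_Q[OF B] Comp_eq_comp[OF uv(8) uv(4,1) b(2) uv(2)[folded uv(6)] uv(5)[folded b(4)]]
    using b by simp
  moreover have "roof_set A B (u \<odot> \<eta> A) \<in> Hom Q A B" "roof_set B A (v \<odot> \<eta> B) \<in> Hom Q B A"
    unfolding Hom_Q using A B h(1-3) k(1-3) by blast+
  ultimately show "isomorphic Q A B"
    unfolding isomorphic_def by blast
qed

text \<open>The Kleisli arrow of \<open>s\<close> has as inverse the extension of
  \<open>\<eta> (src s)\<close> along \<open>s\<close>. Applied to \<open>\<eta>\<close> itself,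
  this makes an object isomorphic to its envelope in X/Y.\<close>

lemma qi_isomorphic_hull:
  assumes s: "qi s"
  shows "isomorphic C (hull (src s)) (hull (tgt s))"
proof -
  have A: "src s \<in> Ob C" and B: "tgt s \<in> Ob C"
    using s by simp_all
  note a = hull[OF A] and b = hull[OF B]
  define h where "h = \<eta> (tgt s) \<odot> s"
  have h: "arr h" "src h = src s" "tgt h = hull (tgt s)"
    unfolding h_def using s b by simp_all
  define k where "k = lift s (\<eta> (src s))"
  have k: "arr k" "src k = tgt s" "tgt k = hull (src s)" "k \<odot> s = \<eta> (src s)"
    unfolding k_def using lift[OF s, of "\<eta> (src s)"] a by simp_all
  note u = ext[OF h(1,3) B, unfolded h(2)] and v = ext[OF k(1,3) A, unfolded k(2)]
  have "ext k \<odot> h = \<eta> (src s)"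
    unfolding h_def using Comp_eq_comp[OF v(4), of s] v b k s by simp
  then have vu: "ext k \<odot> ext h = Id C (hull (src s))"
    using ext_ext[OF h(1,3) B k(1,2,3) A] ext_\<eta>[OF A] by simp
  have "ext h \<odot> k = \<eta> (tgt s)"
  proof (rule qi_cancel[OF s b(7)])
    show "ext h \<odot> k \<odot> s = \<eta> (tgt s) \<odot> s"
      using u k s h_def by simp
  qed (use u k b in simp_all)
  then have uv: "ext h \<odot> ext k = Id C (hull (tgt s))"
    using ext_ext[OF k(1,3) A h(1,2,3) B] ext_\<eta>[OF B] by simp
  show ?thesis
    by (rule isomorphicI[OF u(1-3) v(1-3) vu uv])
qed

lemma isomorphic_Q_hull:
  assumes "A \<in> Ob C"
  shows "isomorphic Q A (hull A)"
  using qi_isomorphic_hull[OF hull(1)[OF assms]] isomorphic_Q_iff[OF assms hull(6)[OF assms]] hull[OF assms] by simp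

text \<open>Arrows of X into \<open>hull A\<close> are exactly the Kleisli arrows into
  \<open>A\<close>, so monicity of the class in X/Y tests \<open>ext h\<close> against every arrow
  of X.\<close>

lemma monic_Q_ext:
  assumes c: "monic Q A B (roof_set A B h)" and h: "arr h" "src h = A" "tgt h = hull B" and B: "B \<in> Ob C"
  shows "mon C (ext h)"
proof -
  have A: "A \<in> Ob C" using h by auto
  note e = ext[OF h(1,3) B, unfolded h(2)] and a = hull[OF A] and b = hull[OF B]
  show ?thesis
  proof (rule monI[OF e(1)])
    fix x assume x: "arr x" "tgt x = src (ext h)" "ext h \<odot> x = zero (src x) (tgt (ext h))"
    define T where "T = src x"
    have xt: "arr x" "src x = T" "tgt x = hull A" "T \<in> Ob C"
      using x e T_def by auto
    have zt: "arr (zero T (hull A))" "src (zero T (hull A)) = T" "tgt (zero T (hull A)) = hull A"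
      using xt a by simp_all
    have "ext h \<odot> x = ext h \<odot> zero T (hull A)"
      using x(3) e xt by simp
    then have "roof_set A B h \<odot>\<^bsub>Q\<^esub> roof_set T A x = roof_set A B h \<odot>\<^bsub>Q\<^esub> roof_set T A (zero T (hull A))"
      unfolding Comp_Q[OF xt(1-3) h A B] Comp_Q[OF zt h A B] by simp
    moreover have "roof_set T A x \<in> Hom Q T A" "roof_set T A (zero T (hull A)) \<in> Hom Q T A"
      unfolding Hom_Q using xt zt A by blast+
    ultimately have "roof_set T A x = roof_set T A (zero T (hull A))"
      using c unfolding monic_def by blast
    from roof_set_inj[OF this xt(1-3) A] have "x = zero T (hull A)"
      by blast
    then show "x = zero (src x) (src (ext h))"
      unfolding T_def[symmetric] e(2) .
  qed
qed

text \<open>An arrow \<open>t\<close> killing \<open>h\<close> becomes, after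
  \<open>\<eta> D\<close>, a Kleisli arrow out of \<open>B\<close> with zero composite; epicity
  gives that \<open>\<eta> D \<odot> t\<close> vanishes, hence \<open>t\<close> is null. Since
  \<open>hull\<close> does not preserve epics in general, the conclusion is only modulo Y.\<close>

lemma epic_Q_Yepi:
  assumes c: "epic Q A B (roof_set A B h)" and h: "arr h" "src h = A" "tgt h = hull B" and B: "B \<in> Ob C"
  shows "Yepi C Y h"
proof (rule YepiI[OF h(1)])
  have A: "A \<in> Ob C" using h by auto
  note b = hull[OF B]
  fix t assume t: "arr t" "src t = tgt h" "t \<odot> h = zero (src h) (tgt t)"
  define D where "D = tgt t"
  have tt: "arr t" "src t = hull B" "tgt t = D" "D \<in> Ob C"
    using t h D_def by auto
  note d = hull[OF tt(4)]
  have z: "\<eta> D \<odot> t \<odot> h = zero A (hull D)"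
    using t(3) tt h d A by simp
  define x where "x = \<eta> D \<odot> t"
  have x: "arr x" "src x = hull B" "tgt x = hull D" "x \<odot> h = zero A (hull D)"
    unfolding x_def using tt d z by simp_all
  \<comment> \<open>The quotient is a plain category without named zero arrows, so zero is put in
    the same form as \<open>x\<close> and the two are compared.\<close>
  define x0 where "x0 = zero (hull B) (hull D)"
  have x0: "arr x0" "src x0 = hull B" "tgt x0 = hull D" "x0 \<odot> h = zero A (hull D)"
    unfolding x0_def using b d h by simp_all
  have y: "arr (x \<odot> \<eta> B)" "src (x \<odot> \<eta> B) = B" "tgt (x \<odot> \<eta> B) = hull D" "ext (x \<odot> \<eta> B) = x"
    using x b ext_unique[OF x(1,2) B x(3) tt(4)] by simp_all
  have y0: "arr (x0 \<odot> \<eta> B)" "src (x0 \<odot> \<eta> B) = B" "tgt (x0 \<odot> \<eta> B) = hull D" "ext (x0 \<odot> \<eta> B) = x0"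
    using x0 b ext_unique[OF x0(1,2) B x0(3) tt(4)] by simp_all
  have "roof_set B D (x \<odot> \<eta> B) \<odot>\<^bsub>Q\<^esub> roof_set A B h = roof_set B D (x0 \<odot> \<eta> B) \<odot>\<^bsub>Q\<^esub> roof_set A B h"
    unfolding Comp_Q[OF h y(1-3) B tt(4)] Comp_Q[OF h y0(1-3) B tt(4)] y(4) y0(4) x(4) x0(4) ..
  moreover have "roof_set B D (x \<odot> \<eta> B) \<in> Hom Q B D" "roof_set B D (x0 \<odot> \<eta> B) \<in> Hom Q B D"
    unfolding Hom_Q using y y0 B tt(4) by blast+
  ultimately have "roof_set B D (x \<odot> \<eta> B) = roof_set B D (x0 \<odot> \<eta> B)"
    using c unfolding epic_def by blast
  from roof_set_inj[OF this y(1-3) tt(4)] have "x \<odot> \<eta> B = x0 \<odot> \<eta> B"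
    by blast
  then have "x = x0"
    by (rule qi_cancel[OF b(1) d(7)]) (use x x0 b in simp_all)
  then have nul: "nul (\<eta> D \<odot> t)"
    unfolding x_def x0_def using b d by simp
  have Ymon: "Ymon C Y (\<eta> D)"
    using d(1) unfolding qi_def by blast
  show "nul t"
    by (rule YmonD(2)[OF Ymon nul]) (use tt d in simp_all)
qed

text \<open>\<open>ext h\<close> is monic modulo Y, since a test arrow can be pulled back along
  \<open>\<eta> A\<close> to one into \<open>A\<close> itself, where \<open>f\<close> is monic; its
  source being torsionfree, \<open>ext h\<close> is then monic.\<close>

lemma monic_Q_mon:
  assumes f: "mon C f"
  shows "monic Q (src f) (tgt f) (roof_set (src f) (tgt f) (\<eta> (tgt f) \<odot> f))"
proof -
  define A B where "A = src f" and "B = tgt f"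
  have ft: "arr f" "src f = A" "tgt f = B" "A \<in> Ob C" "B \<in> Ob C"
    using f A_def B_def by auto
  note a = hull[OF ft(4)] and b = hull[OF ft(5)]
  define h where "h = \<eta> B \<odot> f"
  have h: "arr h" "src h = A" "tgt h = hull B"
    unfolding h_def using ft b by simp_all
  note e = ext[OF h(1,3) ft(5), unfolded h(2)]
  have "Ymon C Y (ext h)"
  proof (rule YmonI[OF e(1)])
    fix x assume x: "arr x" "tgt x = src (ext h)" "ext h \<odot> x = zero (src x) (tgt (ext h))"
    obtain p q where pq: "pullback C (\<eta> A) x p q"
      using ex_pullback[of "\<eta> A" x] a x e by auto
    note d = pullbackD(3,4,6-9)[OF pq]
    have q: "Yepi C Y q"
      using pullback_qi[OF pq a(1)] unfolding qi_def by blast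
    have "h \<odot> p = ext h \<odot> (\<eta> A \<odot> p)"
      by (rule Comp_eq_comp[OF e(4), symmetric]) (use e a d in simp_all)
    also have "\<dots> = zero (src q) (hull B)"
      unfolding d(6) using d(1-5) e x b by (simp add: Comp_eq_comp[OF x(3)])
    finally have "nul (h \<odot> p)"
      using d b by simp
    then have nul: "nul (\<eta> B \<odot> (f \<odot> p))"
      unfolding h_def using ft b d a by simp
    have Ymon: "Ymon C Y (\<eta> B)"
      using b(1) unfolding qi_def by blast
    have "nul (f \<odot> p)"
      by (rule YmonD(2)[OF Ymon nul]) (use ft b d a in simp_all)
    then have "nul p"
      by (rule null_mon[OF _ f]) (use ft d a in simp_all)
    then have "nul (\<eta> A \<odot> p)"
      by (rule null_comp_left) (use d a in simp_all)
    then have "nul (x \<odot> q)"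
      unfolding d(6) .
    then show "nul x"
      by (rule YepiD(2)[OF q]) (use d x in simp_all)
  qed
  then have m: "mon C (ext h)"
    by (rule tf_Ymon_mon) (use e a in simp)
  have "roof_set A B h \<in> Hom Q A B"
    unfolding Hom_Q using h ft by blast
  moreover have "g = g'" if g: "g \<in> Hom Q L A" and g': "g' \<in> Hom Q L A"
    and eq: "roof_set A B h \<odot>\<^bsub>Q\<^esub> g = roof_set A B h \<odot>\<^bsub>Q\<^esub> g'" for L g g'
  proof -
    obtain x where x: "arr x" "src x = L" "tgt x = hull A" "g = roof_set L A x"
      using g unfolding Hom_Q by blast
    obtain y where y: "arr y" "src y = L" "tgt y = hull A" "g' = roof_set L A y"
      using g' unfolding Hom_Q by blast
    have "roof_set L B (ext h \<odot> x) = roof_set L B (ext h \<odot> y)"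
      using eq unfolding x(4) y(4) Comp_Q[OF x(1-3) h ft(4,5)] Comp_Q[OF y(1-3) h ft(4,5)] .
    then have "ext h \<odot> x = ext h \<odot> y"
      using roof_set_inj[of L B "ext h \<odot> x" L B "ext h \<odot> y"] e x ft(5) by simp
    then have "x = y"
      by (rule mon_cancel[OF m]) (use x y e in simp_all)
    with x y show ?thesis by simp
  qed
  ultimately show ?thesis
    unfolding monic_def h_def A_def B_def by blast
qed

text \<open>Composition with the class of \<open>f\<close> sends a Kleisli arrow \<open>x\<close> to
  \<open>x \<odot> f\<close>, so epicity passes over directly.\<close>

lemma epic_Q_epi:
  assumes f: "epi C f"
  shows "epic Q (src f) (tgt f) (roof_set (src f) (tgt f) (\<eta> (tgt f) \<odot> f))"
proof -
  define A B where "A = src f" and "B = tgt f"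
  have ft: "arr f" "src f = A" "tgt f = B" "A \<in> Ob C" "B \<in> Ob C"
    using f A_def B_def by auto
  note b = hull[OF ft(5)]
  define h where "h = \<eta> B \<odot> f"
  have h: "arr h" "src h = A" "tgt h = hull B"
    unfolding h_def using ft b by simp_all
  have "roof_set A B h \<in> Hom Q A B"
    unfolding Hom_Q using h ft by blast
  moreover have "g = g'" if g: "g \<in> Hom Q B L" and g': "g' \<in> Hom Q B L"
    and eq: "g \<odot>\<^bsub>Q\<^esub> roof_set A B h = g' \<odot>\<^bsub>Q\<^esub> roof_set A B h" for L g g'
  proof -
    obtain x where x: "arr x" "src x = B" "tgt x = hull L" "g = roof_set B L x" and L: "L \<in> Ob C"
      using g unfolding Hom_Q by blast
    obtain y where y: "arr y" "src y = B" "tgt y = hull L" "g' = roof_set B L y"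
      using g' unfolding Hom_Q by blast
    have eh: "ext x \<odot> h = x \<odot> f" if x: "arr x" "src x = B" "tgt x = hull L" for x
      unfolding h_def
      by (rule Comp_eq_comp) (use ext[OF x(1,3) L] x b ft in simp_all)
    have "roof_set A L (x \<odot> f) = roof_set A L (y \<odot> f)"
      using eq unfolding x(4) y(4) Comp_Q[OF h x(1-3) ft(5) L] Comp_Q[OF h y(1-3) ft(5) L] eh[OF x(1-3)] eh[OF y(1-3)] .
    then have "x \<odot> f = y \<odot> f"
      using roof_set_inj[of A L "x \<odot> f" A L "y \<odot> f"] x ft L by simp
    then have "x = y"
      by (rule epi_cancel[OF f]) (use x y ft in simp_all)
    with x y show ?thesis by simp
  qed
  ultimately show ?thesis
    unfolding epic_def h_def A_def B_def by blast
qed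

text \<open>\<pi> is a left adjoint: arrows of X/Y from \<open>S\<close> to \<open>T\<close> are
  arrows of X from \<open>S\<close> to \<open>hull T\<close>, where the universal property of
  \<open>S\<close> in X applies.\<close>

lemma direct_sum_Q:
  assumes I: "small U (I :: 'u set)" and S: "is_direct_sum C I M S \<iota>"
  shows "is_direct_sum Q I M S (\<lambda>i. roof_set (M i) S (\<eta> S \<odot> \<iota> i))"
  unfolding is_direct_sum_def
proof (intro conjI ballI allI impI)
  note a = direct_sum_arr[OF S]
  note s = hull[OF a(1)]
  show "S \<in> Ob Q"
    using a(1) unfolding Q_sel .
  have i_t: "arr (\<eta> S \<odot> \<iota> i)" "src (\<eta> S \<odot> \<iota> i) = M i" "tgt (\<eta> S \<odot> \<iota> i) = hull S" "M i \<in> Ob C" if "i \<in> I" for i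
    using a(2)[OF that] s by simp_all
  fix i assume "i \<in> I"
  from i_t[OF this] a(1) show "roof_set (M i) S (\<eta> S \<odot> \<iota> i) \<in> Hom Q (M i) S"
    unfolding Hom_Q by blast
next
  note a = direct_sum_arr[OF S]
  note s = hull[OF a(1)]
  have i_t: "arr (\<eta> S \<odot> \<iota> i)" "src (\<eta> S \<odot> \<iota> i) = M i" "tgt (\<eta> S \<odot> \<iota> i) = hull S" "M i \<in> Ob C" if "i \<in> I" for i
    using a(2)[OF that] s by simp_all
  fix T f assume "T \<in> Ob Q" and f: "\<forall>i\<in>I. f i \<in> Hom Q (M i) T"
  then have T: "T \<in> Ob C" unfolding Q_sel by simp
  have "\<forall>i\<in>I. \<exists>h. arr h \<and> src h = M i \<and> tgt h = hull T \<and> f i = roof_set (M i) T h"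
    using f unfolding Hom_Q by blast
  from bchoice[OF this] obtain x where x: "\<And>i. i \<in> I \<Longrightarrow> arr (x i) \<and> src (x i) = M i \<and> tgt (x i) = hull T \<and> f i = roof_set (M i) T (x i)"
    by blast
  have comp: "roof_set S T h \<odot>\<^bsub>Q\<^esub> roof_set (M i) S (\<eta> S \<odot> \<iota> i) = roof_set (M i) T (h \<odot> \<iota> i)"
    if i: "i \<in> I" and h: "arr h" "src h = S" "tgt h = hull T" for i h
  proof -
    have "ext h \<odot> (\<eta> S \<odot> \<iota> i) = h \<odot> \<iota> i"
      by (rule Comp_eq_comp) (use ext[OF h(1,3) T] h s a(2)[OF i] in simp_all)
    with Comp_Q[OF i_t(1-3)[OF i] h a(1) T] show ?thesis by simp
  qed
  have "\<exists>h. arr h \<and> src h = S \<and> tgt h = hull T \<and> (\<forall>i\<in>I. h \<odot> \<iota> i = x i)"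
    by (rule direct_sum_map[OF S hull(6)[OF T]]) (use x in blast)
  then obtain h where h: "arr h" "src h = S" "tgt h = hull T" "\<And>i. i \<in> I \<Longrightarrow> h \<odot> \<iota> i = x i"
    by blast
  show "\<exists>!c. c \<in> Hom Q S T \<and> (\<forall>i\<in>I. c \<odot>\<^bsub>Q\<^esub> roof_set (M i) S (\<eta> S \<odot> \<iota> i) = f i)"
  proof (rule ex1I[of _ "roof_set S T h"], rule conjI)
    show "roof_set S T h \<in> Hom Q S T"
      unfolding Hom_Q using h a(1) T by blast
    show "\<forall>i\<in>I. roof_set S T h \<odot>\<^bsub>Q\<^esub> roof_set (M i) S (\<eta> S \<odot> \<iota> i) = f i"
      using comp[OF _ h(1-3)] h(4) x by simp
  next
    fix c assume c: "c \<in> Hom Q S T \<and> (\<forall>i\<in>I. c \<odot>\<^bsub>Q\<^esub> roof_set (M i) S (\<eta> S \<odot> \<iota> i) = f i)"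
    then obtain k where k: "arr k" "src k = S" "tgt k = hull T" "c = roof_set S T k"
      unfolding Hom_Q by blast
    have "k = h"
    proof (rule direct_sum_ext[OF S])
      show "\<forall>i\<in>I. k \<odot> \<iota> i = h \<odot> \<iota> i"
      proof
        fix i assume i: "i \<in> I"
        have "roof_set (M i) T (k \<odot> \<iota> i) = f i"
          using c i comp[OF i k(1-3)] unfolding k(4) by simp
        then have "roof_set (M i) T (k \<odot> \<iota> i) = roof_set (M i) T (x i)"
          using x[OF i] by simp
        then show "k \<odot> \<iota> i = h \<odot> \<iota> i"
          using roof_set_inj[of "M i" T "k \<odot> \<iota> i" "M i" T "x i"] k(1-3) a(2)[OF i] T h(4)[OF i] by simp
      qed
    qed (use h k in simp_all)
    with k(4) show "c = roof_set S T h" by simp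
  qed
qed

text \<open>This is the preimage under \<pi>, which is the identity on objects and preserves monics,
  epics and direct sums.\<close>

lemma weakly_closed_Q_C:
  assumes Z: "weakly_closed U Q Z"
  shows "weakly_closed U C Z"
  unfolding weakly_closed_def
proof (intro conjI allI impI)
  interpret Q: category Q by (rule category_Q)
  show "Z \<subseteq> Ob C"
    using Z unfolding weakly_closed_def Q_sel by blast
  show "A \<in> Z" if "monic C A B f" "B \<in> Z" for A B f
    using Q.weakly_closed_sub[OF Z monic_Q_mon] that unfolding monic_iff by blast
  show "B \<in> Z" if "epic C A B f" "A \<in> Z" for A B f
    using Q.weakly_closed_quot[OF Z epic_Q_epi] that unfolding epic_iff by blast
  show "S \<in> Z" if "small U I" "\<forall>i\<in>I. M i \<in> Z" "is_direct_sum C I M S \<iota>" for I :: "'u set" and M S \<iota>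
    using Q.weakly_closed_sum[OF Z that(1) _ direct_sum_Q[OF that(1,3)]] that(2) by blast
qed

lemma weakly_closed_Q_hull:
  assumes Z: "weakly_closed U Q Z" and N: "N \<in> Ob C"
  shows "hull N \<in> Z \<longleftrightarrow> N \<in> Z"
  using category.weakly_closed_iso[OF category_Q Z] isomorphic_Q_hull[OF N]
    category.isomorphic_sym[OF category_Q] by blast

text \<open>Isomorphism in X/Y is isomorphism of envelopes, so stability puts \<open>hull N\<close>
  in \<open>Z\<close>; conversely \<open>hull N\<close> itself is an object of \<open>Z\<close>
  isomorphic to \<open>N\<close> in X/Y.\<close>

lemma quotient_image_eq:
  assumes Z: "weakly_closed U C Z" and st: "\<forall>M\<in>Z. hull M \<in> Z"
  shows "quotient_image C Y Z = {N \<in> Ob C. hull N \<in> Z}"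
proof (intro equalityI subsetI)
  fix N assume "N \<in> quotient_image C Y Z"
  then obtain M where M: "N \<in> Ob C" "M \<in> Z" "isomorphic Q M N"
    unfolding quotient_image_def quotient_functor_sel Q_sel by blast
  have "M \<in> Ob C"
    using Z M(2) unfolding weakly_closed_def by blast
  then have "isomorphic C (hull M) (hull N)"
    using isomorphic_Q_iff M by blast
  from weakly_closed_iso[OF Z isomorphic_sym[OF this] bspec[OF st M(2)]] M(1)
  show "N \<in> {N \<in> Ob C. hull N \<in> Z}" by blast
next
  fix N assume "N \<in> {N \<in> Ob C. hull N \<in> Z}"
  then have N: "N \<in> Ob C" "hull N \<in> Z" by blast+
  from category.isomorphic_sym[OF category_Q isomorphic_Q_hull[OF N(1)]] N
  show "N \<in> quotient_image C Y Z"
    unfolding quotient_image_def quotient_functor_sel Q_sel by blast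
qed

text \<open>Monics of X/Y become monics between envelopes. Epics and direct sums do not pass over so
  directly; there stability of \<open>Z\<close> under \<open>hull\<close> corrects the discrepancy
  modulo Y.\<close>

lemma weakly_closed_hull_preimage:
  assumes Z: "weakly_closed U C Z" and st: "\<forall>M\<in>Z. hull M \<in> Z"
  shows "weakly_closed U Q {N \<in> Ob C. hull N \<in> Z}"
  unfolding weakly_closed_def
proof (intro conjI allI impI)
  interpret Q: category Q by (rule category_Q)
  show "{N \<in> Ob C. hull N \<in> Z} \<subseteq> Ob Q"
    unfolding Q_sel by blast
next
  fix A B c assume c: "monic Q A B c" and B: "B \<in> {N \<in> Ob C. hull N \<in> Z}"
  then have "c \<in> Hom Q A B" unfolding monic_def by blast
  then obtain h where h: "A \<in> Ob C" "B \<in> Ob C" "arr h" "src h = A" "tgt h = hull B" "c = roof_set A B h"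
    unfolding Hom_Q by blast
  have "mon C (ext h)"
    by (rule monic_Q_ext[OF c[unfolded h(6)] h(3-5,2)])
  then have "monic C (hull A) (hull B) (ext h)"
    unfolding monic_iff using ext[OF h(3,5,2)] h(4) by simp
  from weakly_closed_sub[OF Z this] B h(1) show "A \<in> {N \<in> Ob C. hull N \<in> Z}" by blast
next
  fix A B c assume c: "epic Q A B c" and A: "A \<in> {N \<in> Ob C. hull N \<in> Z}"
  then have "c \<in> Hom Q A B" unfolding epic_def by blast
  then obtain h where h: "A \<in> Ob C" "B \<in> Ob C" "arr h" "src h = A" "tgt h = hull B" "c = roof_set A B h"
    unfolding Hom_Q by blast
  note e = ext[OF h(3,5,2), unfolded h(4)] and a = hull[OF h(1)] and b = hull[OF h(2)]
  have "Yepi C Y (ext h \<odot> \<eta> A)"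
    unfolding e(4) by (rule epic_Q_Yepi[OF c[unfolded h(6)] h(3-5,2)])
  then have eY: "Yepi C Y (ext h)"
    by (rule Yepi_first) (use e a in simp_all)
  \<comment> \<open>\<open>hull A \<rightarrow> hull B\<close> is epic only modulo Y. Its image is a
    quotient of \<open>hull A\<close>, so it and its envelope lie in \<open>Z\<close>; the inclusion
    of the image in \<open>hull B\<close> is in \<open>qi\<close>, so that envelope is isomorphic to
    \<open>hull B\<close>.\<close>
  obtain m p where m: "mon C m" "epi C p" "src m = tgt p" "m \<odot> p = ext h" "src p = src (ext h)" "tgt m = tgt (ext h)"
    using image[OF e(1)] by blast
  have "epic C (hull A) (tgt p) p"
    unfolding epic_iff using m e by simp
  from weakly_closed_quot[OF Z this] A have pZ: "hull (tgt p) \<in> Z"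
    using st by blast
  have "Yepi C Y (m \<odot> p)"
    using eY m(4) by simp
  then have "Yepi C Y m"
    by (rule Yepi_first) (use m in simp_all)
  with mon_Ymon[OF m(1)] have "qi m"
    unfolding qi_def by blast
  from qi_isomorphic_hull[OF this] have "isomorphic C (hull (tgt p)) (hull (hull B))"
    using m(3,6) e(3) by simp
  moreover have "isomorphic C (hull B) (hull (hull B))"
    using qi_isomorphic_hull[OF b(1)] b by simp
  ultimately have "isomorphic C (hull B) (hull (tgt p))"
    using isomorphic_trans isomorphic_sym by blast
  from weakly_closed_iso[OF Z this pZ] h(2) show "B \<in> {N \<in> Ob C. hull N \<in> Z}" by blast
next
  interpret Q: category Q by (rule category_Q)
  fix I :: "'u set" and M S' \<iota>'
  assume I: "small U I" and M: "\<forall>i\<in>I. M i \<in> {N \<in> Ob C. hull N \<in> Z}" and S': "is_direct_sum Q I M S' \<iota>'"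
  \<comment> \<open>The direct sum in X of the envelopes stands in for the one given in X/Y, to
    which it is isomorphic there.\<close>
  obtain S \<iota> where S: "is_direct_sum C I (\<lambda>i. hull (M i)) S \<iota>"
    using ex_sum[OF I, of "\<lambda>i. hull (M i)"] M hull(6) by blast
  have "S \<in> Z"
    by (rule weakly_closed_sum[OF Z I _ S]) (use M in blast)
  have "isomorphic Q S' S"
    by (rule Q.direct_sum_isomorphic[OF S' direct_sum_Q[OF I S]]) (use M isomorphic_Q_hull in blast)
  moreover have S'O: "S' \<in> Ob C" "S \<in> Ob C"
    using Q.direct_sum_arr(1)[OF S'] direct_sum_arr(1)[OF S] unfolding Q_sel by blast+
  ultimately have "isomorphic C (hull S') (hull S)"
    using isomorphic_Q_iff by blast
  from weakly_closed_iso[OF Z this bspec[OF st \<open>S \<in> Z\<close>]] S'O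
  show "S' \<in> {N \<in> Ob C. hull N \<in> Z}" by blast
qed

lemma rel_weakly_closed_iff:
  "rel_weakly_closed U C Y Z \<longleftrightarrow> weakly_closed U C Z \<and> (\<forall>M\<in>Z. hull M \<in> Z) \<and> Z = tf_quotients Z"
  unfolding rel_weakly_closed_def torsionfree_generated_def
  using essentially_stable_iff generated_tf by metis

lemma torsionfree_part_eq:
  assumes "weakly_closed U Q Z"
  shows "torsionfree_part U C Y (quotient_preimage C Y Z) = tf_quotients Z"
proof -
  have "quotient_preimage C Y Z = Z"
    using assms unfolding quotient_preimage_def quotient_functor_sel weakly_closed_def Q_sel by blast
  with generated_tf[OF weakly_closed_Q_C[OF assms]] show ?thesis
    unfolding torsionfree_part_def by simp
qed

text \<open>Essential stability holds because \<open>hull M\<close> is isomorphic to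
  \<open>M\<close> in X/Y, so it lies in \<open>Z\<close>, and being torsionfree it is its own
  cover.\<close>

lemma rel_weakly_closed_tf_quotients:
  assumes Z: "weakly_closed U Q Z"
  shows "rel_weakly_closed U C Y (tf_quotients Z)"
  unfolding rel_weakly_closed_iff
proof (intro conjI ballI)
  note W = weakly_closed_Q_C[OF Z]
  show "weakly_closed U C (tf_quotients Z)"
    by (rule weakly_closed_tf_quotients[OF W])
  fix M assume "M \<in> tf_quotients Z"
  then have M: "M \<in> Z" "M \<in> Ob C"
    using tf_quotients_sub[OF W] W unfolding weakly_closed_def by blast+
  show "hull M \<in> tf_quotients Z"
    by (rule tf_quotientsI[OF hull(7)[OF M(2)]]) (use weakly_closed_Q_hull[OF Z M(2)] M(1) in blast)
next
  note W = weakly_closed_Q_C[OF Z]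
  show "tf_quotients Z = tf_quotients (tf_quotients Z)"
  proof (rule equalityI)
    show "tf_quotients Z \<subseteq> tf_quotients (tf_quotients Z)"
    proof
      fix A assume "A \<in> tf_quotients Z"
      then obtain e where e: "epi C e" "src e \<in> Z" "tf (src e)" "A = tgt e"
        unfolding tf_quotients_def by blast
      from tf_quotientsI[OF e(3,2)] e show "A \<in> tf_quotients (tf_quotients Z)"
        unfolding tf_quotients_def[of "tf_quotients Z"] by blast
    qed
    show "tf_quotients (tf_quotients Z) \<subseteq> tf_quotients Z"
      by (rule tf_quotients_sub[OF weakly_closed_tf_quotients[OF W]])
  qed
qed

text \<open>\<open>tf_quotients\<close> sees a class only through its torsionfree members, and on
  these \<open>quotient_image\<close> changes nothing: \<open>\<eta> N\<close> is monic for
  torsionfree \<open>N\<close>.\<close>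

lemma tf_quotients_quotient_image:
  assumes "rel_weakly_closed U C Y Z"
  shows "tf_quotients (quotient_image C Y Z) = Z"
proof -
  have Z: "weakly_closed U C Z" "\<forall>M\<in>Z. hull M \<in> Z" "tf_quotients Z = Z"
    using assms unfolding rel_weakly_closed_iff by blast+
  have "N \<in> quotient_image C Y Z \<longleftrightarrow> N \<in> Z" if N: "tf N" for N
    unfolding quotient_image_eq[OF Z(1,2)]
  proof
    assume h: "N \<in> {N \<in> Ob C. hull N \<in> Z}"
    then have NO: "N \<in> Ob C" by blast
    have "mon C (\<eta> N)"
      using tf_Ymon_mon[of "\<eta> N"] hull[OF NO] N unfolding qi_def by simp
    then have "monic C N (hull N) (\<eta> N)"
      unfolding monic_iff using hull[OF NO] by simp
    from weakly_closed_sub[OF Z(1) this] h show "N \<in> Z" by blast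
  qed (use Z(2) tf_Ob[OF N] in blast)
  then have "tf_quotients (quotient_image C Y Z) = tf_quotients Z"
    unfolding tf_quotients_def by blast
  with Z(3) show ?thesis by simp
qed

lemma quotient_image_tf_quotients:
  assumes Z: "weakly_closed U Q Z"
  shows "quotient_image C Y (tf_quotients Z) = Z"
proof -
  note W = weakly_closed_Q_C[OF Z]
  have r: "weakly_closed U C (tf_quotients Z)" "\<forall>M\<in>tf_quotients Z. hull M \<in> tf_quotients Z"
    using rel_weakly_closed_tf_quotients[OF Z] unfolding rel_weakly_closed_iff by blast+
  have "hull N \<in> tf_quotients Z \<longleftrightarrow> N \<in> Z" if N: "N \<in> Ob C" for N
    using tf_quotientsI[OF hull(7)[OF N]] tf_quotients_sub[OF W] weakly_closed_Q_hull[OF Z N] by blast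
  moreover have "Z \<subseteq> Ob C"
    using W unfolding weakly_closed_def by blast
  ultimately have "{N \<in> Ob C. hull N \<in> tf_quotients Z} = Z"
    by blast
  then show ?thesis
    using quotient_image_eq[OF r] by simp
qed

end

lemma localizing_subcategoryI:
  assumes "universe U" "grothendieck_category U X" "localizing U X Y"
  shows "localizing_subcategory U X Y"
proof -
  interpret grothendieck_category U X by (rule assms(2))
  have wc: "weakly_closed U X Y"
    and ext: "\<And>A B D f g. short_exact X A B D f g \<Longrightarrow> A \<in> Y \<Longrightarrow> D \<in> Y \<Longrightarrow> B \<in> Y"
    using assms(3) unfolding localizing_def by blast+
  have "serre_axioms X Y"
  proof
    show "Y \<subseteq> Ob X"
      using wc unfolding weakly_closed_def by blast
  next
    fix Z assume Z: "zero_object X Z"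
    \<comment> \<open>A zero object is an empty direct sum, which is how Y comes to contain all zero
      objects.\<close>
    have "is_direct_sum X ({} :: 'a set) (\<lambda>_. Z) Z (\<lambda>_. Id X Z)"
      using Z unfolding is_direct_sum_def zero_object_def by blast
    moreover have "small U ({} :: 'a set)"
      using small_finite[OF assms(1)] by blast
    ultimately show "Z \<in> Y"
      using weakly_closed_sum[OF wc] by blast
  next
    fix f assume "mon X f" "Cod X f \<in> Y"
    then show "Dom X f \<in> Y"
      using weakly_closed_sub[OF wc] monic_iff by blast
  next
    fix f assume "epi X f" "Dom X f \<in> Y"
    then show "Cod X f \<in> Y"
      using weakly_closed_quot[OF wc] epic_iff by blast
  next
    fix f g assume fg: "kern X f g" "coker X g f" "Dom X f \<in> Y" "Cod X g \<in> Y"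
    have "short_exact X (Dom X f) (Cod X f) (Cod X g) f g"
      unfolding short_exact_def is_kernel_iff is_cokernel_iff using fg kernD(3)[OF fg(1)] by simp
    from ext[OF this fg(3,4)] show "Cod X f \<in> Y" .
  qed
  moreover have "localizing_subcategory_axioms U X Y"
    using assms(1) weakly_closed_sum[OF wc] by (intro localizing_subcategory_axioms.intro) blast+
  ultimately show ?thesis
    by (intro localizing_subcategory.intro serre.intro assms(2) abelian_category_axioms)
qed

theorem theorem4p3:
  fixes U :: "'u set"
    and X :: "('o, 'm) ab_category"
    and Y :: "'o set"
    and \<phi> \<psi> :: "'o set \<Rightarrow> 'o set"
  assumes "universe U"
    and "grothendieck_category U X"
    and "localizing U X Y"
  defines "\<phi> \<equiv> \<lambda>Z. quotient_image X Y Z"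
    and "\<psi> \<equiv> \<lambda>\<Z>. torsionfree_part U X Y (quotient_preimage X Y \<Z>)"
  shows "bij_betw \<phi> {Z. rel_weakly_closed U X Y Z}
                    {\<Z>. weakly_closed U (gabriel_quotient X Y) \<Z>} \<and>
         bij_betw \<psi> {\<Z>. weakly_closed U (gabriel_quotient X Y) \<Z>}
                    {Z. rel_weakly_closed U X Y Z} \<and>
         (\<forall>Z. rel_weakly_closed U X Y Z \<longrightarrow> \<psi> (\<phi> Z) = Z) \<and>
         (\<forall>\<Z>. weakly_closed U (gabriel_quotient X Y) \<Z> \<longrightarrow> \<phi> (\<psi> \<Z>) = \<Z>)"
proof -
  interpret localizing_subcategory U X Y
    by (rule localizing_subcategoryI[OF assms(1-3)])
  have \<phi>: "weakly_closed U Q (\<phi> Z)" if "rel_weakly_closed U X Y Z" for Z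
  proof -
    have Z: "weakly_closed U X Z" "\<forall>M\<in>Z. hull M \<in> Z"
      using that unfolding rel_weakly_closed_iff by blast+
    have "\<phi> Z = {N \<in> Ob X. hull N \<in> Z}"
      unfolding \<phi>_def by (rule quotient_image_eq[OF Z])
    with weakly_closed_hull_preimage[OF Z] show ?thesis
      by simp
  qed
  have \<psi>: "\<psi> Z = tf_quotients Z" "rel_weakly_closed U X Y (\<psi> Z)" if "weakly_closed U Q Z" for Z
    unfolding \<psi>_def torsionfree_part_eq[OF that] using rel_weakly_closed_tf_quotients[OF that] by simp_all
  have \<psi>\<phi>: "\<psi> (\<phi> Z) = Z" if "rel_weakly_closed U X Y Z" for Z
    using \<psi>(1)[OF \<phi>[OF that]] tf_quotients_quotient_image[OF that] unfolding \<phi>_def by simp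
  have \<phi>\<psi>: "\<phi> (\<psi> Z) = Z" if "weakly_closed U Q Z" for Z
    using \<psi>(1)[OF that] quotient_image_tf_quotients[OF that] unfolding \<phi>_def by simp
  have "bij_betw \<phi> {Z. rel_weakly_closed U X Y Z} {Z. weakly_closed U Q Z}"
    by (rule bij_betw_byWitness[where f' = \<psi>]) (use \<phi> \<psi> \<psi>\<phi> \<phi>\<psi> in blast)+
  moreover have "bij_betw \<psi> {Z. weakly_closed U Q Z} {Z. rel_weakly_closed U X Y Z}"
    by (rule bij_betw_byWitness[where f' = \<phi>]) (use \<phi> \<psi> \<psi>\<phi> \<phi>\<psi> in blast)+
  ultimately show ?thesis
    using \<psi>\<phi> \<phi>\<psi> by blast
qed

end
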